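(* Let $s\in[2/3,1]$ and $p\in[2,\infty]$ satisfy $1/s=1+|1/2-1/p|$, let $Y$ be a Banach space which is a subspace of a quotient (or a quotient of a subspace) of an $L_p(\mu)$-space, and let $T$ be an $s$-nuclear operator in $Y$. Then the spectrum of $T$ is central-symmetric if and only if $\operatorname{trace} T^{2n-1}=0$ for all $n\in\mathbb N$, $n\ge1$.
   Context: Banach spaces are complex; subspaces are closed; $1/\infty=0$. For a Banach space $X$ and $0<s\le1$, $X^*\widehat\otimes_s X$ is the set of elements $u$ of the projective tensor product $X^*\widehat\otimes X$ admitting a representation $u=\sum_{k=1}^\infty x'_k\otimes x_k$ with $x'_k\in X^*$, $x_k\in X$, $\sum_k\|x'_k\|^s\|x_k\|^s<\infty$. Each such $u$ generates the operator $\widetilde u(x)=\sum_k\langle x'_k,x\rangle x_k$ on $X$; operators of this form with $u\in X^*\widehat\otimes_s X$ are called $s$-nuclear. $X$ has the property $AP_s$ if $u\mapsto\widetilde u$ is injective on $X^*\widehat\otimes_s X$. It is known that a space $Y$ as in the claim has $AP_s$ for the given $s$; hence for an $s$-nuclear operator $S$ in $Y$ (in particular for all powers of $T$) the nuclear trace $\operatorname{trace} S:=\sum_k\langle x'_k,x_k\rangle$ is well defined, independently of the representation $S=\sum_k\langle x'_k,\cdot\rangle x_k$ with $\sum_k\|x'_k\|^s\|x_k\|^s<\infty$. The operator $T$ is compact. The spectrum of a compact operator is called central-symmetric if for every nonzero eigenvalue $\lambda$ of it, $-\lambda$ is also an eigenvalue, of the same algebraic multiplicity. *)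

theory Defs
  imports "HOL-Analysis.Analysis"
begin

class complex_normed_vector = real_normed_vector +
  fixes scaleC :: "complex \<Rightarrow> 'a \<Rightarrow> 'a"  (infixr \<open>*\<^sub>C\<close> 75)
  assumes scaleC_add_right: "c *\<^sub>C (x + y) = c *\<^sub>C x + c *\<^sub>C y"
    and scaleC_add_left: "(c + d) *\<^sub>C x = c *\<^sub>C x + d *\<^sub>C x"
    and scaleC_scaleC: "c *\<^sub>C d *\<^sub>C x = (c * d) *\<^sub>C x"
    and scaleC_of_real: "complex_of_real r *\<^sub>C x = r *\<^sub>R x"
    and norm_scaleC: "norm (c *\<^sub>C x) = cmod c * norm x"

class complex_banach = complex_normed_vector + banach

lemma vector_space_scaleC:
  "vector_space (scaleC :: complex \<Rightarrow> 'a \<Rightarrow> 'a::complex_normed_vector)"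
  using scaleC_of_real[of 1, where 'a = 'a]
  by unfold_locales (simp_all add: scaleC_add_right scaleC_add_left scaleC_scaleC)

instantiation complex :: complex_banach
begin

definition scaleC_complex :: "complex \<Rightarrow> complex \<Rightarrow> complex"
  where "scaleC_complex c x = c * x"

instance
  by standard (simp_all add: scaleC_complex_def algebra_simps norm_mult scaleR_conv_of_real)

end

definition bounded_clinear ::
    "('a::complex_normed_vector \<Rightarrow> 'b::complex_normed_vector) \<Rightarrow> bool"
  where "bounded_clinear f \<longleftrightarrow> bounded_linear f \<and> (\<forall>c x. f (c *\<^sub>C x) = c *\<^sub>C f x)"

text \<open>Spaces depending on parameters (an exponent, a measure, a subspace) are not types, so
  they are described by a carrier set, operations and a (semi)norm.  The operations matter
  on the carrier only.\<close>

record 'v cspace =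
  points :: "'v set"
  plus_of :: "'v \<Rightarrow> 'v \<Rightarrow> 'v"
  scale_of :: "complex \<Rightarrow> 'v \<Rightarrow> 'v"
  norm_of :: "'v \<Rightarrow> real"

definition cspace_of_type :: "'a::complex_normed_vector itself \<Rightarrow> 'a cspace"
  where "cspace_of_type _ = \<lparr>points = UNIV, plus_of = (+), scale_of = (*\<^sub>C), norm_of = norm\<rparr>"

definition isometric :: "'v cspace \<Rightarrow> 'w cspace \<Rightarrow> bool"
  where "isometric X Z \<longleftrightarrow> (\<exists>j. bij_betw j (points X) (points Z) \<and>
    (\<forall>x\<in>points X. \<forall>y\<in>points X. j (plus_of X x y) = plus_of Z (j x) (j y)) \<and>
    (\<forall>c. \<forall>x\<in>points X. j (scale_of X c x) = scale_of Z c (j x)) \<and>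
    (\<forall>x\<in>points X. norm_of Z (j x) = norm_of X x))"

definition closed_subspace :: "'v cspace \<Rightarrow> 'v set \<Rightarrow> bool"
  where "closed_subspace X N \<longleftrightarrow> N \<noteq> {} \<and> N \<subseteq> points X \<and>
    (\<forall>x\<in>N. \<forall>y\<in>N. plus_of X x y \<in> N) \<and> (\<forall>c. \<forall>x\<in>N. scale_of X c x \<in> N) \<and>
    (\<forall>x\<in>points X.
       (\<forall>e>0. \<exists>y\<in>N. norm_of X (plus_of X x (scale_of X (-1) y)) < e) \<longrightarrow> x \<in> N)"

definition subspace_cspace :: "'v cspace \<Rightarrow> 'v set \<Rightarrow> 'v cspace"
  where "subspace_cspace X N = X\<lparr>points := N\<rparr>"

definition coset_of :: "'v cspace \<Rightarrow> 'v set \<Rightarrow> 'v \<Rightarrow> 'v set"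
  where "coset_of X N x = plus_of X x ` N"

text \<open>Adding the summand from \<open>N\<close> in the scalar multiplication makes \<open>0\<close> times a coset
  equal to \<open>N\<close> rather than to a singleton.\<close>

definition quotient_cspace :: "'v cspace \<Rightarrow> 'v set \<Rightarrow> 'v set cspace"
  where "quotient_cspace X N =
    \<lparr>points = coset_of X N ` points X,
     plus_of = (\<lambda>C D. {plus_of X x y | x y. x \<in> C \<and> y \<in> D}),
     scale_of = (\<lambda>c C. \<Union>x\<in>C. coset_of X N (scale_of X c x)),
     norm_of = (\<lambda>C. INF x\<in>C. norm_of X x)\<rparr>"

definition Lp_seminorm :: "ennreal \<Rightarrow> 'm measure \<Rightarrow> ('m \<Rightarrow> complex) \<Rightarrow> real"
  where "Lp_seminorm p M f =
    (if p = \<infinity> then Inf {c. 0 \<le> c \<and> (AE x in M. cmod (f x) \<le> c)}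
     else (\<integral>x. cmod (f x) powr enn2real p \<partial>M) powr (1 / enn2real p))"

definition Lp_functions :: "ennreal \<Rightarrow> 'm measure \<Rightarrow> ('m \<Rightarrow> complex) set"
  where "Lp_functions p M = {f \<in> borel_measurable M.
    (if p = \<infinity> then \<exists>c. AE x in M. cmod (f x) \<le> c
     else integrable M (\<lambda>x. cmod (f x) powr enn2real p))}"

definition Lp :: "ennreal \<Rightarrow> 'm measure \<Rightarrow> ('m \<Rightarrow> complex) set cspace"
  where "Lp p M = quotient_cspace
    \<lparr>points = Lp_functions p M, plus_of = (\<lambda>f g x. f x + g x),
     scale_of = (\<lambda>c f x. c * f x), norm_of = Lp_seminorm p M\<rparr>
    {f \<in> borel_measurable M. AE x in M. f x = 0}"

definition is_subspace_of_quotient :: "'v cspace \<Rightarrow> 'w cspace \<Rightarrow> bool"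
  where "is_subspace_of_quotient Y X \<longleftrightarrow>
    (\<exists>N U. closed_subspace X N \<and> closed_subspace (quotient_cspace X N) U \<and>
       isometric Y (subspace_cspace (quotient_cspace X N) U))"

definition is_quotient_of_subspace :: "'v cspace \<Rightarrow> 'w cspace \<Rightarrow> bool"
  where "is_quotient_of_subspace Y X \<longleftrightarrow>
    (\<exists>U N. closed_subspace X U \<and> closed_subspace (subspace_cspace X U) N \<and>
       isometric Y (quotient_cspace (subspace_cspace X U) N))"

definition nuclear_rep ::
    "real \<Rightarrow> ('a::complex_banach \<Rightarrow> 'a) \<Rightarrow> (nat \<Rightarrow> 'a \<Rightarrow> complex) \<Rightarrow> (nat \<Rightarrow> 'a) \<Rightarrow> bool"
  where "nuclear_rep s S x' x \<longleftrightarrow>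
    (\<forall>k. bounded_clinear (x' k)) \<and>
    summable (\<lambda>k. onorm (x' k) powr s * norm (x k) powr s) \<and>
    (\<forall>y. (\<lambda>k. x' k y *\<^sub>C x k) sums S y)"

definition nuclear :: "real \<Rightarrow> ('a::complex_banach \<Rightarrow> 'a) \<Rightarrow> bool"
  where "nuclear s S \<longleftrightarrow> (\<exists>x' x. nuclear_rep s S x' x)"

text \<open>Meaningful for \<open>s\<close>-nuclear operators on spaces with the property \<open>AP\<^sub>s\<close>, where the
  value does not depend on the representation.\<close>

definition nuclear_trace :: "real \<Rightarrow> ('a::complex_banach \<Rightarrow> 'a) \<Rightarrow> complex"
  where "nuclear_trace s S = (THE t. \<exists>x' x. nuclear_rep s S x' x \<and> (\<lambda>k. x' k (x k)) sums t)"

definition eigenvalue :: "('a::complex_normed_vector \<Rightarrow> 'a) \<Rightarrow> complex \<Rightarrow> bool"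
  where "eigenvalue T z \<longleftrightarrow> (\<exists>x. x \<noteq> 0 \<and> T x = z *\<^sub>C x)"

text \<open>The root space of a nonzero eigenvalue of a compact operator is finite-dimensional, so
  the convention that \<open>dim\<close> is \<open>0\<close> on infinite-dimensional spaces plays no role there.\<close>

definition algebraic_multiplicity :: "('a::complex_normed_vector \<Rightarrow> 'a) \<Rightarrow> complex \<Rightarrow> nat"
  where "algebraic_multiplicity T z =
    vector_space.dim (scaleC :: complex \<Rightarrow> 'a \<Rightarrow> 'a) (\<Union>n. {x. ((\<lambda>y. T y - z *\<^sub>C y) ^^ n) x = 0})"

definition central_symmetric_spectrum :: "('a::complex_normed_vector \<Rightarrow> 'a) \<Rightarrow> bool"
  where "central_symmetric_spectrum T \<longleftrightarrow> (\<forall>z. z \<noteq> 0 \<and> eigenvalue T z \<longrightarrow>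
    eigenvalue T (- z) \<and> algebraic_multiplicity T (- z) = algebraic_multiplicity T z)"

end

theory Submission
  imports "HOL-Complex_Analysis.Complex_Analysis" "Jordan_Normal_Form.Schur_Decomposition" Defs
begin

text \<open>All of the determinant theory rests on one local property of \<open>Y\<close>: with \<open>\<alpha> = 1 / s - 1\<close>,
  functionals \<open>\<phi>\<^sub>i\<close> and vectors \<open>y\<^sub>j\<close> (\<open>i, j < n\<close>) in the unit balls satisfy
  \<open>\<bar>det (\<phi>\<^sub>i y\<^sub>j)\<bar> \<le> (K n\<^sup>\<alpha>)\<^sup>n\<close>.  A unitary change of the \<open>y\<^sub>j\<close> makes the matrix triangular; it
  preserves the pointwise square function of representatives in \<open>L\<^sub>p\<close>, so that the bound follows
  from the arithmetic-geometric mean inequality and power mean inequalities.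

  Write \<open>T = \<Sum>\<^sub>k x'\<^sub>k \<otimes> x\<^sub>k\<close>.  The Fredholm determinant is the power series with logarithmic
  derivative \<open>- \<Sum>\<^sub>n trace T\<^sup>n z\<^bsup>n-1\<^esup>\<close>; it is the limit of the determinants of the finite sections
  of the matrix \<open>1 - z (x'\<^sub>i x\<^sub>j)\<close>.  The coefficients of the latter are sums of principal minors, and the
  bound above makes the limit an entire function of exponential type zero.  For a representation
  of the zero operator it equals \<open>exp (- z t)\<close> where \<open>t\<close> is the trace, so \<open>t = 0\<close> and the trace is
  well defined.  In general its zeros are the inverse eigenvalues counted with algebraic multiplicity:
  a zero is a limit of inverse eigenvalues of truncations, and subtracting a rank one operator
  removes one eigenvalue and one linear factor.  An entire function of exponential type zero with
  value \<open>1\<close> at \<open>0\<close> is determined by its zeros.  Hence the spectrum is central-symmetric iff the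
  determinant is even, that is, iff its logarithmic derivative is odd.\<close>

section \<open>Finite determinants\<close>

text \<open>The relation 1 / s = 1 + \<alpha> balances two factorials. Let t_k be the product of the
  norms of x'_k and x_k. Summability of t_k^s bounds the sum of the products of t_k over all
  n-element index sets by C \<epsilon>^n / (n!)^(1 + \<alpha>), for every \<epsilon> > 0. The
  determinant bound costs (K n^\<alpha>)^n, which is (n!)^\<alpha> up to a geometric factor. What
  remains is C \<epsilon>^n / n!, and that is exponential type zero.

  Type zero excludes a factor exp (- z t). This is used for the trace of a representation of zero,
  where such a factor is the whole determinant, and for the quotient of two determinants with the
  same zeros, which has no zeros left. The property AP_s is thereby derived along the way.

  The coefficients have two descriptions: as polynomials in the traces, which pass to the limit, and
  as sums of principal minors, which can be estimated. No product over all eigenvalues and no trace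
  formula is formed: eigenvalues are split off one at a time, and the finite dimension of the root
  spaces comes out of that induction.\<close>

definition minor :: "(nat \<Rightarrow> nat \<Rightarrow> 'a::comm_ring_1) \<Rightarrow> nat set \<Rightarrow> 'a"
  where "minor M S = (\<Sum>p | p permutes S. of_int (sign p) * (\<Prod>i\<in>S. M i (p i)))"

lemma permutes_atLeastLessThan_less: "p permutes {0..<n} \<Longrightarrow> i < n \<Longrightarrow> p i < (n::nat)"
  using permutes_in_image[of p "{0..<n}" i] by simp

text \<open>Conjugation by any enumeration \<open>e\<close> of \<open>S\<close> matches permutations
  of \<open>S\<close> with permutations of \<open>{0..<n}\<close> and keeps signs, so
  \<open>e\<close> need not be monotone. Index sets suit the expansion of a determinant, the matrix
  form suits the determinant bound.\<close>

lemma minor_bij_betw: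
  assumes e: "bij_betw e {0..<n} S"
  shows "minor M S = det (mat n n (\<lambda>(i,j). M (e i) (e j)))"
proof -
  have inj: "inj_on e {0..<n}" using e by (rule bij_betw_imp_inj_on)
  define e' where "e' = inv_into {0..<n} e"
  have e': "bij_betw e' S {0..<n}" unfolding e'_def using e by (rule bij_betw_inv_into)
  have "minor M S = (\<Sum>p | p permutes {0..<n}. of_int (sign p) * (\<Prod>i\<in>{0..<n}. M (e i) (e (p i))))"
    unfolding minor_def
  proof (rule sum.reindex_bij_witness[where i = "map_permutation {0..<n} e" and j = "map_permutation S e'"])
    fix p assume "p \<in> {p. p permutes S}"
    then have p: "p permutes S" by simp
    have 1: "map_permutation {0..<n} e (map_permutation S e' p) = map_permutation S (e \<circ> e') p"
      by (rule map_permutation_compose[OF e' inj])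
    also have "\<dots> = map_permutation S id p"
      by (rule map_permutation_cong) (use p e bij_betw_imp_inj_on[OF bij_betw_trans[OF e' e]]
          in \<open>auto simp: e'_def f_inv_into_f bij_betw_def\<close>)
    finally show 2: "map_permutation {0..<n} e (map_permutation S e' p) = p" using p by simp
    show 3: "map_permutation S e' p \<in> {p. p permutes {0..<n}}"
      using map_permutation_permutes[OF e' p] by simp
    have "sign (map_permutation {0..<n} e (map_permutation S e' p)) = sign (map_permutation S e' p)"
      by (rule sign_map_permutation) (use 3 inj in auto)
    then have s: "sign (map_permutation S e' p) = sign p" by (simp add: 2)
    have "e (map_permutation S e' p i) = p (e i)" if "i \<in> {0..<n}" for i
    proof -
      have "e i \<in> S" using e that by (auto simp: bij_betw_def)
      moreover have "map_permutation {0..<n} e (map_permutation S e' p) (e i) = e (map_permutation S e' p i)"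
        using that inj unfolding map_permutation_def[of "{0..<n}"] by (simp add: restrict_id_def)
      ultimately show ?thesis by (simp add: 2)
    qed
    then have "(\<Prod>i\<in>{0..<n}. M (e i) (e (map_permutation S e' p i))) = (\<Prod>i\<in>{0..<n}. M (e i) (p (e i)))"
      by simp
    also have "\<dots> = (\<Prod>i\<in>S. M i (p i))"
      by (rule prod.reindex_bij_betw[OF e])
    finally show "of_int (sign (map_permutation S e' p)) * (\<Prod>i\<in>{0..<n}. M (e i) (e (map_permutation S e' p i))) =
        of_int (sign p) * (\<Prod>i\<in>S. M i (p i))" by (simp add: s)
  next
    fix p assume "p \<in> {p. p permutes {0..<n}}"
    then have p: "p permutes {0..<n}" by simp
    show "map_permutation {0..<n} e p \<in> {p. p permutes S}"
      using map_permutation_permutes[OF e p] by simp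
    have "map_permutation S e' (map_permutation {0..<n} e p) = map_permutation {0..<n} (e' \<circ> e) p"
      by (rule map_permutation_compose[OF e bij_betw_imp_inj_on[OF e']])
    also have "\<dots> = map_permutation {0..<n} id p"
      by (rule map_permutation_cong) (use p inj bij_betw_imp_inj_on[OF bij_betw_trans[OF e e']] in \<open>auto simp: e'_def\<close>)
    finally show "map_permutation S e' (map_permutation {0..<n} e p) = p" using p by simp
  qed
  also have "\<dots> = det (mat n n (\<lambda>(i,j). M (e i) (e j)))"
    by (subst det_def'[of _ n])
       (auto intro!: sum.cong prod.cong simp: permutes_atLeastLessThan_less)
  finally show ?thesis .
qed

text \<open>Multiplying out the product over the rows chooses the set \<open>S\<close> of rows that
  contribute - z M; the other rows contribute the identity matrix, which kills every permutation
  moving a point outside \<open>S\<close>.\<close>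

lemma det_one_minus_smult:
  fixes M :: "nat \<Rightarrow> nat \<Rightarrow> complex"
  shows "det (mat N N (\<lambda>(i,j). (if i = j then 1 else 0) - z * M i j))
       = (\<Sum>S\<in>Pow {0..<N}. (- z) ^ card S * minor M S)"
proof -
  define d where "d = (\<lambda>i j::nat. if i = j then 1 else 0 :: complex)"
  have "det (mat N N (\<lambda>(i,j). (if i = j then 1 else 0) - z * M i j))
      = (\<Sum>p | p permutes {0..<N}. of_int (sign p) * (\<Prod>i\<in>{0..<N}. (- z) * M i (p i) + d i (p i)))"
    by (subst det_def'[of _ N])
       (auto intro!: sum.cong prod.cong simp: permutes_atLeastLessThan_less d_def)
  also have "\<dots> = (\<Sum>p | p permutes {0..<N}. \<Sum>S\<in>Pow {0..<N}. of_int (sign p) *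
       ((\<Prod>i\<in>S. (- z) * M i (p i)) * (\<Prod>i\<in>{0..<N}-S. d i (p i))))"
    by (simp only: prod_add[OF finite_atLeastLessThan] sum_distrib_left)
  also have "\<dots> = (\<Sum>S\<in>Pow {0..<N}. \<Sum>p | p permutes {0..<N}. of_int (sign p) *
       ((\<Prod>i\<in>S. (- z) * M i (p i)) * (\<Prod>i\<in>{0..<N}-S. d i (p i))))"
    by (rule sum.swap)
  also have "\<dots> = (\<Sum>S\<in>Pow {0..<N}. (- z) ^ card S * minor M S)"
  proof (rule sum.cong[OF refl])
    fix S assume "S \<in> Pow {0..<N}"
    then have S: "S \<subseteq> {0..<N}" by simp
    have "(\<Sum>p | p permutes {0..<N}. of_int (sign p) *
       ((\<Prod>i\<in>S. (- z) * M i (p i)) * (\<Prod>i\<in>{0..<N}-S. d i (p i))))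
       = (\<Sum>p | p permutes S. of_int (sign p) *
       ((\<Prod>i\<in>S. (- z) * M i (p i)) * (\<Prod>i\<in>{0..<N}-S. d i (p i))))"
    proof (rule sum.mono_neutral_right)
      show "finite {p. p permutes {0..<N}}" by (simp add: finite_permutations)
      show "{p. p permutes S} \<subseteq> {p. p permutes {0..<N}}" using permutes_subset S by blast
      show "\<forall>p\<in>{p. p permutes {0..<N}} - {p. p permutes S}.
        of_int (sign p) * ((\<Prod>i\<in>S. - z * M i (p i)) * (\<Prod>i\<in>{0..<N} - S. d i (p i))) = 0"
      proof
        fix p assume p: "p \<in> {p. p permutes {0..<N}} - {p. p permutes S}"
        then obtain i where i: "i \<in> {0..<N} - S" "p i \<noteq> i"
          by (metis (no_types, lifting) DiffE mem_Collect_eq permutes_superset)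
        then have "d i (p i) = 0" by (simp add: d_def)
        then have "(\<Prod>i\<in>{0..<N} - S. d i (p i)) = 0"
          using i(1) by (intro prod_zero) auto
        then show "of_int (sign p) * ((\<Prod>i\<in>S. - z * M i (p i)) * (\<Prod>i\<in>{0..<N} - S. d i (p i))) = 0"
          by simp
      qed
    qed
    also have "\<dots> = (\<Sum>p | p permutes S. of_int (sign p) * ((- z) ^ card S * (\<Prod>i\<in>S. M i (p i))))"
    proof (rule sum.cong[OF refl])
      fix p assume "p \<in> {p. p permutes S}"
      then have "(\<Prod>i\<in>{0..<N} - S. d i (p i)) = 1"
        by (intro prod.neutral) (auto simp: d_def permutes_not_in)
      then show "of_int (sign p) * ((\<Prod>i\<in>S. (- z) * M i (p i)) * (\<Prod>i\<in>{0..<N}-S. d i (p i)))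
         = of_int (sign p) * ((- z) ^ card S * (\<Prod>i\<in>S. M i (p i)))"
        by (simp only: prod.distrib prod_constant)  simp
    qed
    also have "\<dots> = (- z) ^ card S * minor M S"
      by (simp add: minor_def sum_distrib_left mult.left_commute)
    finally show "(\<Sum>p | p permutes {0..<N}. of_int (sign p) *
       ((\<Prod>i\<in>S. (- z) * M i (p i)) * (\<Prod>i\<in>{0..<N}-S. d i (p i)))) = (- z) ^ card S * minor M S" .
  qed
  finally show ?thesis .
qed

section \<open>Triangular form: traces of powers and determinants from one list of
  eigenvalues\<close>

lemma upper_triangular_mult:
  fixes A B :: "complex mat"
  assumes A: "A \<in> carrier_mat n n" "upper_triangular A" and B: "B \<in> carrier_mat n n" "upper_triangular B"
  shows "upper_triangular (A * B)" "i < n \<Longrightarrow> (A * B) $$ (i,i) = A $$ (i,i) * B $$ (i,i)"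
proof -
  have 0: "A $$ (i,k) * B $$ (k,j) = 0" if "i < n" "k < n" "j \<le> i" "k \<noteq> i \<or> j < i" for i j k
  proof (cases "k < i")
    case True
    then have "A $$ (i,k) = 0" using A that by auto
    then show ?thesis by simp
  next
    case False
    then have "j < k" using that by auto
    then have "B $$ (k,j) = 0" using B that by auto
    then show ?thesis by simp
  qed
  show "upper_triangular (A * B)"
  proof (rule upper_triangularI)
    fix i j assume ij: "j < i" "i < dim_row (A * B)"
    then have "(A * B) $$ (i,j) = (\<Sum>k\<in>{0..<n}. A $$ (i,k) * B $$ (k,j))"
      using A B by (simp add: scalar_prod_def)
    also have "\<dots> = 0" using 0 ij A by (intro sum.neutral) auto
    finally show "(A * B) $$ (i,j) = 0" .
  qed
  show "(A * B) $$ (i,i) = A $$ (i,i) * B $$ (i,i)" if i: "i < n"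
  proof -
    have "(A * B) $$ (i,i) = (\<Sum>k\<in>{0..<n}. A $$ (i,k) * B $$ (k,i))"
      using A B i by (simp add: scalar_prod_def)
    also have "\<dots> = (\<Sum>k\<in>{i}. A $$ (i,k) * B $$ (k,i))"
      using 0 i by (intro sum.mono_neutral_right) auto
    finally show ?thesis by simp
  qed
qed

lemma sum_diag_mult_commute:
  fixes A B :: "complex mat"
  assumes "A \<in> carrier_mat n n" "B \<in> carrier_mat n n"
  shows "(\<Sum>i<n. (A * B) $$ (i,i)) = (\<Sum>i<n. (B * A) $$ (i,i))"
proof -
  have "(\<Sum>i<n. (A * B) $$ (i,i)) = (\<Sum>i<n. \<Sum>k<n. A $$ (i,k) * B $$ (k,i))"
    using assms by (simp add: scalar_prod_def atLeast0LessThan)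
  also have "\<dots> = (\<Sum>k<n. \<Sum>i<n. B $$ (k,i) * A $$ (i,k))"
    by (subst sum.swap) (simp add: mult.commute)
  also have "\<dots> = (\<Sum>i<n. (B * A) $$ (i,i))"
    using assms by (simp add: scalar_prod_def atLeast0LessThan)
  finally show ?thesis .
qed

text \<open>The diagonal of one Schur form serves both formulas. This common list is what links the
  traces of the powers to the coefficients of the determinant.\<close>

lemma exists_eigenvalue_list:
  fixes A :: "complex mat"
  assumes A: "A \<in> carrier_mat n n"
  shows "\<exists>b. (\<forall>k. (\<Sum>i<n. (A ^\<^sub>m k) $$ (i,i)) = (\<Sum>i<n. b i ^ k)) \<and>
             (\<forall>z. det (1\<^sub>m n - z \<cdot>\<^sub>m A) = (\<Prod>i<n. 1 - z * b i))"
proof -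
  obtain as where "char_poly A = (\<Prod>a\<leftarrow>as. [:- a, 1:])" using char_poly_factorized[OF A] by blast
  from schur_decomposition_exists[OF A this] obtain B P Q where
    B: "B \<in> carrier_mat n n" "upper_triangular B" and sim: "similar_mat_wit A B P Q"
    unfolding similar_mat_def by blast
  have c: "P \<in> carrier_mat n n" "Q \<in> carrier_mat n n" and PQ: "P * Q = 1\<^sub>m n" "Q * P = 1\<^sub>m n" and APBQ: "A = P * B * Q"
    using similar_mat_witD2[OF A sim] by auto
  have Bk: "upper_triangular (B ^\<^sub>m k) \<and> (\<forall>i<n. (B ^\<^sub>m k) $$ (i,i) = (B $$ (i,i)) ^ k)" for k
  proof (induction k)
    case 0
    show ?case using B by simp
  next
    case (Suc k)
    have "B ^\<^sub>m k \<in> carrier_mat n n" using B by simp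
    then show ?case using upper_triangular_mult[of "B ^\<^sub>m k" n B] B Suc by (simp add: mult.commute)
  qed
  have tr: "(\<Sum>i<n. (A ^\<^sub>m k) $$ (i,i)) = (\<Sum>i<n. (B $$ (i,i)) ^ k)" for k
  proof -
    have Bc: "B ^\<^sub>m k \<in> carrier_mat n n" using B by simp
    have "A ^\<^sub>m k = P * B ^\<^sub>m k * Q" by (rule similar_mat_wit_pow_id[OF sim])
    then have "(\<Sum>i<n. (A ^\<^sub>m k) $$ (i,i)) = (\<Sum>i<n. (Q * (P * B ^\<^sub>m k)) $$ (i,i))"
      using sum_diag_mult_commute[of "P * B ^\<^sub>m k" n Q] Bc c by simp
    also have "Q * (P * B ^\<^sub>m k) = B ^\<^sub>m k"
      using Bc c PQ by (simp add: left_mult_one_mat[OF Bc] flip: assoc_mult_mat[of Q n n P n _ n])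
    finally show ?thesis using Bk by simp
  qed
  have dt: "det (1\<^sub>m n - z \<cdot>\<^sub>m A) = (\<Prod>i<n. 1 - z * B $$ (i,i))" for z
  proof -
    define D where "D = 1\<^sub>m n - z \<cdot>\<^sub>m B"
    have D: "D \<in> carrier_mat n n" using B by (auto simp: D_def)
    have "1\<^sub>m n - z \<cdot>\<^sub>m A = P * D * Q"
    proof -
      have "P * D = P - z \<cdot>\<^sub>m (P * B)"
        unfolding D_def using c B by (subst mult_minus_distrib_mat[of _ n n _ n]) auto
      then have "P * D * Q = P * Q - (z \<cdot>\<^sub>m (P * B)) * Q"
        using c B by (simp add: minus_mult_distrib_mat[of _ n n _ _ n])
      also have "(z \<cdot>\<^sub>m (P * B)) * Q = z \<cdot>\<^sub>m A"
        using c B unfolding APBQ by (intro mult_smult_assoc_mat[of _ n n _ n]) auto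
      finally show ?thesis by (simp add: PQ)
    qed
    then have "det (1\<^sub>m n - z \<cdot>\<^sub>m A) = det P * det D * det Q"
      using det_mult[of "P * D" n Q] det_mult[of P n D] c D by simp
    also have "\<dots> = det D" using det_mult[OF c] PQ(1) by (simp add: mult_ac)
    also have "\<dots> = prod_list (diag_mat D)"
      by (rule det_upper_triangular[OF _ D]) (use B in \<open>auto simp: D_def upper_triangular_def\<close>)
    also have "\<dots> = (\<Prod>i<n. 1 - z * B $$ (i,i))"
      using B D by (simp add: diag_mat_def prod.list_conv_set_nth atLeast0LessThan D_def)
    finally show ?thesis .
  qed
  show ?thesis by (intro exI[of _ "\<lambda>i. B $$ (i,i)"] conjI allI tr dt)
qed

text \<open>These are n - 1 homogeneous linear conditions in n unknowns: replacing row
  \<open>k\<close> by zeros makes the matrix singular, and a kernel vector is scaled to length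
  1.\<close>

lemma exists_annihilated_vector:
  fixes B :: "nat \<Rightarrow> nat \<Rightarrow> complex"
  assumes "k < n"
  obtains v where "(\<Sum>j<n. cmod (v j) ^ 2) = 1" "\<And>i. i < n \<Longrightarrow> i \<noteq> k \<Longrightarrow> (\<Sum>j<n. B i j * v j) = 0"
proof -
  define A where "A = mat n n (\<lambda>(i,j). if i = k then 0 else B i j)"
  have A: "A \<in> carrier_mat n n" by (simp add: A_def)
  have "det A = 0"
  proof -
    have "(\<Prod>i = 0..<n. A $$ (i, p i)) = 0" if "p permutes {0..<n}" for p
    proof (rule prod_zero)
      have "p k < n" using permutes_in_image[OF that, of k] assms by simp
      then show "\<exists>a\<in>{0..<n}. A $$ (a, p a) = 0"
        using assms by (intro bexI[of _ k]) (auto simp: A_def)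
    qed simp
    then show ?thesis
      unfolding det_def'[OF A] by (intro sum.neutral ballI) (simp only: mem_Collect_eq mult_zero_right)
  qed
  then obtain v where v: "v \<in> carrier_vec n" "v \<noteq> 0\<^sub>v n" "A *\<^sub>v v = 0\<^sub>v n"
    using det_0_iff_vec_prod_zero[OF A] by blast
  define u where "u = vec_index v"
  have ann: "(\<Sum>j<n. B i j * u j) = 0" if "i < n" "i \<noteq> k" for i
  proof -
    have "vec_index (A *\<^sub>v v) i = 0" using v(3) that by simp
    then show ?thesis using that v(1)
      by (simp add: A_def scalar_prod_def u_def atLeast0LessThan)
  qed
  define c where "c = (\<Sum>j<n. cmod (u j) ^ 2)"
  have "\<exists>j<n. u j \<noteq> 0"
    using v(1,2) by (auto simp: u_def vec_eq_iff)
  then have "c > 0"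
    unfolding c_def by (auto intro!: sum_pos2)
  show thesis
  proof (rule that[of "\<lambda>j. u j / sqrt c"])
    show "(\<Sum>j<n. cmod (u j / complex_of_real (sqrt c)) ^ 2) = 1"
      using \<open>c > 0\<close> by (simp add: norm_divide power_divide flip: sum_divide_distrib c_def)
    show "(\<Sum>j<n. B i j * (u j / complex_of_real (sqrt c))) = 0" if "i < n" "i \<noteq> k" for i
      using ann[OF that] by (simp flip: sum_divide_distrib)
  qed
qed

text \<open>The rows of \<open>q\<close> are chosen from the last one downwards. Row
  \<open>k\<close> must be annihilated by the \<open>k\<close> rows of \<open>A\<close> before it
  and be orthogonal to the n - 1 - k rows already chosen, which leaves room for a unit vector. The
  conjugates in the system express orthogonality.\<close>

lemma exists_triangularising_frame:
  fixes A :: "nat \<Rightarrow> nat \<Rightarrow> complex"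
  shows "\<exists>q. (\<forall>k<n. \<forall>l<n. (\<Sum>j<n. q k j * cnj (q l j)) = (if k = l then 1 else 0)) \<and>
             (\<forall>i k. i < k \<and> k < n \<longrightarrow> (\<Sum>j<n. A i j * q k j) = 0)"
proof -
  have "\<exists>q. (\<forall>k\<in>{n-m..<n}. \<forall>l\<in>{n-m..<n}. (\<Sum>j<n. q k j * cnj (q l j)) = (if k = l then 1 else 0)) \<and>
             (\<forall>k\<in>{n-m..<n}. \<forall>i<k. (\<Sum>j<n. A i j * q k j) = 0)" if "m \<le> n" for m
    using that
  proof (induction m)
    case 0
    show ?case by simp
  next
    case (Suc m)
    obtain q where
      q1: "\<And>k l. k \<in> {n-m..<n} \<Longrightarrow> l \<in> {n-m..<n} \<Longrightarrow> (\<Sum>j<n. q k j * cnj (q l j)) = (if k = l then 1 else 0)" and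
      q2: "\<And>k i. k \<in> {n-m..<n} \<Longrightarrow> i < k \<Longrightarrow> (\<Sum>j<n. A i j * q k j) = 0"
      using Suc.IH[OF Suc_leD[OF Suc.prems]] by (elim exE conjE) blast
    define k where "k = n - Suc m"
    have k: "k < n" "n - m = Suc k" using Suc.prems by (auto simp: k_def)
    obtain v where v1: "(\<Sum>j<n. cmod (v j) ^ 2) = 1"
      and v2: "\<And>i. i < n \<Longrightarrow> i \<noteq> k \<Longrightarrow> (\<Sum>j<n. (if i < k then A i j else cnj (q i j)) * v j) = 0"
      using exists_annihilated_vector[OF k(1), of "\<lambda>i j. if i < k then A i j else cnj (q i j)"] by blast
    have vv: "(\<Sum>j<n. v j * cnj (v j)) = 1"
      using v1 by (simp only: of_real_sum of_real_1 flip: complex_norm_square of_real_eq_1_iff[where 'a = complex])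
    have vq: "(\<Sum>j<n. v j * cnj (q l j)) = 0" if "l \<in> {Suc k..<n}" for l
      using v2[of l] that by (simp add: mult.commute)
    have qv: "(\<Sum>j<n. q l j * cnj (v j)) = 0" if "l \<in> {Suc k..<n}" for l
    proof -
      have "cnj (\<Sum>j<n. v j * cnj (q l j)) = 0" using vq[OF that] by simp
      then show ?thesis by (simp add: mult.commute)
    qed
    have vA: "(\<Sum>j<n. A i j * v j) = 0" if "i < k" for i
      using v2[of i] that k by simp
    have set: "{n - Suc m..<n} = insert k {Suc k..<n}" using k by (auto simp: k_def)
    show ?case unfolding set
    proof (intro exI[of _ "q(k := v)"] conjI ballI allI impI)
      fix k' l assume "k' \<in> insert k {Suc k..<n}" "l \<in> insert k {Suc k..<n}"
      then show "(\<Sum>j<n. (q(k := v)) k' j * cnj ((q(k := v)) l j)) = (if k' = l then 1 else 0)"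
        using q1[unfolded k(2)] vv vq qv by auto
    next
      fix k' i assume "k' \<in> insert k {Suc k..<n}" "i < k'"
      then show "(\<Sum>j<n. A i j * (q(k := v)) k' j) = 0"
        using q2[unfolded k(2)] vA by auto
    qed
  qed
  from this[of n] obtain q where
      "\<forall>k\<in>{0..<n}. \<forall>l\<in>{0..<n}. (\<Sum>j<n. q k j * cnj (q l j)) = (if k = l then 1 else 0)"
      "\<forall>k\<in>{0..<n}. \<forall>i<k. (\<Sum>j<n. A i j * q k j) = 0"
    by auto
  then show ?thesis by (intro exI[of _ q]) simp
qed

lemma orthonormal_columns:
  fixes q :: "nat \<Rightarrow> nat \<Rightarrow> complex"
  assumes "\<And>k l. k < n \<Longrightarrow> l < n \<Longrightarrow> (\<Sum>j<n. q k j * cnj (q l j)) = (if k = l then 1 else 0)"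
  assumes "i < n" "j < n"
  shows "(\<Sum>k<n. cnj (q k i) * q k j) = (if i = j then 1 else 0)"
proof -
  define Q where "Q = mat n n (\<lambda>(k,j). q k j)"
  define R where "R = mat n n (\<lambda>(j,k). cnj (q k j))"
  have c: "Q \<in> carrier_mat n n" "R \<in> carrier_mat n n" by (auto simp: Q_def R_def)
  have "Q * R = 1\<^sub>m n"
    by (rule eq_matI) (auto simp: Q_def R_def scalar_prod_def atLeast0LessThan assms(1))
  then have "R * Q = 1\<^sub>m n" using mat_mult_left_right_inverse c by blast
  then have "(R * Q) $$ (i,j) = 1\<^sub>m n $$ (i,j)" by simp
  then show ?thesis using assms(2,3)
    by (simp add: Q_def R_def scalar_prod_def atLeast0LessThan)
qed

lemma orthonormal_Parseval:
  fixes q :: "nat \<Rightarrow> nat \<Rightarrow> complex"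
  assumes "\<And>k l. k < n \<Longrightarrow> l < n \<Longrightarrow> (\<Sum>j<n. q k j * cnj (q l j)) = (if k = l then 1 else 0)"
  shows "(\<Sum>k<n. cmod (\<Sum>j<n. q k j * f j) ^ 2) = (\<Sum>j<n. cmod (f j) ^ 2)"
proof -
  have "complex_of_real (\<Sum>k<n. cmod (\<Sum>j<n. q k j * f j) ^ 2)
      = (\<Sum>k<n. (\<Sum>j<n. q k j * f j) * cnj (\<Sum>i<n. q k i * f i))"
    unfolding of_real_sum complex_norm_square ..
  also have "\<dots> = (\<Sum>k<n. \<Sum>j<n. \<Sum>i<n. (f j * cnj (f i)) * (cnj (q k i) * q k j))"
    by (simp add: sum_product algebra_simps)
  also have "\<dots> = (\<Sum>j<n. \<Sum>k<n. \<Sum>i<n. (f j * cnj (f i)) * (cnj (q k i) * q k j))"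
    by (rule sum.swap)
  also have "\<dots> = (\<Sum>j<n. \<Sum>i<n. (f j * cnj (f i)) * (\<Sum>k<n. cnj (q k i) * q k j))"
    by (rule sum.cong[OF refl], subst sum.swap) (simp add: sum_distrib_left)
  also have "\<dots> = (\<Sum>j<n. \<Sum>i<n. (f j * cnj (f i)) * (if i = j then 1 else 0))"
    by (intro sum.cong refl, subst orthonormal_columns[OF assms]) auto
  also have "\<dots> = (\<Sum>j<n. f j * cnj (f j))"
    by (intro sum.cong refl) (simp add: if_distrib cong: if_cong)
  also have "\<dots> = complex_of_real (\<Sum>j<n. cmod (f j) ^ 2)"
    unfolding of_real_sum complex_norm_square ..
  finally show ?thesis by (simp only: of_real_eq_iff)
qed

text \<open>The hypothesis covers all norm-preserving \<open>q\<close> because the triangularising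
  frame depends on \<open>A\<close>. It is an identity for arbitrary scalars \<open>f\<close> so
  that it can later be applied to the values of functions at each point.\<close>

lemma norm_det_le_power:
  fixes A :: "nat \<Rightarrow> nat \<Rightarrow> complex"
  assumes trace_bound: "\<And>q. (\<And>f. (\<Sum>k<n. cmod (\<Sum>j<n. q k j * f j) ^ 2) = (\<Sum>j<n. cmod (f j) ^ 2)) \<Longrightarrow>
      (\<Sum>i<n. cmod (\<Sum>j<n. A i j * q i j)) \<le> real n * c"
    and "n > 0"
  shows "cmod (det (mat n n (\<lambda>(i,j). A i j))) \<le> c ^ n"
proof -
  obtain q where
    q1: "\<And>k l. k < n \<Longrightarrow> l < n \<Longrightarrow> (\<Sum>j<n. q k j * cnj (q l j)) = (if k = l then 1 else 0)" and
    q2: "\<And>i k. i < k \<Longrightarrow> k < n \<Longrightarrow> (\<Sum>j<n. A i j * q k j) = 0"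
    using exists_triangularising_frame[of n A] by (elim exE conjE) blast
  define a where "a = (\<lambda>i. cmod (\<Sum>j<n. A i j * q i j))"
  define M R L where "M = mat n n (\<lambda>(i,j). A i j)"
    and "R = mat n n (\<lambda>(j,k). q k j)" and "L = mat n n (\<lambda>(i,k). \<Sum>j<n. A i j * q k j)"
  have c: "M \<in> carrier_mat n n" "R \<in> carrier_mat n n" "L \<in> carrier_mat n n"
    by (auto simp: M_def R_def L_def)
  have "M * R = L"
    by (rule eq_matI) (auto simp: M_def R_def L_def scalar_prod_def atLeast0LessThan)
  then have "det M * det R = det L" using det_mult c by metis
  moreover have "det L = (\<Prod>i<n. \<Sum>j<n. A i j * q i j)"
  proof -
    have "det L = prod_list (diag_mat L)"
      by (rule det_lower_triangular[OF _ c(3)]) (auto simp: L_def q2)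
    also have "\<dots> = (\<Prod>i<n. \<Sum>j<n. A i j * q i j)"
      by (simp add: diag_mat_def L_def prod.list_conv_set_nth atLeast0LessThan)
    finally show ?thesis .
  qed
  moreover have "cmod (det R) = 1"
  proof -
    define S where "S = mat n n (\<lambda>(i,j). cnj (q i j))"
    have S: "S \<in> carrier_mat n n" by (simp add: S_def)
    have "S * R = 1\<^sub>m n"
    proof (rule eq_matI)
      fix i j assume ij: "i < dim_row (1\<^sub>m n)" "j < dim_col (1\<^sub>m n)"
      have "(\<Sum>k<n. cnj (q i k) * q j k) = (\<Sum>k<n. q j k * cnj (q i k))" by (simp add: mult.commute)
      then show "(S * R) $$ (i,j) = 1\<^sub>m n $$ (i,j)" using ij
        by (auto simp: S_def R_def scalar_prod_def atLeast0LessThan q1)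
    qed (auto simp: S_def R_def)
    then have "det S * det R = 1" using det_mult[OF S c(2)] by simp
    moreover have "det S = cnj (det R)"
    proof -
      have "S = map_mat cnj (transpose_mat R)" by (rule eq_matI) (auto simp: S_def R_def)
      moreover have "comm_ring_hom cnj" by unfold_locales auto
      ultimately show ?thesis using comm_ring_hom.hom_det[of cnj "transpose_mat R"] det_transpose[OF c(2)] by simp
    qed
    ultimately have "complex_of_real (cmod (det R) ^ 2) = 1"
      by (simp add: complex_norm_square mult.commute del: of_real_power)
    then have "cmod (det R) ^ 2 = 1" by (simp only: of_real_eq_1_iff)
    then show ?thesis by (rule power2_eq_imp_eq[of _ 1, simplified]) simp
  qed
  ultimately have "cmod (det M) * 1 = cmod (\<Prod>i<n. \<Sum>j<n. A i j * q i j)"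
    by (metis norm_mult)
  then have det: "cmod (det M) = (\<Prod>i<n. a i)"
    unfolding a_def prod_norm by simp
  have a0: "a i \<ge> 0" for i by (simp add: a_def)
  have "(\<Prod>i<n. a i) = (\<Prod>i<n. a i powr (1 / real n)) ^ n"
    unfolding prod_power_distrib
  proof (rule prod.cong[OF refl])
    show "a i = (a i powr (1 / real n)) ^ n" for i
      using \<open>n > 0\<close> a0[of i] by (cases "a i = 0") (auto simp: powr_power)
  qed
  also have "\<dots> \<le> ((\<Sum>i<n. a i) / n) ^ n"
    using arith_geom_mean[of "{..<n}" a] \<open>n > 0\<close> a0
    by (intro power_mono prod_nonneg) (auto simp: prod_powr_distrib lessThan_empty_iff sum_divide_distrib)
  also have "\<dots> \<le> c ^ n"
  proof (intro power_mono)
    have "(\<Sum>i<n. a i) \<le> n * c"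
      unfolding a_def by (intro trace_bound orthonormal_Parseval q1)
    then show "(\<Sum>i<n. a i) / n \<le> c" using \<open>n > 0\<close> by (simp add: field_simps)
  qed (simp add: a0 sum_nonneg)
  finally show ?thesis using det by (simp add: M_def)
qed

section \<open>Power series with prescribed logarithmic derivative\<close>

text \<open>Newton's identities, with a shifted index: \<open>\<tau> k\<close> stands for the trace
  of the power \<open>Suc k\<close>. Formally these are the coefficients of the exponential of minus
  the sum of \<tau> k z^(k+1) / (k+1).\<close>

fun fredholm_coeff :: "(nat \<Rightarrow> complex) \<Rightarrow> nat \<Rightarrow> complex" where
  "fredholm_coeff \<tau> 0 = 1"
| "fredholm_coeff \<tau> (Suc n) = - (\<Sum>k\<le>n. \<tau> k * fredholm_coeff \<tau> (n - k)) / of_nat (Suc n)"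

lemma fps_deriv_fredholm_coeff:
  "fps_deriv (Abs_fps (fredholm_coeff \<tau>)) = - (Abs_fps \<tau> * Abs_fps (fredholm_coeff \<tau>))"
proof (rule fps_ext)
  fix n
  have "of_nat (Suc n) * fredholm_coeff \<tau> (Suc n) = - (\<Sum>k\<le>n. \<tau> k * fredholm_coeff \<tau> (n - k))"
    by (simp del: of_nat_Suc)
  then show "fps_nth (fps_deriv (Abs_fps (fredholm_coeff \<tau>))) n =
      fps_nth (- (Abs_fps \<tau> * Abs_fps (fredholm_coeff \<tau>))) n"
    by (simp add: fps_mult_nth atLeast0AtMost del: of_nat_Suc fredholm_coeff.simps)
qed

text \<open>A formal linear differential equation of first order determines each coefficient from
  the earlier ones.\<close>

lemma fredholm_coeff_unique:
  assumes "fps_nth E 0 = 1" "fps_deriv E = - (Abs_fps \<tau> * E)"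
  shows "E = Abs_fps (fredholm_coeff \<tau>)"
proof (rule fps_ext)
  fix n show "fps_nth E n = fps_nth (Abs_fps (fredholm_coeff \<tau>)) n"
  proof (induction n rule: less_induct)
    case (less n)
    show ?case
    proof (cases n)
      case 0
      then show ?thesis using assms by simp
    next
      case (Suc m)
      have "of_nat (Suc m) * fps_nth E (Suc m) = fps_nth (fps_deriv E) m" by simp
      also have "\<dots> = - (\<Sum>k\<le>m. \<tau> k * fps_nth E (m - k))"
        unfolding assms(2) by (simp add: fps_mult_nth atLeast0AtMost)
      also have "\<dots> = - (\<Sum>k\<le>m. \<tau> k * fredholm_coeff \<tau> (m - k))"
        using less Suc by simp
      also have "\<dots> = of_nat (Suc m) * fredholm_coeff \<tau> (Suc m)"
        by (simp del: of_nat_Suc)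
      finally show ?thesis unfolding Suc by (simp del: of_nat_Suc fredholm_coeff.simps)
    qed
  qed
qed

text \<open>One more eigenvalue \<open>c\<close> means one more linear factor. The geometric series
  \<open>G\<close> inverts that factor, and c G is the negative of its logarithmic
  derivative.\<close>

lemma fredholm_coeff_add_power:
  assumes "\<And>k. \<tau> k = \<tau>' k + c ^ Suc k"
  shows "Abs_fps (fredholm_coeff \<tau>) = (1 - fps_const c * fps_X) * Abs_fps (fredholm_coeff \<tau>')"
proof (rule fredholm_coeff_unique[symmetric])
  define E where "E = Abs_fps (fredholm_coeff \<tau>')"
  define G where "G = Abs_fps (\<lambda>k. c ^ k)"
  have G: "(1 - fps_const c * fps_X) * G = 1"
  proof (rule fps_ext)
    fix n show "fps_nth ((1 - fps_const c * fps_X) * G) n = fps_nth 1 n"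
      by (cases n) (simp_all add: G_def algebra_simps)
  qed
  have \<tau>: "Abs_fps \<tau> = Abs_fps \<tau>' + fps_const c * G"
    by (rule fps_ext) (simp add: assms G_def)
  have E: "fps_deriv E = - (Abs_fps \<tau>' * E)" unfolding E_def by (rule fps_deriv_fredholm_coeff)
  define H where "H = 1 - fps_const c * fps_X"
  have "fps_deriv (H * E) = - (fps_const c * E) - H * Abs_fps \<tau>' * E"
    by (simp add: E H_def algebra_simps)
  also have "fps_const c * E = fps_const c * (H * G) * E" using G by (simp add: H_def)
  also have "- (fps_const c * (H * G) * E) - H * Abs_fps \<tau>' * E = - (Abs_fps \<tau> * (H * E))"
    unfolding \<tau> by (simp add: algebra_simps)
  finally show "fps_deriv ((1 - fps_const c * fps_X) * Abs_fps (fredholm_coeff \<tau>'))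
      = - (Abs_fps \<tau> * ((1 - fps_const c * fps_X) * Abs_fps (fredholm_coeff \<tau>')))"
    unfolding E_def H_def .
qed simp

lemma fredholm_coeff_power_sums:
  fixes b :: "nat \<Rightarrow> complex" and N :: nat
  shows "Abs_fps (fredholm_coeff (\<lambda>k. \<Sum>i<N. b i ^ Suc k)) = (\<Prod>i<N. 1 - fps_const (b i) * fps_X)"
proof (induction N)
  case 0
  show ?case by (rule fredholm_coeff_unique[symmetric]) (auto simp: fps_ext)
next
  case (Suc N)
  then show ?case
    by (subst fredholm_coeff_add_power[where \<tau>' = "\<lambda>k. \<Sum>i<N. b i ^ Suc k" and c = "b N"])
       (simp_all add: mult.commute)
qed

text \<open>Both sides are read off det (1 - z A): the left one through the eigenvalue list, the
  right one through the expansion into principal minors. Agreement at every \<open>z\<close> makes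
  the two polynomials equal.\<close>

lemma fredholm_coeff_eq_sum_minors:
  fixes M :: "nat \<Rightarrow> nat \<Rightarrow> complex" and N :: nat
  defines "A \<equiv> mat N N (\<lambda>(i,j). M i j)"
  shows "fredholm_coeff (\<lambda>k. \<Sum>i<N. (A ^\<^sub>m Suc k) $$ (i,i)) n =
    (\<Sum>S | S \<subseteq> {0..<N} \<and> card S = n. (- 1) ^ n * minor M S)"
proof -
  have A: "A \<in> carrier_mat N N" by (simp add: A_def)
  obtain b where b: "\<And>k. (\<Sum>i<N. (A ^\<^sub>m k) $$ (i,i)) = (\<Sum>i<N. b i ^ k)"
    and det: "\<And>z. det (1\<^sub>m N - z \<cdot>\<^sub>m A) = (\<Prod>i<N. 1 - z * b i)"
    using exists_eigenvalue_list[OF A] by blast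
  define p where "p = (\<Sum>S\<in>Pow {0..<N}. Polynomial.monom ((- 1) ^ card S * minor M S) (card S))"
  define q where "q = (\<Prod>i<N. [:1, - b i:])"
  have "poly p z = poly q z" for z
  proof -
    have eq: "1\<^sub>m N - z \<cdot>\<^sub>m A = mat N N (\<lambda>(i,j). (if i = j then 1 else 0) - z * M i j)"
      by (rule eq_matI) (auto simp: A_def)
    have "(\<Prod>i<N. 1 - z * b i) = (\<Sum>S\<in>Pow {0..<N}. (- z) ^ card S * minor M S)"
      using det[of z, symmetric] unfolding eq det_one_minus_smult .
    also have "\<dots> = poly p z"
      by (simp add: p_def poly_sum poly_monom power_minus[of z] mult_ac)
    finally show ?thesis by (simp add: q_def poly_prod)
  qed
  then have "poly p = poly q" by (rule ext)
  then have pq: "p = q" by (rule poly_eq_poly_eq_iff[THEN iffD1])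
  have "Abs_fps (fredholm_coeff (\<lambda>k. \<Sum>i<N. (A ^\<^sub>m Suc k) $$ (i,i))) = (\<Prod>i<N. 1 - fps_const (b i) * fps_X)"
    unfolding b by (rule fredholm_coeff_power_sums)
  also have "\<dots> = fps_of_poly q"
    by (simp add: q_def fps_of_poly_prod fps_of_poly_pCons mult.commute flip: fps_const_neg)
  finally have "fps_nth (Abs_fps (fredholm_coeff (\<lambda>k. \<Sum>i<N. (A ^\<^sub>m Suc k) $$ (i,i)))) n = fps_nth (fps_of_poly q) n"
    by (rule arg_cong)
  then have "fredholm_coeff (\<lambda>k. \<Sum>i<N. (A ^\<^sub>m Suc k) $$ (i,i)) n = coeff p n"
    by (simp only: fps_nth_Abs_fps fps_of_poly_nth pq)
  also have "\<dots> = (\<Sum>S\<in>Pow {0..<N}. if card S = n then (- 1) ^ n * minor M S else 0)"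
    unfolding p_def coeff_sum by (intro sum.cong refl) simp
  also have "\<dots> = (\<Sum>S | S \<subseteq> {0..<N} \<and> card S = n. (- 1) ^ n * minor M S)"
    by (subst sum.inter_filter[symmetric]) (auto intro: sum.cong)
  finally show ?thesis .
qed

text \<open>Each coefficient is a polynomial in finitely many of the traces.\<close>

lemma tendsto_fredholm_coeff:
  assumes "\<And>k. ((\<lambda>N. \<tau> N k) \<longlongrightarrow> \<tau>' k) F"
  shows "((\<lambda>N. fredholm_coeff (\<tau> N) n) \<longlongrightarrow> fredholm_coeff \<tau>' n) F"
proof (induction n rule: less_induct)
  case (less n)
  show ?case
  proof (cases n)
    case (Suc m)
    have "((\<lambda>N. - (\<Sum>k\<le>m. \<tau> N k * fredholm_coeff (\<tau> N) (m - k)) / of_nat (Suc m)) \<longlongrightarrow>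
      - (\<Sum>k\<le>m. \<tau>' k * fredholm_coeff \<tau>' (m - k)) / of_nat (Suc m)) F"
      by (intro tendsto_intros assms less) (auto simp: Suc simp del: of_nat_Suc)
    then show ?thesis by (simp add: Suc del: of_nat_Suc)
  qed simp
qed

text \<open>Even indices of \<open>\<tau>\<close> are traces of odd powers. For even
  \<open>m\<close> the indices \<open>k\<close> and \<open>m - k\<close> have equal parity, so in
  each term of the recursion one factor vanishes, either the trace or the coefficient. In the
  converse only the term k = n survives, with coefficient 1.\<close>

lemma fredholm_coeff_odd_eq_0_iff:
  "(\<forall>n. odd n \<longrightarrow> fredholm_coeff \<tau> n = 0) \<longleftrightarrow> (\<forall>k. even k \<longrightarrow> \<tau> k = 0)"
proof
  assume \<tau>: "\<forall>k. even k \<longrightarrow> \<tau> k = 0"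
  show "\<forall>n. odd n \<longrightarrow> fredholm_coeff \<tau> n = 0"
  proof
    fix n show "odd n \<longrightarrow> fredholm_coeff \<tau> n = 0"
    proof (induction n rule: less_induct)
      case (less n)
      show ?case
      proof
        assume "odd n"
        then obtain m where m: "n = Suc m" "even m" by (cases n) auto
        have "\<tau> k * fredholm_coeff \<tau> (m - k) = 0" if "k \<le> m" for k
          using that \<tau> m less by (cases "even k") auto
        then have "(\<Sum>k\<le>m. \<tau> k * fredholm_coeff \<tau> (m - k)) = 0" by (intro sum.neutral) blast
        then show "fredholm_coeff \<tau> n = 0" by (simp add: m)
      qed
    qed
  qed
next
  assume d: "\<forall>n. odd n \<longrightarrow> fredholm_coeff \<tau> n = 0"
  show "\<forall>k. even k \<longrightarrow> \<tau> k = 0"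
  proof
    fix n show "even n \<longrightarrow> \<tau> n = 0"
    proof (induction n rule: less_induct)
      case (less n)
      show ?case
      proof
        assume n: "even n"
        have "\<tau> k * fredholm_coeff \<tau> (n - k) = 0" if "k < n" for k
          using that d n less by (cases "even k") auto
        then have "(\<Sum>k<n. \<tau> k * fredholm_coeff \<tau> (n - k)) = 0" by (intro sum.neutral) blast
        then have "(\<Sum>k\<le>n. \<tau> k * fredholm_coeff \<tau> (n - k)) = \<tau> n"
          by (simp add: lessThan_Suc_atMost[symmetric])
        moreover have "fredholm_coeff \<tau> (Suc n) = 0"
          using d n by (simp del: fredholm_coeff.simps)
        ultimately show "\<tau> n = 0" by (simp del: of_nat_Suc)
      qed
    qed
  qed
qed

text \<open>The coefficients of exp (- t z). This is the trace sequence of a representation of the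
  zero operator, whose higher powers contribute nothing whatever \<open>t\<close> is.\<close>

lemma fredholm_coeff_only_first_trace:
  "fredholm_coeff (\<lambda>k. if k = 0 then t else 0) n = (- t) ^ n / fact n"
proof (induction n)
  case (Suc n)
  have "(\<Sum>k\<le>n. (if k = 0 then t else 0) * fredholm_coeff (\<lambda>k. if k = 0 then t else 0) (n - k))
     = (\<Sum>k\<in>{0}. (if k = 0 then t else 0) * fredholm_coeff (\<lambda>k. if k = 0 then t else 0) (n - k))"
    by (rule sum.mono_neutral_right) auto
  then have "fredholm_coeff (\<lambda>k. if k = 0 then t else 0) (Suc n) = - (t * ((- t) ^ n / fact n)) / of_nat (Suc n)"
    using Suc by simp
  also have "\<dots> = (- t) ^ Suc n / fact (Suc n)"
    by (simp add: fact_Suc mult.commute del: of_nat_Suc)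
  finally show ?case .
qed simp

text \<open>Under this bound the power series defines an entire function of exponential type zero.\<close>

definition minimal_type :: "(nat \<Rightarrow> complex) \<Rightarrow> bool"
  where "minimal_type c \<longleftrightarrow> (\<forall>\<epsilon>>0. \<exists>C. \<forall>n. cmod (c n) \<le> C * \<epsilon> ^ n / fact n)"

lemma minimal_type_summable_norm:
  assumes "minimal_type c"
  shows "summable (\<lambda>n. norm (c n * z ^ n))"
proof -
  have "\<exists>C. \<forall>n. cmod (c n) \<le> C * 1 ^ n / fact n"
    using assms[unfolded minimal_type_def, THEN spec, of 1] by (rule mp) simp
  then obtain C where C: "\<And>n. cmod (c n) \<le> C * 1 ^ n / fact n" by blast
  have "summable (\<lambda>n. C * (cmod z ^ n / fact n))"
    using summable_exp[of "cmod z"] by (intro summable_mult) (simp add: divide_inverse mult.commute)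
  then show ?thesis
  proof (rule summable_comparison_test')
    show "norm (norm (c n * z ^ n)) \<le> C * (cmod z ^ n / fact n)" for n
      using mult_right_mono[OF C[of n], of "cmod z ^ n"] by (simp add: norm_mult norm_power)
  qed
qed

lemma minimal_type_bound:
  assumes "minimal_type c" "\<epsilon> > 0"
  shows "\<exists>C>0. \<forall>z. cmod (\<Sum>n. c n * z ^ n) \<le> C * exp (\<epsilon> * cmod z)"
proof -
  obtain C0 where C0: "\<And>n. cmod (c n) \<le> C0 * \<epsilon> ^ n / fact n"
    using mp[OF spec[OF assms(1)[unfolded minimal_type_def], of \<epsilon>] assms(2)] by blast
  define C where "C = max C0 1"
  have C: "cmod (c n) \<le> C * \<epsilon> ^ n / fact n" for n
    by (rule order_trans[OF C0]) (use \<open>\<epsilon> > 0\<close> in \<open>auto intro!: divide_right_mono mult_right_mono simp: C_def\<close>)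
  have "cmod (\<Sum>n. c n * z ^ n) \<le> C * exp (\<epsilon> * cmod z)" for z
  proof -
    have s: "(\<lambda>n. C * ((\<epsilon> * cmod z) ^ n / fact n)) sums (C * exp (\<epsilon> * cmod z))"
      using exp_converges[of "\<epsilon> * cmod z"] by (intro sums_mult) (simp add: field_simps)
    have "cmod (\<Sum>n. c n * z ^ n) \<le> (\<Sum>n. norm (c n * z ^ n))"
      by (rule summable_norm[OF minimal_type_summable_norm[OF assms(1)]])
    also have "\<dots> \<le> (\<Sum>n. C * ((\<epsilon> * cmod z) ^ n / fact n))"
    proof (rule suminf_le[OF _ minimal_type_summable_norm[OF assms(1)] sums_summable[OF s]])
      show "norm (c n * z ^ n) \<le> C * ((\<epsilon> * cmod z) ^ n / fact n)" for n
        using mult_right_mono[OF C[of n], of "cmod z ^ n"]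
        by (simp add: norm_mult norm_power power_mult_distrib mult_ac)
    qed
    also have "\<dots> = C * exp (\<epsilon> * cmod z)" using s by (rule sums_unique[symmetric])
    finally show ?thesis .
  qed
  then show ?thesis by (intro exI[of _ C]) (auto simp: C_def)
qed

lemma minimal_type_holomorphic:
  assumes "minimal_type c"
  shows "(\<lambda>z. \<Sum>n. c n * z ^ n) holomorphic_on UNIV"
proof -
  have "(\<lambda>z. \<Sum>n. c n * z ^ n) field_differentiable (at z)" for z
    using termdiffs_strong_converges_everywhere[of c z] minimal_type_summable_norm[OF assms]
    unfolding field_differentiable_def by (blast intro: summable_norm_cancel)
  then show ?thesis by (simp add: holomorphic_on_def field_differentiable_at_within)
qed

text \<open>The function exp (- t z) has type equal to the modulus of \<open>t\<close>; testing with
  half that modulus would bound all powers of 2.\<close>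

lemma minimal_type_exp_imp_0:
  assumes "minimal_type (\<lambda>n. (- t) ^ n / fact n)"
  shows "t = 0"
proof (rule ccontr)
  assume "t \<noteq> 0"
  define e where "e = cmod t / 2"
  have "e > 0" using \<open>t \<noteq> 0\<close> by (simp add: e_def)
  then obtain C where C: "\<And>n. cmod ((- t) ^ n / fact n) \<le> C * e ^ n / fact n"
    using mp[OF spec[OF assms[unfolded minimal_type_def], of e] \<open>e > 0\<close>] by blast
  have "2 ^ n \<le> C" for n
  proof -
    have "cmod t ^ n \<le> C * e ^ n"
      using C[of n] by (simp add: norm_divide norm_power divide_le_cancel)
    then show ?thesis using \<open>e > 0\<close> by (simp add: e_def power_divide field_simps)
  qed
  moreover obtain n where "C < 2 ^ n" using real_arch_pow[of 2 C] by auto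
  ultimately show False by (meson not_le)
qed

lemma minimal_type_LIMSEQ:
  assumes "\<And>n. (\<lambda>N. c N n) \<longlonglongrightarrow> d n"
    and "\<And>\<epsilon>. \<epsilon> > 0 \<Longrightarrow> \<exists>C. \<forall>N n. cmod (c N n) \<le> C * \<epsilon> ^ n / fact n"
  shows "minimal_type d"
  unfolding minimal_type_def
proof (intro allI impI)
  fix \<epsilon> :: real assume "\<epsilon> > 0"
  then obtain C where C: "\<And>N n. cmod (c N n) \<le> C * \<epsilon> ^ n / fact n" using assms(2) by blast
  have "cmod (d n) \<le> C * \<epsilon> ^ n / fact n" for n
    by (rule LIMSEQ_le_const2[OF tendsto_norm[OF assms(1)]]) (use C in blast)
  then show "\<exists>C. \<forall>n. cmod (d n) \<le> C * \<epsilon> ^ n / fact n" by blast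
qed

section \<open>Entire functions of exponential type zero\<close>

text \<open>The order of vanishing at a point \<open>a \<noteq> 0\<close>, normalised so that the factor is \<open>1\<close> at the origin.\<close>

definition vanishes_to_order :: "(complex \<Rightarrow> complex) \<Rightarrow> complex \<Rightarrow> nat \<Rightarrow> bool"
  where "vanishes_to_order f a m \<longleftrightarrow>
    (\<exists>h. h holomorphic_on UNIV \<and> h a \<noteq> 0 \<and> (\<forall>z. f z = (1 - z / a) ^ m * h z))"

lemma entire_divide_zero:
  assumes "h holomorphic_on UNIV" "h a = 0" "a \<noteq> 0"
  obtains k where "k holomorphic_on UNIV" "\<And>z. h z = (1 - z / a) * k z"
proof -
  define k where "k = (\<lambda>z. if z = a then deriv h a else (h z - h a) / (z - a))"
  have "k holomorphic_on UNIV" unfolding k_def by (rule pole_lemma_open[OF assms(1) open_UNIV])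
  moreover have "h z = (1 - z / a) * (- a * k z)" for z
  proof -
    have "(1 - z / a) * (- a) = z - a" using assms(3) by (simp add: field_simps)
    then have "(1 - z / a) * (- a * k z) = (z - a) * k z" by (simp only: mult.assoc[symmetric])
    also have "\<dots> = h z" using assms(2) by (simp add: k_def)
    finally show ?thesis by simp
  qed
  ultimately show thesis by (intro that[of "\<lambda>z. - a * k z"] holomorphic_intros) auto
qed

text \<open>Since \<open>f 0 \<noteq> 0\<close>, a function vanishing at \<open>a\<close> is not
  constant, so its zero there has a finite order \<open>n\<close>; divisibility by the power n + 1
  would make the local cofactor vanish at \<open>a\<close>. The negated form is the one on which the
  induction over deflations runs.\<close>

lemma zero_order_bounded:
  assumes f: "f holomorphic_on UNIV" "f 0 \<noteq> 0" and a: "a \<noteq> 0"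
  obtains N where "\<not> (\<exists>h. h holomorphic_on UNIV \<and> (\<forall>z. f z = (1 - z / a) ^ N * h z))"
proof (cases "f a = 0")
  case False
  show thesis
  proof (rule that[of 1], rule notI, elim exE conjE)
    fix h assume "\<forall>z. f z = (1 - z / a) ^ 1 * h z"
    then have "f a = 0" using a by simp
    then show False using False by simp
  qed
next
  case True
  have "\<not> f constant_on UNIV"
  proof
    assume "f constant_on UNIV"
    then have "f a = f 0" unfolding constant_on_def by auto
    then show False using f True by simp
  qed
  then obtain g r n where r: "r > 0" and g: "g holomorphic_on ball a r"
     and fg: "\<And>w. w \<in> ball a r \<Longrightarrow> f w = (w - a) ^ n * g w" and g0: "\<And>w. w \<in> ball a r \<Longrightarrow> g w \<noteq> 0"
    using holomorphic_factor_zero_nonconstant[of f UNIV a] f True by (metis UNIV_I connected_UNIV open_UNIV)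
  show thesis
  proof (rule that[of "Suc n"], rule notI, elim exE conjE)
    fix h assume h: "h holomorphic_on UNIV" "\<forall>z. f z = (1 - z / a) ^ Suc n * h z"
    have eq: "g w = (- 1 / a) ^ Suc n * (w - a) * h w" if "w \<in> ball a r" "w \<noteq> a" for w
    proof -
      have "1 - w / a = (- 1 / a) * (w - a)" using a by (simp add: field_simps)
      then have "(w - a) ^ n * g w = (w - a) ^ n * ((- 1 / a) ^ Suc n * (w - a) * h w)"
        using fg[OF that(1)] h(2) by (simp only: power_mult_distrib power_Suc mult_ac)
      moreover have "(w - a) ^ n \<noteq> 0" using that by simp
      ultimately show ?thesis by (rule mult_left_cancel[THEN iffD1, rotated])
    qed
    have "(g \<longlongrightarrow> g a) (at a)"
      using holomorphic_on_imp_continuous_on[OF g] r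
      by (metis at_within_open centre_in_ball continuous_on_def open_ball)
    moreover have "(g \<longlongrightarrow> (- 1 / a) ^ Suc n * (a - a) * h a) (at a)"
    proof (rule Lim_transform_within[OF _ r])
      have "isCont h a" using holomorphic_on_imp_continuous_on[OF h(1)]
        by (simp add: continuous_on_eq_continuous_at)
      then show "((\<lambda>w. (- 1 / a) ^ Suc n * (w - a) * h w) \<longlongrightarrow> (- 1 / a) ^ Suc n * (a - a) * h a) (at a)"
        by (intro tendsto_intros) (simp add: isCont_def)
    qed (use eq in \<open>auto simp: dist_commute\<close>)
    ultimately have "g a = 0" using tendsto_unique[of "at a" g] by fastforce
    then show False using g0 r by simp
  qed
qed

lemma vanishes_to_order_exists:
  assumes f: "f holomorphic_on UNIV" "f 0 \<noteq> 0" and a: "a \<noteq> 0"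
  obtains m where "vanishes_to_order f a m"
proof -
  define P where "P = (\<lambda>m. \<exists>h. h holomorphic_on UNIV \<and> (\<forall>z. f z = (1 - z / a) ^ m * h z))"
  obtain N where "\<not> P N" using zero_order_bounded[OF assms] unfolding P_def by blast
  moreover have "P 0" using f by (auto simp: P_def)
  ultimately obtain m where m: "P m" "\<not> P (Suc m)"
    using nat_induct[of P N] by blast
  then obtain h where h: "h holomorphic_on UNIV" "\<And>z. f z = (1 - z / a) ^ m * h z"
    by (auto simp: P_def)
  have "h a \<noteq> 0"
  proof
    assume "h a = 0"
    then obtain k where "k holomorphic_on UNIV" "\<And>z. h z = (1 - z / a) * k z"
      using entire_divide_zero[OF h(1) _ a] by blast
    then have "P (Suc m)" unfolding P_def by (intro exI[of _ k]) (auto simp: h(2) mult_ac)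
    then show False using m by simp
  qed
  then show thesis using h that unfolding vanishes_to_order_def by blast
qed

lemma vanishes_to_order_unique:
  assumes "vanishes_to_order f a m" "vanishes_to_order f a n" and a: "a \<noteq> 0"
  shows "m = n"
proof -
  have False if mn: "vanishes_to_order f a m" "vanishes_to_order f a n" "m < n" for m n
  proof -
    obtain h k where h: "h holomorphic_on UNIV" "h a \<noteq> 0" "\<And>z. f z = (1 - z / a) ^ m * h z"
      and k: "k holomorphic_on UNIV" "\<And>z. f z = (1 - z / a) ^ n * k z"
      using mn unfolding vanishes_to_order_def by metis
    have eq: "h w = (1 - w / a) ^ (n - m) * k w" if "w \<noteq> a" for w
    proof -
      have "(1 - w / a) ^ n = (1 - w / a) ^ m * (1 - w / a) ^ (n - m)"
        using mn(3) by (simp flip: power_add)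
      then have "(1 - w / a) ^ m * h w = (1 - w / a) ^ m * ((1 - w / a) ^ (n - m) * k w)"
        using h(3)[of w] k(2)[of w] by (simp only: mult.assoc)
      moreover have "(1 - w / a) ^ m \<noteq> 0" using that a by (simp add: field_simps)
      ultimately show ?thesis by (rule mult_left_cancel[THEN iffD1, rotated])
    qed
    have "isCont h a" "isCont k a"
      using holomorphic_on_imp_continuous_on[OF h(1)] holomorphic_on_imp_continuous_on[OF k(1)]
      by (simp_all add: continuous_on_eq_continuous_at)
    then have "(h \<longlongrightarrow> h a) (at a)" "((\<lambda>w. (1 - w / a) ^ (n - m) * k w) \<longlongrightarrow> (1 - a / a) ^ (n - m) * k a) (at a)"
      unfolding isCont_def by (simp, intro tendsto_intros a)
    moreover have "(h \<longlongrightarrow> (1 - a / a) ^ (n - m) * k a) (at a)"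
    proof (rule Lim_transform_within[OF calculation(2), of 1])
      show "(1 - x / a) ^ (n - m) * k x = h x" if "0 < dist x a" for x
        using eq[of x] that by auto
    qed simp
    ultimately have "h a = (1 - a / a) ^ (n - m) * k a" using tendsto_unique[of "at a" h] by fastforce
    then show False using h(2) mn(3) a by simp
  qed
  then show ?thesis using assms by (meson linorder_neqE_nat)
qed

lemma factor_out_zeros:
  assumes f: "f holomorphic_on UNIV" "f 0 = 1"
    and Z: "finite Z" "0 \<notin> Z" "\<And>a. a \<in> Z \<Longrightarrow> vanishes_to_order f a (m a)"
  shows "\<exists>g. g holomorphic_on UNIV \<and> (\<forall>z. f z = (\<Prod>a\<in>Z. (1 - z / a) ^ m a) * g z) \<and> (\<forall>a\<in>Z. g a \<noteq> 0)"
  using Z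
proof (induction Z rule: finite_induct)
  case empty
  then show ?case using f by auto
next
  case (insert b Z)
  then obtain g where g: "g holomorphic_on UNIV" "\<And>z. f z = (\<Prod>a\<in>Z. (1 - z / a) ^ m a) * g z"
    "\<And>a. a \<in> Z \<Longrightarrow> g a \<noteq> 0" by auto
  have b: "b \<noteq> 0" "b \<notin> Z" using insert by auto
  have "g 0 \<noteq> 0" using g(2)[of 0] f by auto
  then obtain k where "vanishes_to_order g b k"
    using vanishes_to_order_exists[OF g(1) _ b(1)] by blast
  then obtain h where h: "h holomorphic_on UNIV" "h b \<noteq> 0" "\<And>z. g z = (1 - z / b) ^ k * h z"
    unfolding vanishes_to_order_def by blast
  have 0: "0 \<notin> Z" using insert by auto
  have "vanishes_to_order f b k"
    unfolding vanishes_to_order_def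
  proof (intro exI[of _ "\<lambda>z. (\<Prod>a\<in>Z. (1 - z / a) ^ m a) * h z"] conjI allI)
    show "(\<lambda>z. (\<Prod>a\<in>Z. (1 - z / a) ^ m a) * h z) holomorphic_on UNIV"
      using 0 by (intro holomorphic_intros h(1)) auto
    show "(\<Prod>a\<in>Z. (1 - b / a) ^ m a) * h b \<noteq> 0"
      using h(2) b 0 insert.hyps(1) by (auto simp: field_simps)
    show "f z = (1 - z / b) ^ k * ((\<Prod>a\<in>Z. (1 - z / a) ^ m a) * h z)" for z
      using g(2)[of z] h(3)[of z] by (simp add: mult_ac)
  qed
  then have k: "k = m b" using vanishes_to_order_unique insert.prems(2)[of b] b by auto
  show ?case
  proof (intro exI[of _ h] conjI allI ballI)
    show "h holomorphic_on UNIV" by fact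
    show "f z = (\<Prod>a\<in>insert b Z. (1 - z / a) ^ m a) * h z" for z
      using insert.hyps g(2)[of z] h(3)[of z] by (simp add: k mult_ac)
    show "h a \<noteq> 0" if "a \<in> insert b Z" for a
    proof (cases "a = b")
      case False
      then have "g a \<noteq> 0" using that g(3) by blast
      then show ?thesis using h(3)[of a] by (metis mult_zero_right)
    qed (use h(2) in simp)
  qed
qed

text \<open>Borel--Caratheodory for a logarithm: the Cayley transform \<open>w / (2 A - w)\<close> maps the half plane
  \<open>Re w < A\<close> into the unit disc, so that Schwarz's lemma applies.\<close>

lemma zero_free_logarithm_bound:
  assumes F: "F holomorphic_on ball 0 R" "F 0 = 1"
    and nz: "\<And>z. cmod z < R \<Longrightarrow> F z \<noteq> 0"
    and A: "\<And>z. cmod z < R \<Longrightarrow> cmod (F z) < exp A"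
    and z: "cmod z < R"
  obtains w where "F z = exp w" "cmod w \<le> 2 * A * cmod z / (R - cmod z)"
proof -
  have R: "R > 0" using z norm_ge_zero[of z] by linarith
  have "A > 0" using A[of 0] F R by simp
  obtain G0 where G0: "G0 holomorphic_on ball 0 R" "\<And>x. x \<in> ball 0 R \<Longrightarrow> exp (G0 x) = F x"
    by (rule holomorphic_logarithm_exists[of "ball 0 R" F 0]) (use F nz R in auto)
  define G where "G = (\<lambda>x. G0 x - G0 0)"
  have G: "G holomorphic_on ball 0 R" unfolding G_def by (intro holomorphic_intros G0)
  have expG: "exp (G x) = F x" if "cmod x < R" for x
    using G0(2)[of x] G0(2)[of 0] that R F(2) by (simp add: G_def exp_diff)
  have Re: "Re (G x) < A" if "cmod x < R" for x
    using A[OF that] expG[OF that, symmetric] by simp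
  have lt: "cmod (G x) < cmod (2 * A - G x)" if "cmod x < R" for x
  proof -
    have "cmod (2 * A - G x) ^ 2 - cmod (G x) ^ 2 = 4 * A * (A - Re (G x))"
      unfolding cmod_power2 by (simp add: power2_eq_square algebra_simps)
    also have "\<dots> > 0" using Re[OF that] \<open>A > 0\<close> by simp
    finally have "cmod (G x) ^ 2 < cmod (2 * A - G x) ^ 2" by simp
    then show ?thesis by (rule power2_less_imp_less) simp
  qed
  define \<phi> where "\<phi> = (\<lambda>u::complex. G (R * u) / (2 * A - G (R * u)))"
  have Ru: "cmod (R * u) < R" if "cmod u < 1" for u :: complex using that R by (simp add: norm_mult)
  have "cmod (\<phi> (z / R)) \<le> cmod (z / R)"
  proof (rule Schwarz_Lemma(1))
    have "(G \<circ> (\<lambda>u. R * u)) holomorphic_on ball 0 1"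
      by (rule holomorphic_on_compose_gen[OF _ G]) (use Ru in \<open>auto intro!: holomorphic_intros\<close>)
    then have "(\<lambda>u. G (R * u)) holomorphic_on ball 0 1" by (simp add: o_def)
    moreover have "2 * A - G (R * u) \<noteq> 0" if "u \<in> ball 0 1" for u :: complex
      using lt[of "R * u"] Ru[of u] that norm_ge_zero[of "G (R * u)"] by (auto simp del: norm_ge_zero)
    ultimately show "\<phi> holomorphic_on ball 0 1"
      unfolding \<phi>_def by (intro holomorphic_intros) auto
    show "\<phi> 0 = 0" by (simp add: \<phi>_def G_def)
    show "cmod (\<phi> u) < 1" if "cmod u < 1" for u
    proof -
      have l: "cmod (G (R * u)) < cmod (2 * A - G (R * u))" using lt[of "R * u"] Ru[OF that] .
      then have "0 < cmod (2 * A - G (R * u))" by (rule le_less_trans[OF norm_ge_zero])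
      then show ?thesis using l by (simp add: \<phi>_def norm_divide)
    qed
    show "cmod (z / R) < 1" using z R by (simp add: norm_divide)
  qed
  then have \<phi>: "cmod (\<phi> (z / R)) \<le> cmod z / R" using R by (simp add: norm_divide)
  define w \<rho> where "w = \<phi> (z / R)" and "\<rho> = cmod z / R"
  have \<rho>: "\<rho> < 1" "cmod w \<le> \<rho>" using z R \<phi> by (auto simp: \<rho>_def w_def)
  have nz': "2 * A - G z \<noteq> 0" using lt[OF z] norm_ge_zero[of "G z"] by (auto simp del: norm_ge_zero)
  have "w = G z / (2 * A - G z)" using R by (simp add: w_def \<phi>_def)
  \<comment> \<open>Inverting the Cayley transform: G = 2 A w / (1 + w), whose denominator has
    modulus at least 1 - \<rho>.\<close>
  then have "G z * (1 + w) = 2 * A * w" using nz' by (simp add: field_simps)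
  then have "cmod (G z) * cmod (1 + w) = 2 * A * cmod w"
    using \<open>A > 0\<close> by (metis norm_mult norm_of_real abs_of_pos of_real_mult of_real_numeral zero_less_mult_iff zero_less_numeral)
  moreover have "cmod (1 + w) \<ge> 1 - \<rho>"
    using norm_triangle_ineq2[of 1 "- w"] \<rho>(2) by simp
  ultimately have "cmod (G z) * (1 - \<rho>) \<le> 2 * A * \<rho>"
  proof -
    assume 1: "cmod (G z) * cmod (1 + w) = 2 * A * cmod w" and 2: "1 - \<rho> \<le> cmod (1 + w)"
    have "cmod (G z) * (1 - \<rho>) \<le> cmod (G z) * cmod (1 + w)" using 2 by (intro mult_left_mono) auto
    also have "\<dots> \<le> 2 * A * \<rho>" unfolding 1 using \<rho>(2) \<open>A > 0\<close> by (intro mult_left_mono) auto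
    finally show ?thesis .
  qed
  then have "cmod (G z) \<le> 2 * A * \<rho> / (1 - \<rho>)" using \<rho>(1) by (simp add: field_simps)
  also have "\<dots> = 2 * A * cmod z / (R - cmod z)" using R z by (simp add: \<rho>_def field_simps)
  finally show thesis using that[of "G z"] expG[OF z] by simp
qed

text \<open>On the circle of radius 2 R every factor 1 - z / a with a in the disc of radius R has
  modulus at least 1, so there \<open>g\<close> is bounded by \<open>f\<close>, and the maximum
  principle carries the bound inside. In the result the constant \<open>c\<close> is divided by R
  while \<epsilon> is not, so \<epsilon> has to be fixed first.\<close>

lemma zero_free_part_logarithm:
  assumes g: "g holomorphic_on UNIV" "\<And>z. cmod z < R \<Longrightarrow> g z \<noteq> 0"
    and fg: "\<And>z. f z = (\<Prod>a\<in>Z. (1 - z / a) ^ m a) * g z" "f 0 = 1"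
    and Z: "finite Z" "\<And>a. a \<in> Z \<Longrightarrow> a \<noteq> 0 \<and> cmod a \<le> R"
    and bd: "\<And>z. cmod (f z) \<le> exp (c + \<epsilon> * cmod z)" and pos: "c \<ge> 0" "\<epsilon> > 0"
    and z: "2 * cmod z \<le> R" "0 < R"
  obtains w where "g z = exp w" "cmod w \<le> 4 * cmod z * (c + 1) / R + 8 * cmod z * \<epsilon>"
proof -
  have gb: "cmod (g u) \<le> exp (c + \<epsilon> * (2 * R))" if "cmod u < R" for u
  proof (rule maximum_modulus_frontier[of g "cball 0 (2 * R)"])
    show "g holomorphic_on interior (cball 0 (2 * R))" using g(1) holomorphic_on_subset by blast
    show "continuous_on (closure (cball 0 (2 * R))) g"
      using holomorphic_on_imp_continuous_on[OF g(1)] continuous_on_subset by blast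
    fix v :: complex assume "v \<in> frontier (cball 0 (2 * R))"
    then have v: "cmod v = 2 * R" using z by simp
    have "1 \<le> cmod (1 - v / a)" if "a \<in> Z" for a
    proof -
      have "2 \<le> cmod (v / a)" using Z(2)[OF that] v by (simp add: norm_divide field_simps)
      then show ?thesis using norm_triangle_ineq2[of "v / a" 1] by (simp add: norm_minus_commute)
    qed
    then have "1 \<le> cmod (\<Prod>a\<in>Z. (1 - v / a) ^ m a)"
      unfolding prod_norm[symmetric] norm_power by (intro prod_ge_1 one_le_power) auto
    then have "cmod (g v) \<le> cmod (\<Prod>a\<in>Z. (1 - v / a) ^ m a) * cmod (g v)"
      using mult_right_mono[of 1 _ "cmod (g v)"] by simp
    also have "\<dots> = cmod (f v)" by (simp add: fg norm_mult)
    also have "\<dots> \<le> exp (c + \<epsilon> * (2 * R))" using bd[of v] v by simp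
    finally show "cmod (g v) \<le> exp (c + \<epsilon> * (2 * R))" .
  next
    show "u \<in> cball 0 (2 * R)" using that z by simp
  qed simp
  \<comment> \<open>The summand 1 turns the bound on \<open>g\<close> into the strict one that
    \<open>zero_free_logarithm_bound\<close> demands.\<close>
  define A where "A = c + 1 + 2 * \<epsilon> * R"
  have "g 0 = 1" using fg(1)[of 0] fg(2) by simp
  have zR: "cmod z < R" using z by auto
  obtain w where w: "g z = exp w" "cmod w \<le> 2 * A * cmod z / (R - cmod z)"
  proof (rule zero_free_logarithm_bound[of g R A z])
    show "cmod (g u) < exp A" if "cmod u < R" for u
      by (rule le_less_trans[OF gb[OF that]]) (simp add: A_def)
  qed (use g zR \<open>g 0 = 1\<close> in \<open>auto intro: holomorphic_on_subset\<close>)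
  have A: "A \<ge> 0" using pos z by (simp add: A_def)
  have "2 * A * cmod z / (R - cmod z) \<le> 2 * A * cmod z / (R / 2)"
    using z A by (intro divide_left_mono) auto
  also have "\<dots> = 4 * cmod z * (c + 1) / R + 8 * cmod z * \<epsilon>"
    using z by (simp add: A_def field_simps)
  finally have "cmod w \<le> 4 * cmod z * (c + 1) / R + 8 * cmod z * \<epsilon>" using w(2) by linarith
  then show thesis using that w(1) by blast
qed

text \<open>On a disc of radius \<open>R\<close> the common zeros are divided out; the logarithms of the remaining
  zero-free factors tend to \<open>0\<close> as \<open>R\<close> grows, because both functions have exponential type zero.\<close>

lemma entire_minimal_type_determined_by_zeros:
  assumes f: "f holomorphic_on UNIV" "f 0 = 1"
      "\<And>\<epsilon>. \<epsilon> > 0 \<Longrightarrow> \<exists>C>0. \<forall>z. cmod (f z) \<le> C * exp (\<epsilon> * cmod z)"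
    and g: "g holomorphic_on UNIV" "g 0 = 1"
      "\<And>\<epsilon>. \<epsilon> > 0 \<Longrightarrow> \<exists>C>0. \<forall>z. cmod (g z) \<le> C * exp (\<epsilon> * cmod z)"
    and ord: "\<And>a m. a \<noteq> 0 \<Longrightarrow> vanishes_to_order f a m \<longleftrightarrow> vanishes_to_order g a m"
  shows "f z = g z"
proof -
  define m where "m = (\<lambda>a. SOME k. vanishes_to_order f a k)"
  have mf: "vanishes_to_order f a (m a)" if "a \<noteq> 0" for a
    unfolding m_def using vanishes_to_order_exists[OF f(1) _ that] f(2)
    by (metis someI_ex zero_neq_one)
  have mg: "vanishes_to_order g a (m a)" if "a \<noteq> 0" for a using mf ord that by blast
  have zeros: "f a = 0 \<longleftrightarrow> g a = 0" for a
  proof (cases "a = 0")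
    case False
    have "f a = 0 \<longleftrightarrow> m a > 0" using mf[OF False] False unfolding vanishes_to_order_def by auto
    moreover have "g a = 0 \<longleftrightarrow> m a > 0" using mg[OF False] False unfolding vanishes_to_order_def by auto
    ultimately show ?thesis by simp
  qed (use f g in auto)
  show ?thesis
  proof (cases "f z = 0")
    case True
    then show ?thesis using zeros by simp
  next
    case False
    have close: "\<exists>w. f z / g z = exp w \<and> cmod w \<le> \<delta>" if "\<delta> > 0" for \<delta>
    proof -
      \<comment> \<open>The constants \<open>C1\<close> and \<open>C2\<close> depend on \<epsilon>,
        so it is chosen before \<open>R\<close>. It makes the term 8 |z| \<epsilon> at most \<delta>
        / 4; the choice of \<open>R\<close> does the same for the other term, and two logarithms are
        subtracted.\<close>
      define \<epsilon> where "\<epsilon> = \<delta> / 32 / (cmod z + 1)"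
      have z1: "0 < cmod z + 1" using norm_ge_zero[of z] by linarith
      have "\<epsilon> > 0" using that z1 by (simp add: \<epsilon>_def)
      obtain C1 C2 where C1: "C1 > 0" "\<And>z. cmod (f z) \<le> C1 * exp (\<epsilon> * cmod z)"
         and C2: "C2 > 0" "\<And>z. cmod (g z) \<le> C2 * exp (\<epsilon> * cmod z)"
        using f(3)[OF \<open>\<epsilon> > 0\<close>] g(3)[OF \<open>\<epsilon> > 0\<close>] by (elim exE conjE) blast
      define c where "c = max 0 (max (ln C1) (ln C2))"
      have c: "c \<ge> 0" "C1 \<le> exp c" "C2 \<le> exp c"
      proof -
        have "ln C1 \<le> c" "ln C2 \<le> c" by (simp_all add: c_def)
        then show "C1 \<le> exp c" "C2 \<le> exp c"
          using C1(1) C2(1) by (metis exp_ln exp_le_cancel_iff)+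
      qed (simp add: c_def)
      have fb: "cmod (f u) \<le> exp (c + \<epsilon> * cmod u)" for u
        unfolding exp_add by (rule order_trans[OF C1(2)]) (use c in \<open>auto intro: mult_right_mono\<close>)
      have gb: "cmod (g u) \<le> exp (c + \<epsilon> * cmod u)" for u
        unfolding exp_add by (rule order_trans[OF C2(2)]) (use c in \<open>auto intro: mult_right_mono\<close>)
      define R where "R = max (2 * (cmod z + 1)) (16 * (cmod z + 1) * (c + 1) / \<delta>)"
      have R: "2 * (cmod z + 1) \<le> R" "16 * (cmod z + 1) * (c + 1) / \<delta> \<le> R" by (auto simp: R_def)
      then have R0: "R > 0" "2 * cmod z \<le> R" using z1 by auto
      have est: "4 * cmod z * (c + 1) / R + 8 * cmod z * \<epsilon> \<le> \<delta> / 2"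
      proof -
        have "4 * cmod z * (c + 1) \<le> 4 * (cmod z + 1) * (c + 1)" using c by (intro mult_mono) auto
        also have "\<dots> \<le> R * \<delta> / 4" using R(2) that by (simp add: field_simps)
        finally have "4 * cmod z * (c + 1) / R \<le> \<delta> / 4" using R0 by (simp add: field_simps)
        moreover have "8 * cmod z * \<epsilon> \<le> 8 * (cmod z + 1) * \<epsilon>" using \<open>\<epsilon> > 0\<close> by simp
        moreover have "(cmod z + 1) * \<epsilon> = \<delta> / 32" 
        proof -
          have "K * (d / K) = d" if "K > 0" for K d :: real using that by simp
          from this[OF z1, of "\<delta> / 32"] show ?thesis by (simp only: \<epsilon>_def)
        qed
        ultimately show ?thesis by linarith
      qed
      define Z where "Z = {a \<in> cball 0 R. f a = 0}"
      have "finite Z"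
      proof (cases "f constant_on UNIV")
        case True
        then have "f a = f 0" for a unfolding constant_on_def by auto
        then show ?thesis using f(2) by (simp add: Z_def)
      next
        case False
        show ?thesis unfolding Z_def
          by (rule holomorphic_compact_finite_zeros[OF f(1) _ _ _ _ False]) auto
      qed
      have Z: "a \<noteq> 0 \<and> cmod a \<le> R" if "a \<in> Z" for a using that f(2) by (auto simp: Z_def)
      have "0 \<notin> Z" using Z by blast
      obtain f1 where f1: "f1 holomorphic_on UNIV" "\<And>z. f z = (\<Prod>a\<in>Z. (1 - z / a) ^ m a) * f1 z" "\<And>a. a \<in> Z \<Longrightarrow> f1 a \<noteq> 0"
        using factor_out_zeros[OF f(1,2) \<open>finite Z\<close> \<open>0 \<notin> Z\<close>, of m] mf Z by metis
      obtain g1 where g1: "g1 holomorphic_on UNIV" "\<And>z. g z = (\<Prod>a\<in>Z. (1 - z / a) ^ m a) * g1 z" "\<And>a. a \<in> Z \<Longrightarrow> g1 a \<noteq> 0"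
        using factor_out_zeros[OF g(1,2) \<open>finite Z\<close> \<open>0 \<notin> Z\<close>, of m] mg Z by metis
      have f1n: "f1 u \<noteq> 0" if "cmod u < R" for u
        using that f1(2)[of u] f1(3)[of u] by (cases "f u = 0") (auto simp: Z_def)
      have g1n: "g1 u \<noteq> 0" if "cmod u < R" for u
        using that g1(2)[of u] g1(3)[of u] zeros[of u] by (cases "f u = 0") (auto simp: Z_def)
      obtain w1 where w1: "f1 z = exp w1" "cmod w1 \<le> 4 * cmod z * (c + 1) / R + 8 * cmod z * \<epsilon>"
        by (rule zero_free_part_logarithm[OF f1(1) f1n f1(2) f(2) \<open>finite Z\<close> Z fb c(1) \<open>\<epsilon> > 0\<close> R0(2,1)])
      obtain w2 where w2: "g1 z = exp w2" "cmod w2 \<le> 4 * cmod z * (c + 1) / R + 8 * cmod z * \<epsilon>"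
        by (rule zero_free_part_logarithm[OF g1(1) g1n g1(2) g(2) \<open>finite Z\<close> Z gb c(1) \<open>\<epsilon> > 0\<close> R0(2,1)])
      have "f z / g z = exp (w1 - w2)"
        using False f1(2)[of z] g1(2)[of z] w1(1) w2(1) by (simp add: exp_diff)
      moreover have "cmod (w1 - w2) \<le> \<delta>"
        using norm_triangle_ineq4[of w1 w2] w1(2) w2(2) est by linarith
      ultimately show ?thesis by blast
    qed
    \<comment> \<open>The quotient does not depend on \<delta>, so having logarithms that tend to 0
      forces it to be 1.\<close>
    have "\<forall>n. \<exists>w. f z / g z = exp w \<and> cmod w \<le> 1 / Suc n"
      by (intro allI close) simp
    from choice[OF this] obtain w where w: "\<And>n. f z / g z = exp (w n)" "\<And>n. cmod (w n) \<le> 1 / Suc n"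
      by (elim exE) blast
    have "w \<longlonglongrightarrow> 0"
    proof (rule Lim_null_comparison[OF _ LIMSEQ_inverse_real_of_nat])
      show "\<forall>\<^sub>F n in sequentially. cmod (w n) \<le> inverse (real (Suc n))"
        using w(2) by (simp add: inverse_eq_divide)
    qed
    then have "(\<lambda>n. exp (w n)) \<longlonglongrightarrow> exp 0" by (rule tendsto_exp)
    then have "(\<lambda>n. f z / g z) \<longlonglongrightarrow> 1" unfolding w(1)[symmetric] by simp
    then have "f z / g z = 1" by (simp add: LIMSEQ_const_iff)
    then show ?thesis using False zeros by (simp add: field_simps)
  qed
qed

section \<open>Growth estimates for sums of products over finite index sets\<close>

lemma prod_one_plus_bound:
  fixes a :: "nat \<Rightarrow> real"
  assumes "\<And>k. a k \<ge> 0" "summable a" "\<delta> > 0"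
  obtains C where "C > 0" "\<And>N r. r \<ge> 0 \<Longrightarrow> (\<Prod>k<N. 1 + r * a k) \<le> C * exp (\<delta> * r)"
proof -
  obtain K where K: "\<And>m n. m \<ge> K \<Longrightarrow> norm (sum a {m..<n}) < \<delta> / 2"
    using assms(2,3) unfolding summable_Cauchy by (metis half_gt_zero)
  \<comment> \<open>The factors from \<open>K\<close> on contribute at most exp (r \<delta> / 2).
    Each of the first \<open>K\<close> is linear in \<open>r\<close>, hence at most a constant times
    exp (r \<eta>), and together they cost at most another \<delta> / 2. The denominator K + 1 also
    covers K = 0.\<close>
  define \<eta> where "\<eta> = \<delta> / (2 * (K + 1))"
  have "\<eta> > 0" using assms(3) by (simp add: \<eta>_def)
  define b c where "b = (\<lambda>k. if k < K then \<eta> else a k)" and "c = (\<lambda>k. if k < K then 1 + a k / \<eta> else 1)"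
  have c1: "c k \<ge> 1" for k using assms(1)[of k] \<open>\<eta> > 0\<close> by (simp add: c_def)
  have "(\<Prod>k<N. 1 + r * a k) \<le> (\<Prod>k<K. c k) * exp (\<delta> * r)" if "r \<ge> 0" for N r
  proof -
    have "1 + r * a k \<le> c k * exp (r * b k)" for k
    proof (cases "k < K")
      case True
      have "1 + r * a k \<le> (1 + a k / \<eta>) * (1 + r * \<eta>)"
        using assms(1)[of k] \<open>\<eta> > 0\<close> that by (simp add: algebra_simps add_increasing)
      also have "\<dots> \<le> (1 + a k / \<eta>) * exp (r * \<eta>)"
        using assms(1)[of k] \<open>\<eta> > 0\<close> exp_ge_add_one_self[of "r * \<eta>"] by (intro mult_left_mono) auto
      finally show ?thesis using True by (simp add: c_def b_def)
    next
      case False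
      then show ?thesis using exp_ge_add_one_self[of "r * a k"] by (simp add: c_def b_def)
    qed
    then have "(\<Prod>k<N. 1 + r * a k) \<le> (\<Prod>k<N. c k * exp (r * b k))"
      using assms(1) that by (intro prod_mono) (auto intro!: add_nonneg_nonneg)
    also have "\<dots> = (\<Prod>k<N. c k) * exp (r * (\<Sum>k<N. b k))"
      by (simp add: prod.distrib exp_sum sum_distrib_left)
    also have "(\<Prod>k<N. c k) \<le> (\<Prod>k<K. c k)"
    proof -
      have "(\<Prod>k<N. c k) \<le> (\<Prod>k<max N K. c k)"
        using c1 by (intro prod_mono2) (auto intro: order_trans[OF zero_le_one])
      also have "\<dots> = (\<Prod>k<K. c k)"
        by (rule prod.mono_neutral_right) (auto simp: c_def)
      finally show ?thesis .
    qed
    also have "(\<Sum>k<N. b k) \<le> \<delta>"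
    proof -
      have "(\<Sum>k<N. b k) \<le> (\<Sum>k\<in>{..<K} \<union> {K..<N}. b k)"
        using assms(1) \<open>\<eta> > 0\<close> by (intro sum_mono2) (auto simp: b_def)
      also have "\<dots> = (\<Sum>k<K. \<eta>) + (\<Sum>k=K..<N. a k)"
        by (subst sum.union_disjoint) (auto simp: b_def)
      also have "(\<Sum>k<K. \<eta>) \<le> \<delta> / 2" using assms(3) by (simp add: \<eta>_def field_simps)
      also have "(\<Sum>k=K..<N. a k) \<le> \<delta> / 2" using K[of K N] by simp
      finally show ?thesis by simp
    qed
    finally show ?thesis using c1 that
      by (simp add: mult.commute mult_left_mono mult_right_mono prod_nonneg order_trans[OF zero_le_one])
  qed
  moreover have "(\<Prod>k<K. c k) > 0"
  proof (rule prod_pos)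
    show "0 < c k" for k using c1[of k] by linarith
  qed
  ultimately show thesis using that by blast
qed

text \<open>A Cauchy estimate: the elementary symmetric sum times r^n is at most the product of all
  1 + r a_k, hence at most C exp (\<delta> r). The optimal r = n / \<delta> gives C (e \<delta> /
  n)^n, which explains \<delta> = \<epsilon> / e, and n^n dominates n!.\<close>

lemma sum_prod_subsets_bound:
  fixes a :: "nat \<Rightarrow> real"
  assumes a: "\<And>k. a k \<ge> 0" "summable a" and "\<epsilon> > 0"
  obtains C where "C > 0"
    "\<And>N n. (\<Sum>S | S \<subseteq> {0..<N} \<and> card S = n. \<Prod>k\<in>S. a k) \<le> C * \<epsilon> ^ n / fact n"
proof -
  define \<delta> where "\<delta> = \<epsilon> / exp 1"
  have "\<delta> > 0" using assms by (simp add: \<delta>_def)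
  obtain C where C: "C > 0" "\<And>N r. r \<ge> 0 \<Longrightarrow> (\<Prod>k<N. 1 + r * a k) \<le> C * exp (\<delta> * r)"
    using prod_one_plus_bound[OF a \<open>\<delta> > 0\<close>] by blast
  have "(\<Sum>S | S \<subseteq> {0..<N} \<and> card S = n. \<Prod>k\<in>S. a k) \<le> C * \<epsilon> ^ n / fact n" for N n
  proof -
    define e where "e = (\<Sum>S | S \<subseteq> {0..<N} \<and> card S = n. \<Prod>k\<in>S. a k)"
    define r where "r = real n / \<delta>"
    have r: "r \<ge> 0" using \<open>\<delta> > 0\<close> by (simp add: r_def)
    have "r ^ n * e = (\<Sum>S | S \<subseteq> {0..<N} \<and> card S = n. \<Prod>k\<in>S. r * a k)"
      unfolding e_def sum_distrib_left by (intro sum.cong refl) (auto simp: prod.distrib)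
    also have "\<dots> \<le> (\<Sum>S\<in>Pow {0..<N}. \<Prod>k\<in>S. r * a k)"
      using r a by (intro sum_mono2 prod_nonneg) auto
    also have "\<dots> = (\<Prod>k<N. 1 + r * a k)"
      using prod_add[of "{0..<N}" "\<lambda>k. r * a k" "\<lambda>_. 1"] by (simp add: atLeast0LessThan add.commute)
    also have "\<dots> \<le> C * exp (\<delta> * r)" using C r by blast
    also have "\<delta> * r = real n" using \<open>\<delta> > 0\<close> by (simp add: r_def)
    finally have "real n ^ n * e \<le> C * exp (real n) * \<delta> ^ n"
      using \<open>\<delta> > 0\<close> by (simp add: r_def power_divide field_simps)
    also have "\<dots> = C * \<epsilon> ^ n" by (simp add: \<delta>_def power_divide exp_of_nat_mult[of _ 1, simplified])
    finally have "real n ^ n * e \<le> C * \<epsilon> ^ n" .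
    moreover have "fact n * e \<le> real n ^ n * e"
    proof (rule mult_right_mono)
      show "fact n \<le> real n ^ n" using fact_le_power[of n, where 'a = real] by simp
    qed (use a in \<open>auto simp: e_def intro!: sum_nonneg prod_nonneg\<close>)
    ultimately show ?thesis by (simp add: e_def field_simps)
  qed
  then show thesis using that C by blast
qed

lemma sum_powr_le_powr_sum:
  fixes u :: "'a \<Rightarrow> real"
  assumes "\<And>i. i \<in> F \<Longrightarrow> u i \<ge> 0" "p \<ge> 1" "finite F"
  shows "(\<Sum>i\<in>F. u i powr p) \<le> (\<Sum>i\<in>F. u i) powr p"
proof -
  define U where "U = (\<Sum>i\<in>F. u i)"
  have U: "U \<ge> 0" unfolding U_def using assms by (intro sum_nonneg)
  have split: "x powr p = x * x powr (p - 1)" if "x \<ge> 0" for x :: real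
    using that by (cases "x = 0") (simp_all add: powr_mult_base)
  have "(\<Sum>i\<in>F. u i powr p) \<le> (\<Sum>i\<in>F. u i * U powr (p - 1))"
  proof (rule sum_mono)
    fix i assume i: "i \<in> F"
    then have "u i \<le> U" unfolding U_def using assms by (intro member_le_sum) auto
    then have "u i powr (p - 1) \<le> U powr (p - 1)" using assms i by (intro powr_mono2) auto
    then show "u i powr p \<le> u i * U powr (p - 1)"
      using assms(1)[OF i] by (simp add: split mult_left_mono)
  qed
  also have "\<dots> = U powr p" using split[OF U] by (simp add: U_def sum_distrib_right)
  finally show ?thesis by (simp add: U_def)
qed

lemma power_self_le_exp_fact: "real n ^ n \<le> exp (real n) * fact n"
proof -
  have s: "(\<lambda>k. real n ^ k / fact k) sums exp (real n)"
    using exp_converges[of "real n"] by (simp add: field_simps)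
  have "real n ^ n / fact n = (\<Sum>k\<in>{n}. real n ^ k / fact k)" by simp
  also have "\<dots> \<le> (\<Sum>k. real n ^ k / fact k)"
    by (rule sum_le_suminf[OF sums_summable[OF s]]) auto
  finally show ?thesis using s by (simp add: sums_unique[symmetric] field_simps)
qed

lemma sum_prod_subsets_powr_bound:
  fixes t :: "nat \<Rightarrow> real"
  assumes t: "\<And>k. t k \<ge> 0" "summable (\<lambda>k. t k powr s)"
    and s: "s > 0" "1 / s = 1 + \<alpha>" "\<alpha> \<ge> 0" and "K > 0" "\<epsilon> > 0"
  obtains C where "\<And>N n. (K * real n powr \<alpha>) ^ n *
      (\<Sum>S | S \<subseteq> {0..<N} \<and> card S = n. \<Prod>k\<in>S. t k) \<le> C * \<epsilon> ^ n / fact n"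
proof -
  \<comment> \<open>Solves K exp (\<alpha>) \<delta>^(1 + \<alpha>) = \<epsilon>. The factor exp
    (\<alpha>) per power pays for replacing n^(\<alpha> n) by (n!)^\<alpha>.\<close>
  define \<delta> where "\<delta> = (\<epsilon> / (K * exp \<alpha>)) powr s"
  have "\<delta> > 0" using assms by (simp add: \<delta>_def)
  have \<delta>: "K * exp \<alpha> * \<delta> powr (1 + \<alpha>) = \<epsilon>"
    using assms by (simp add: \<delta>_def powr_powr flip: s(2))
  obtain C where C: "C > 0" "\<And>N n. (\<Sum>S | S \<subseteq> {0..<N} \<and> card S = n. \<Prod>k\<in>S. t k powr s) \<le> C * \<delta> ^ n / fact n"
    using sum_prod_subsets_bound[of "\<lambda>k. t k powr s" \<delta>, OF powr_ge_zero t(2) \<open>\<delta> > 0\<close>] by blast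
  have "(K * real n powr \<alpha>) ^ n * (\<Sum>S | S \<subseteq> {0..<N} \<and> card S = n. \<Prod>k\<in>S. t k)
      \<le> C powr (1 + \<alpha>) * \<epsilon> ^ n / fact n" for N n
  proof -
    have "(\<Sum>S | S \<subseteq> {0..<N} \<and> card S = n. \<Prod>k\<in>S. t k)
        = (\<Sum>S | S \<subseteq> {0..<N} \<and> card S = n. (\<Prod>k\<in>S. t k powr s) powr (1 + \<alpha>))"
    proof (rule sum.cong[OF refl])
      fix S
      have "(\<Prod>k\<in>S. t k powr s) powr (1 + \<alpha>) = (\<Prod>k\<in>S. (t k powr s) powr (1 + \<alpha>))"
        by (simp add: prod_powr_distrib)
      also have "\<dots> = (\<Prod>k\<in>S. t k)"
        using t(1) s by (intro prod.cong refl) (simp add: powr_powr flip: s(2))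
      finally show "(\<Prod>k\<in>S. t k) = (\<Prod>k\<in>S. t k powr s) powr (1 + \<alpha>)" ..
    qed
    also have "\<dots> \<le> (\<Sum>S | S \<subseteq> {0..<N} \<and> card S = n. \<Prod>k\<in>S. t k powr s) powr (1 + \<alpha>)"
      using s by (intro sum_powr_le_powr_sum) (auto intro!: prod_nonneg)
    also have "\<dots> \<le> (C * \<delta> ^ n / fact n) powr (1 + \<alpha>)"
      using s C by (intro powr_mono2) (auto intro!: sum_nonneg prod_nonneg)
    also have "\<dots> = C powr (1 + \<alpha>) * (\<delta> powr (1 + \<alpha>)) ^ n / (fact n * fact n powr \<alpha>)"
    proof -
      have "(\<delta> ^ n) powr (1 + \<alpha>) = (\<delta> powr (1 + \<alpha>)) ^ n"
        using \<open>\<delta> > 0\<close> by (simp add: powr_power powr_powr mult.commute flip: powr_realpow)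
      moreover have "(fact n :: real) powr (1 + \<alpha>) = fact n * fact n powr \<alpha>"
        by (simp add: powr_add)
      ultimately show ?thesis using C \<open>\<delta> > 0\<close> by (simp add: powr_divide powr_mult)
    qed
    finally have "(K * real n powr \<alpha>) ^ n * (\<Sum>S | S \<subseteq> {0..<N} \<and> card S = n. \<Prod>k\<in>S. t k)
       \<le> (K * real n powr \<alpha>) ^ n * (C powr (1 + \<alpha>) * (\<delta> powr (1 + \<alpha>)) ^ n / (fact n * fact n powr \<alpha>))"
      using assms by (intro mult_left_mono) auto
    also have "\<dots> = C powr (1 + \<alpha>) * (K * \<delta> powr (1 + \<alpha>)) ^ n / fact n * ((real n ^ n / fact n) powr \<alpha>)"
    proof -
      have "(real n powr \<alpha>) ^ n = (real n ^ n) powr \<alpha>"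
        by (cases "n = 0") (simp_all add: powr_power powr_powr mult.commute flip: powr_realpow)
      then show ?thesis by (simp add: power_mult_distrib powr_divide)
    qed
    also have "\<dots> \<le> C powr (1 + \<alpha>) * (K * \<delta> powr (1 + \<alpha>)) ^ n / fact n * (exp \<alpha> ^ n)"
    proof (rule mult_left_mono)
      have "(real n ^ n / fact n) powr \<alpha> \<le> exp (real n) powr \<alpha>"
        using power_self_le_exp_fact[of n] s by (intro powr_mono2) (auto simp: field_simps)
      also have "\<dots> = exp \<alpha> ^ n" by (simp add: powr_def mult.commute flip: exp_of_nat_mult)
      finally show "(real n ^ n / fact n) powr \<alpha> \<le> exp \<alpha> ^ n" .
    qed (use assms in auto)
    also have "\<dots> = C powr (1 + \<alpha>) * (K * exp \<alpha> * \<delta> powr (1 + \<alpha>)) ^ n / fact n"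
      by (simp add: power_mult_distrib mult_ac)
    finally show ?thesis unfolding \<delta> .
  qed
  then show thesis using that by blast
qed

text \<open>Dominated convergence for vector-valued series, reduced to Tannery's theorem for the
  norms of the differences, which are at most 2 M. It serves traces and determinants as well as the
  eigenvectors of truncations.\<close>

lemma tendsto_suminf_dominated:
  fixes f :: "nat \<Rightarrow> nat \<Rightarrow> 'a::banach"
  assumes lim: "\<And>k. (\<lambda>N. f N k) \<longlonglongrightarrow> g k"
    and bound: "\<And>N k. norm (f N k) \<le> M k" and M: "summable M"
  shows "(\<lambda>N. \<Sum>k. f N k) \<longlonglongrightarrow> (\<Sum>k. g k)"
proof -
  have gM: "norm (g k) \<le> M k" for k
    by (rule LIMSEQ_le_const2[OF tendsto_norm[OF lim]]) (use bound in blast)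
  have sf: "summable (f N)" for N by (rule summable_comparison_test'[OF M]) (rule bound)
  have sg: "summable g" by (rule summable_comparison_test'[OF M]) (rule gM)
  define h where "h = (\<lambda>k N. norm (f N k - g k))"
  have hM: "h k N \<le> 2 * M k" for k N
    using norm_triangle_ineq4[of "f N k" "g k"] bound[of N k] gM[of k] by (simp add: h_def)
  have sh: "summable (\<lambda>k. h k N)" for N
    by (rule summable_comparison_test'[OF summable_mult[OF M, of 2]]) (use hM in \<open>simp add: h_def\<close>)
  have "(\<lambda>N. suminf (\<lambda>k. h k N)) \<longlonglongrightarrow> suminf (\<lambda>k. 0 :: real)"
  proof (rule tannerys_theorem[THEN conjunct2, THEN conjunct2])
    show "(\<lambda>N. h k N) \<longlonglongrightarrow> 0" for k
      using tendsto_norm[OF tendsto_diff[OF lim[of k] tendsto_const[of "g k"]]] by (simp add: h_def)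
    show "\<forall>\<^sub>F (k, N) in sequentially \<times>\<^sub>F sequentially. norm (h k N) \<le> 2 * M k"
      using hM by (intro always_eventually) (auto simp: h_def)
    show "summable (\<lambda>k. 2 * M k)" using M by (rule summable_mult)
  qed simp
  then have h0: "(\<lambda>N. \<Sum>k. h k N) \<longlonglongrightarrow> 0" by simp
  have "(\<lambda>N. (\<Sum>k. f N k) - (\<Sum>k. g k)) \<longlonglongrightarrow> 0"
  proof (rule Lim_null_comparison[OF always_eventually h0], rule allI)
    fix N
    have "(\<Sum>k. f N k) - (\<Sum>k. g k) = (\<Sum>k. f N k - g k)" by (rule suminf_diff[OF sf sg])
    also have "norm \<dots> \<le> (\<Sum>k. h k N)" unfolding h_def
      by (rule summable_norm) (use sh[of N] in \<open>simp add: h_def\<close>)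
    finally show "norm ((\<Sum>k. f N k) - (\<Sum>k. g k)) \<le> (\<Sum>k. h k N)" .
  qed
  then show ?thesis by (simp add: LIM_zero_iff)
qed

section \<open>Nuclear representations\<close>

lemma bounded_bilinear_scaleC:
  "bounded_bilinear (scaleC :: complex \<Rightarrow> 'a \<Rightarrow> 'a::complex_normed_vector)"
proof
  show "\<exists>K. \<forall>a b. norm (a *\<^sub>C (b :: 'a)) \<le> norm a * norm b * K"
    by (intro exI[of _ 1]) (simp add: norm_scaleC)
  fix r :: real and a :: complex and b :: 'a
  have "(r *\<^sub>R a) *\<^sub>C b = complex_of_real r *\<^sub>C a *\<^sub>C b"
    by (simp add: scaleC_scaleC scaleR_conv_of_real)
  then show "(r *\<^sub>R a) *\<^sub>C b = r *\<^sub>R (a *\<^sub>C b)" by (simp add: scaleC_of_real)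
  have "a *\<^sub>C (r *\<^sub>R b) = complex_of_real r *\<^sub>C a *\<^sub>C b"
    by (simp add: scaleC_scaleC mult.commute flip: scaleC_of_real)
  then show "a *\<^sub>C (r *\<^sub>R b) = r *\<^sub>R (a *\<^sub>C b)" by (simp add: scaleC_of_real)
qed (simp_all add: scaleC_add_right scaleC_add_left)

interpretation scaleC: bounded_bilinear "scaleC :: complex \<Rightarrow> 'a \<Rightarrow> 'a::complex_normed_vector"
  by (rule bounded_bilinear_scaleC)

interpretation complex_space: vector_space "scaleC :: complex \<Rightarrow> 'a \<Rightarrow> 'a::complex_normed_vector"
  by (rule vector_space_scaleC)

lemma bounded_clinear_imp_bounded_linear: "bounded_clinear f \<Longrightarrow> bounded_linear f"
  by (simp add: bounded_clinear_def)

lemma bounded_clinear_scale: "bounded_clinear f \<Longrightarrow> f (c *\<^sub>C x) = c *\<^sub>C f x"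
  by (simp add: bounded_clinear_def)

lemma bounded_clinear_scale_complex: "bounded_clinear f \<Longrightarrow> f (c *\<^sub>C x) = c * f x"
  by (simp add: bounded_clinear_def scaleC_complex_def)

lemmas bounded_clinear_simps =
  bounded_linear.linear[OF bounded_clinear_imp_bounded_linear, THEN linear_add]
  bounded_linear.linear[OF bounded_clinear_imp_bounded_linear, THEN linear_diff]
  bounded_linear.linear[OF bounded_clinear_imp_bounded_linear, THEN linear_0]
  bounded_linear.linear[OF bounded_clinear_imp_bounded_linear, THEN linear_sum]

lemma bounded_clinear_norm_le: "bounded_clinear f \<Longrightarrow> norm (f x) \<le> onorm f * norm x"
  by (rule onorm[OF bounded_clinear_imp_bounded_linear])

lemma bounded_clinear_tendsto:
  "bounded_clinear f \<Longrightarrow> (g \<longlongrightarrow> a) F \<Longrightarrow> ((\<lambda>x. f (g x)) \<longlongrightarrow> f a) F"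
  by (rule bounded_linear.tendsto[OF bounded_clinear_imp_bounded_linear])

lemma bounded_clinear_sums:
  "bounded_clinear f \<Longrightarrow> g sums a \<Longrightarrow> (\<lambda>k. f (g k)) sums f a"
  by (rule bounded_linear.sums[OF bounded_clinear_imp_bounded_linear])

lemma bounded_clinear_compose:
  "bounded_clinear f \<Longrightarrow> bounded_clinear g \<Longrightarrow> bounded_clinear (\<lambda>x. f (g x))"
  unfolding bounded_clinear_def by (auto intro: bounded_linear_compose)

lemma bounded_clinear_funpow:
  fixes f :: "'a::complex_normed_vector \<Rightarrow> 'a"
  assumes "bounded_clinear f"
  shows "bounded_clinear (f ^^ k)"
proof (induction k)
  case 0
  show ?case by (simp add: bounded_clinear_def id_def bounded_linear_ident)
next
  case (Suc k)
  then show ?case using bounded_clinear_compose[OF assms Suc] by (simp add: o_def)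
qed

lemma bounded_clinear_cmult:
  fixes f :: "'a::complex_normed_vector \<Rightarrow> complex"
  assumes "bounded_clinear f"
  shows "bounded_clinear (\<lambda>x. c * f x)"
  using assms unfolding bounded_clinear_def
  by (auto simp: scaleC_complex_def intro: bounded_linear_const_mult)

text \<open>The terms tend to 0, and below 1 a power with exponent at most 1 only enlarges
  them.\<close>

lemma summable_of_summable_powr:
  fixes t :: "nat \<Rightarrow> real"
  assumes "\<And>k. t k \<ge> 0" "summable (\<lambda>k. t k powr s)" "0 < s" "s \<le> 1"
  shows "summable t"
proof (rule summable_comparison_test_ev[OF _ assms(2)])
  have "(\<lambda>k. t k powr s) \<longlonglongrightarrow> 0" by (rule summable_LIMSEQ_zero[OF assms(2)])
  then have "\<forall>\<^sub>F k in sequentially. t k powr s < 1"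
    by (rule order_tendstoD) simp
  then show "\<forall>\<^sub>F k in sequentially. norm (t k) \<le> t k powr s"
  proof eventually_elim
    case (elim k)
    have "t k < 1"
    proof (rule ccontr)
      assume "\<not> t k < 1"
      then have "1 \<le> t k powr s" using assms by (simp add: ge_one_powr_ge_zero)
      then show False using elim by simp
    qed
    then have "t k powr 1 \<le> t k powr s"
      using assms(1)[of k] assms(3,4) by (intro powr_mono') auto
    then show ?case using assms(1)[of k] by simp
  qed
qed

section \<open>Truncations of a nuclear representation and the traces of their powers\<close>

locale nuclear_representation =
  fixes s :: real and T :: "'a::complex_banach \<Rightarrow> 'a" and x' :: "nat \<Rightarrow> 'a \<Rightarrow> complex" and x :: "nat \<Rightarrow> 'a"
  assumes rep: "nuclear_rep s T x' x" and s: "0 < s" "s \<le> 1"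
begin

definition "t k = onorm (x' k) * norm (x k)"
text \<open>A common bound for the norms of \<open>T\<close> and of all its truncations; every
  dominating series for the traces is built from it.\<close>

definition "L = (\<Sum>k. t k)"
definition "trunc N y = (\<Sum>k<N. x' k y *\<^sub>C x k)"
text \<open>The truncation sends y to the N numbers x'_i y and these to a combination of the x_i.
  \<open>M N\<close> is the product of these two maps in the other order, so it has the same nonzero
  eigenvalues and the same traces of powers as \<open>trunc N\<close>.\<close>

definition "M N = mat N N (\<lambda>(i,j). x' i (x j))"

lemma bcl: "bounded_clinear (x' k)" using rep by (simp add: nuclear_rep_def)

lemma sums: "(\<lambda>k. x' k y *\<^sub>C x k) sums T y" using rep by (simp add: nuclear_rep_def)

lemma onorm_nonneg: "onorm (x' k) \<ge> 0"
  using onorm_pos_le[OF bounded_clinear_imp_bounded_linear[OF bcl]] .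

lemma t_nonneg: "t k \<ge> 0" by (simp add: t_def onorm_nonneg)

lemma summable_t_powr: "summable (\<lambda>k. t k powr s)"
  using rep by (simp add: nuclear_rep_def t_def powr_mult onorm_nonneg)

lemma summable_t: "summable t"
  by (rule summable_of_summable_powr[OF t_nonneg summable_t_powr s])

lemma L_nonneg: "L \<ge> 0" unfolding L_def by (rule suminf_nonneg[OF summable_t t_nonneg])

lemma norm_term_le: "norm (x' k y *\<^sub>C x k) \<le> t k * norm y"
  using mult_right_mono[OF bounded_clinear_norm_le[OF bcl, of k y], of "norm (x k)"]
  by (simp add: norm_scaleC t_def mult_ac)

lemma norm_trunc_le: "norm (trunc N y) \<le> L * norm y"
proof -
  have "norm (trunc N y) \<le> (\<Sum>k<N. t k * norm y)"
    unfolding trunc_def by (rule sum_norm_le) (rule norm_term_le)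
  also have "\<dots> = (\<Sum>k<N. t k) * norm y" by (simp add: sum_distrib_right)
  also have "\<dots> \<le> L * norm y"
    unfolding L_def by (intro mult_right_mono sum_le_suminf summable_t) (auto simp: t_nonneg)
  finally show ?thesis .
qed

lemma trunc_tendsto: "(\<lambda>N. trunc N y) \<longlonglongrightarrow> T y"
  using sums[of y] unfolding sums_def trunc_def .

lemma norm_T_le: "norm (T y) \<le> L * norm y"
  by (rule LIMSEQ_le_const2[OF tendsto_norm[OF trunc_tendsto]]) (use norm_trunc_le in blast)

lemma trunc_linear: "trunc N (y + z) = trunc N y + trunc N z" "trunc N (c *\<^sub>C y) = c *\<^sub>C trunc N y"
  by (simp_all add: trunc_def bounded_clinear_simps[OF bcl] bounded_clinear_scale_complex[OF bcl]
      scaleC_add_left sum.distrib scaleC.sum_right scaleC_scaleC)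

lemma bounded_clinear_trunc: "bounded_clinear (trunc N)"
  unfolding bounded_clinear_def
proof (intro conjI allI)
  show "bounded_linear (trunc N)"
  proof (rule bounded_linear_intro[of _ L])
    show "trunc N (r *\<^sub>R y) = r *\<^sub>R trunc N y" for r y
      using trunc_linear(2)[of N "complex_of_real r" y] by (simp add: scaleC_of_real)
  qed (simp_all add: trunc_linear norm_trunc_le[unfolded mult.commute[of L]])
qed (rule trunc_linear)

lemma bounded_clinear_T: "bounded_clinear T"
proof -
  have add: "T (y + z) = T y + T z" for y z
    by (rule LIMSEQ_unique[OF trunc_tendsto])
       (use tendsto_add[OF trunc_tendsto[of y] trunc_tendsto[of z]] in \<open>simp add: trunc_linear\<close>)
  have scale: "T (c *\<^sub>C y) = c *\<^sub>C T y" for c y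
    by (rule LIMSEQ_unique[OF trunc_tendsto])
       (use scaleC.tendsto[OF tendsto_const[of c] trunc_tendsto[of y]] in \<open>simp add: trunc_linear\<close>)
  show ?thesis unfolding bounded_clinear_def
  proof (intro conjI allI)
    show "bounded_linear T"
    proof (rule bounded_linear_intro[of _ L])
      show "T (r *\<^sub>R y) = r *\<^sub>R T y" for r y
        using scale[of "complex_of_real r" y] by (simp add: scaleC_of_real)
    qed (simp_all add: add norm_T_le[unfolded mult.commute[of L]])
  qed (rule scale)
qed

lemma norm_trunc_pow_le: "norm ((trunc N ^^ k) y) \<le> L ^ k * norm y"
proof (induction k)
  case (Suc k)
  have "norm ((trunc N ^^ Suc k) y) \<le> L * norm ((trunc N ^^ k) y)" by (simp add: norm_trunc_le)
  also have "\<dots> \<le> L * (L ^ k * norm y)" by (rule mult_left_mono[OF Suc L_nonneg])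
  finally show ?case by simp
qed simp

lemma norm_T_pow_le: "norm ((T ^^ k) y) \<le> L ^ k * norm y"
proof (induction k)
  case (Suc k)
  have "norm ((T ^^ Suc k) y) \<le> L * norm ((T ^^ k) y)" by (simp add: norm_T_le)
  also have "\<dots> \<le> L * (L ^ k * norm y)" by (rule mult_left_mono[OF Suc L_nonneg])
  finally show ?case by simp
qed simp

text \<open>Pointwise convergence survives composition because the truncations are uniformly bounded
  by \<open>L\<close>.\<close>

lemma trunc_pow_tendsto: "(\<lambda>N. (trunc N ^^ k) y) \<longlonglongrightarrow> (T ^^ k) y"
proof (induction k)
  case (Suc k)
  define u where "u = (T ^^ k) y"
  have "(\<lambda>N. trunc N ((trunc N ^^ k) y - u)) \<longlonglongrightarrow> 0"
  proof (rule Lim_null_comparison[OF always_eventually])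
    show "\<forall>N. norm (trunc N ((trunc N ^^ k) y - u)) \<le> L * norm ((trunc N ^^ k) y - u)"
      by (simp add: norm_trunc_le)
    have "(\<lambda>N. (trunc N ^^ k) y - u) \<longlonglongrightarrow> 0" using Suc by (simp add: u_def LIM_zero)
    from tendsto_mult[OF tendsto_const[of L] tendsto_norm[OF this]]
    show "(\<lambda>N. L * norm ((trunc N ^^ k) y - u)) \<longlonglongrightarrow> 0" by simp
  qed
  from tendsto_add[OF this trunc_tendsto[of u]]
  show ?case by (simp add: bounded_clinear_simps[OF bounded_clinear_trunc] u_def)
qed simp

text \<open>One truncation is split between the outer functional and the outer vector, so the matrix
  power \<open>Suc k\<close> shows only \<open>k\<close> truncations.\<close>

lemma M_pow_index:
  assumes "i < N" "j < N"
  shows "(M N ^\<^sub>m Suc k) $$ (i,j) = x' i ((trunc N ^^ k) (x j))"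
  using assms(2)
proof (induction k arbitrary: j)
  case 0
  have "M N ^\<^sub>m Suc 0 = M N" by (simp add: M_def)
  then show ?case using assms 0 by (simp add: M_def)
next
  case (Suc k)
  have c: "M N ^\<^sub>m Suc k \<in> carrier_mat N N" "M N \<in> carrier_mat N N"
    by (auto simp: M_def simp del: pow_mat.simps intro!: pow_carrier_mat)
  have "(M N ^\<^sub>m Suc (Suc k)) $$ (i,j) = (M N ^\<^sub>m Suc k * M N) $$ (i,j)"
    by simp
  also have "\<dots> = (\<Sum>l<N. (M N ^\<^sub>m Suc k) $$ (i,l) * M N $$ (l,j))"
    using c assms Suc.prems by (simp add: scalar_prod_def atLeast0LessThan del: pow_mat.simps)
  also have "\<dots> = (\<Sum>l<N. x' i ((trunc N ^^ k) (x l)) * x' l (x j))"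
    using Suc by (intro sum.cong refl) (simp add: M_def del: pow_mat.simps)
  also have "\<dots> = x' i ((trunc N ^^ k) (trunc N (x j)))"
    unfolding trunc_def[of N "x j"]
    by (simp add: bounded_clinear_simps[OF bounded_clinear_funpow[OF bounded_clinear_trunc]]
      bounded_clinear_simps[OF bcl] bounded_clinear_scale[OF bounded_clinear_funpow[OF bounded_clinear_trunc]]
      bounded_clinear_scale_complex[OF bcl] mult.commute)
  finally show ?case by (simp only: funpow_Suc_right o_apply)
qed

definition "matrix_trace N k = (\<Sum>i<N. (M N ^\<^sub>m Suc k) $$ (i,i))"
definition "trace_seq k = (\<Sum>i. x' i ((T ^^ k) (x i)))"

lemma norm_trace_term_le: "norm (x' i ((T ^^ k) (x i))) \<le> L ^ k * t i"
proof -
  have "norm (x' i ((T ^^ k) (x i))) \<le> onorm (x' i) * norm ((T ^^ k) (x i))"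
    by (rule bounded_clinear_norm_le[OF bcl])
  also have "\<dots> \<le> onorm (x' i) * (L ^ k * norm (x i))"
    by (intro mult_left_mono norm_T_pow_le onorm_nonneg)
  finally show ?thesis by (simp add: t_def mult_ac)
qed

lemma trace_seq_sums: "(\<lambda>i. x' i ((T ^^ k) (x i))) sums trace_seq k"
  unfolding trace_seq_def
  by (rule summable_sums) (rule summable_comparison_test'[OF summable_mult[OF summable_t]], rule norm_trace_term_le)

lemma matrix_trace_tendsto: "(\<lambda>N. matrix_trace N k) \<longlonglongrightarrow> trace_seq k"
proof -
  define f where "f = (\<lambda>N i. if i < N then x' i ((trunc N ^^ k) (x i)) else 0)"
  have "matrix_trace N k = (\<Sum>i. f N i)" for N
  proof -
    have "(\<Sum>i. f N i) = (\<Sum>i<N. f N i)" by (rule suminf_finite) (auto simp: f_def)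
    also have "\<dots> = matrix_trace N k" unfolding matrix_trace_def
      by (intro sum.cong refl) (simp add: f_def M_pow_index del: pow_mat.simps)
    finally show ?thesis ..
  qed
  moreover have "(\<lambda>N. \<Sum>i. f N i) \<longlonglongrightarrow> (\<Sum>i. x' i ((T ^^ k) (x i)))"
  proof (rule tendsto_suminf_dominated)
    show "(\<lambda>N. f N i) \<longlonglongrightarrow> x' i ((T ^^ k) (x i))" for i
    proof (rule Lim_transform_eventually)
      show "(\<lambda>N. x' i ((trunc N ^^ k) (x i))) \<longlonglongrightarrow> x' i ((T ^^ k) (x i))"
        by (rule bounded_clinear_tendsto[OF bcl trunc_pow_tendsto])
      show "\<forall>\<^sub>F N in sequentially. x' i ((trunc N ^^ k) (x i)) = f N i"
        using eventually_gt_at_top[of i] by eventually_elim (simp add: f_def)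
    qed
    show "norm (f N i) \<le> L ^ k * t i" for N i
    proof -
      have "norm (x' i ((trunc N ^^ k) (x i))) \<le> onorm (x' i) * norm ((trunc N ^^ k) (x i))"
        by (rule bounded_clinear_norm_le[OF bcl])
      also have "\<dots> \<le> onorm (x' i) * (L ^ k * norm (x i))"
        by (intro mult_left_mono norm_trunc_pow_le onorm_nonneg)
      also have "\<dots> = L ^ k * t i" by (simp add: t_def)
      finally show ?thesis using t_nonneg[of i] L_nonneg by (simp add: f_def)
    qed
    show "summable (\<lambda>i. L ^ k * t i)" by (rule summable_mult[OF summable_t])
  qed
  ultimately show ?thesis by (simp add: trace_seq_def)
qed

text \<open>Makes \<open>trace_seq k\<close> the trace of one explicit representation of
  \<open>T ^^ Suc k\<close>. Moving the other \<open>k\<close> factors onto the vectors enlarges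
  their norms by at most L^k.\<close>

lemma power_representation: "nuclear_rep s (T ^^ Suc k) x' (\<lambda>i. (T ^^ k) (x i))"
  unfolding nuclear_rep_def
proof (intro conjI allI)
  show "bounded_clinear (x' i)" for i by (rule bcl)
  show "summable (\<lambda>i. onorm (x' i) powr s * norm ((T ^^ k) (x i)) powr s)"
  proof (rule summable_comparison_test'[OF summable_mult[OF summable_t_powr, of "(L ^ k) powr s"]])
    fix i
    have "norm ((T ^^ k) (x i)) powr s \<le> (L ^ k * norm (x i)) powr s"
      using s by (intro powr_mono2 norm_T_pow_le) auto
    also have "\<dots> = (L ^ k) powr s * norm (x i) powr s"
      using L_nonneg by (simp add: powr_mult)
    finally have "onorm (x' i) powr s * norm ((T ^^ k) (x i)) powr s \<le> onorm (x' i) powr s * ((L ^ k) powr s * norm (x i) powr s)"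
      by (rule mult_left_mono) simp
    then show "norm (onorm (x' i) powr s * norm ((T ^^ k) (x i)) powr s) \<le> (L ^ k) powr s * t i powr s"
      using onorm_nonneg by (simp add: t_def powr_mult mult_ac)
  qed
  show "(\<lambda>i. x' i y *\<^sub>C (T ^^ k) (x i)) sums (T ^^ Suc k) y" for y
    using bounded_clinear_sums[OF bounded_clinear_funpow[OF bounded_clinear_T] sums[of y]]
    by (simp add: bounded_clinear_scale[OF bounded_clinear_funpow[OF bounded_clinear_T]] funpow_swap1)
qed

end

section \<open>Rank one perturbations and differences of representations\<close>

lemma nuclear_rep_Cons:
  assumes "nuclear_rep s T x' x" "bounded_clinear g"
  shows "nuclear_rep s (\<lambda>y. g y *\<^sub>C z + T y) (case_nat g x') (case_nat z x)"
  unfolding nuclear_rep_def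
proof (intro conjI allI)
  show "bounded_clinear (case_nat g x' k)" for k
    using assms by (cases k) (auto simp: nuclear_rep_def)
  have "summable (\<lambda>k. onorm (x' k) powr s * norm (x k) powr s)" using assms by (simp add: nuclear_rep_def)
  then show "summable (\<lambda>k. onorm (case_nat g x' k) powr s * norm (case_nat z x k) powr s)"
    by (subst summable_Suc_iff[symmetric]) simp
  show "(\<lambda>k. case_nat g x' k y *\<^sub>C case_nat z x k) sums (g y *\<^sub>C z + T y)" for y
  proof -
    have "(\<lambda>k. x' k y *\<^sub>C x k) sums T y" using assms by (simp add: nuclear_rep_def)
    then have "(\<lambda>k. case_nat g x' (Suc k) y *\<^sub>C case_nat z x (Suc k)) sums T y" by simp
    from sums_Suc[OF this] show ?thesis by (simp add: add.commute)
  qed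
qed

lemma sums_interleave:
  fixes f g :: "nat \<Rightarrow> 'a::real_normed_vector"
  assumes "f sums a" "g sums b"
  shows "(\<lambda>n. if even n then f (n div 2) else g (n div 2)) sums (a + b)"
proof -
  have "(\<lambda>n. if even n then f (n div 2) else 0) sums a"
    using assms(1) by (subst sums_mono_reindex[of "\<lambda>n. 2 * n", symmetric])
      (auto simp: strict_mono_def elim!: evenE)
  moreover have "(\<lambda>n. if even n then 0 else g (n div 2)) sums b"
    using assms(2) by (subst sums_mono_reindex[of "\<lambda>n. 2 * n + 1", symmetric])
      (auto simp: strict_mono_def elim!: oddE)
  ultimately have "(\<lambda>n. (if even n then f (n div 2) else 0) + (if even n then 0 else g (n div 2))) sums (a + b)"
    by (rule sums_add)
  then show ?thesis by (rule back_subst[of "\<lambda>f. f sums (a + b)"]) auto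
qed

text \<open>Two representations of the same operator yield one of zero, which reduces uniqueness of
  the trace to that case.\<close>

lemma nuclear_rep_interleave:
  assumes S: "nuclear_rep s S x' x" and T: "nuclear_rep s T u' u"
  shows "nuclear_rep s (\<lambda>y. S y - T y) (\<lambda>n. if even n then x' (n div 2) else u' (n div 2))
     (\<lambda>n. if even n then x (n div 2) else - u (n div 2))"
  unfolding nuclear_rep_def
proof (intro conjI allI)
  show "bounded_clinear (if even k then x' (k div 2) else u' (k div 2))" for k
    using S T by (auto simp: nuclear_rep_def)
  have "summable (\<lambda>k. onorm (x' k) powr s * norm (x k) powr s)" "summable (\<lambda>k. onorm (u' k) powr s * norm (u k) powr s)"
    using S T by (simp_all add: nuclear_rep_def)
  from sums_interleave[OF this[THEN summable_sums], THEN sums_summable]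
  show "summable (\<lambda>k. onorm (if even k then x' (k div 2) else u' (k div 2)) powr s *
      norm (if even k then x (k div 2) else - u (k div 2)) powr s)"
    by (rule back_subst[of summable]) (auto simp: fun_eq_iff)
  fix y
  have "(\<lambda>k. x' k y *\<^sub>C x k) sums S y" "(\<lambda>k. - (u' k y *\<^sub>C u k)) sums - T y"
    using S T by (simp_all add: nuclear_rep_def sums_minus)
  from sums_interleave[OF this]
  show "(\<lambda>k. (if even k then x' (k div 2) else u' (k div 2)) y *\<^sub>C (if even k then x (k div 2) else - u (k div 2)))
      sums (S y - T y)"
    by (auto simp: scaleC.minus_right elim!: back_subst[of "\<lambda>f. f sums (S y - T y)"])
qed

section \<open>The Fredholm determinant of a representation\<close>

text \<open>Homogeneous in \<open>\<phi>\<close> and \<open>y\<close>, so the terms of a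
  representation can be inserted without normalising them first.\<close>

definition determinant_bound :: "'a::complex_banach itself \<Rightarrow> real \<Rightarrow> bool"
  where "determinant_bound _ \<alpha> \<longleftrightarrow> (\<exists>K>0. \<forall>n \<phi> y. (\<forall>i. bounded_clinear (\<phi> i)) \<longrightarrow>
    cmod (det (mat n n (\<lambda>(i,j). \<phi> i (y j :: 'a)))) \<le>
      (K * real n powr \<alpha>) ^ n * (\<Prod>i<n. onorm (\<phi> i) * norm (y i)))"

lemma no_subset_of_card_gt: "{S. S \<subseteq> {0..<N} \<and> card S = n} = {}" if "n > (N::nat)"
proof -
  have "card S \<noteq> n" if "S \<subseteq> {0..<N}" for S
    using card_mono[OF finite_atLeastLessThan that] \<open>n > N\<close> by simp
  then show ?thesis by blast
qed

locale nuclear_representation_det = nuclear_representation +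
  fixes \<alpha> :: real
  assumes determinant_bound: "determinant_bound TYPE('a) \<alpha>"
    and \<alpha>: "1 / s = 1 + \<alpha>" "\<alpha> \<ge> 0"
begin

abbreviation "entry \<equiv> \<lambda>i j. x' i (x j)"

lemma matrix_coeff_eq_sum_minors:
  "fredholm_coeff (matrix_trace N) n = (\<Sum>S | S \<subseteq> {0..<N} \<and> card S = n. (- 1) ^ n * minor entry S)"
  using fredholm_coeff_eq_sum_minors[of N entry n]
  by (simp add: matrix_trace_def[abs_def] M_def del: pow_mat.simps)

text \<open>Rows and columns of a principal minor use the same index set, so the norms combine to a
  product of \<open>t k\<close>. The constant is independent of \<open>N\<close>, which lets the
  bound pass to the limit.\<close>

lemma matrix_coeff_bound:
  assumes "\<epsilon> > 0"
  shows "\<exists>C. \<forall>N n. cmod (fredholm_coeff (matrix_trace N) n) \<le> C * \<epsilon> ^ n / fact n"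
proof -
  obtain K where K: "K > 0" and bd: "\<And>n \<phi> y. (\<And>i. bounded_clinear (\<phi> i)) \<Longrightarrow>
    cmod (det (mat n n (\<lambda>(i,j). \<phi> i (y j :: 'a)))) \<le> (K * real n powr \<alpha>) ^ n * (\<Prod>i<n. onorm (\<phi> i) * norm (y i))"
    using determinant_bound unfolding determinant_bound_def by blast
  have minor: "cmod (minor entry S) \<le> (K * real n powr \<alpha>) ^ n * (\<Prod>k\<in>S. t k)"
    if S: "S \<subseteq> {0..<N}" "card S = n" for S N n
  proof -
    have "finite S" using S finite_subset by blast
    then obtain e where e: "bij_betw e {0..<n} S"
      using ex_bij_betw_nat_finite[of S] S(2) by blast
    have "cmod (minor entry S) \<le> (K * real n powr \<alpha>) ^ n * (\<Prod>i<n. onorm (x' (e i)) * norm (x (e i)))"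
      unfolding minor_bij_betw[OF e] by (rule bd[of "\<lambda>i. x' (e i)" n "\<lambda>j. x (e j)"]) (rule bcl)
    also have "(\<Prod>i<n. onorm (x' (e i)) * norm (x (e i))) = (\<Prod>k\<in>S. t k)"
      using prod.reindex_bij_betw[OF e, of t] by (simp add: t_def atLeast0LessThan)
    finally show ?thesis .
  qed
  obtain C where C: "\<And>N n. (K * real n powr \<alpha>) ^ n *
      (\<Sum>S | S \<subseteq> {0..<N} \<and> card S = n. \<Prod>k\<in>S. t k) \<le> C * \<epsilon> ^ n / fact n"
    using sum_prod_subsets_powr_bound[OF t_nonneg summable_t_powr s(1) \<alpha> K assms] by blast
  have "cmod (fredholm_coeff (matrix_trace N) n) \<le> C * \<epsilon> ^ n / fact n" for N n
  proof -
    have "cmod (fredholm_coeff (matrix_trace N) n) \<le>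
        (\<Sum>S | S \<subseteq> {0..<N} \<and> card S = n. (K * real n powr \<alpha>) ^ n * (\<Prod>k\<in>S. t k))"
      unfolding matrix_coeff_eq_sum_minors
      by (rule sum_norm_le) (use minor in \<open>auto simp: norm_mult norm_power\<close>)
    also have "\<dots> \<le> C * \<epsilon> ^ n / fact n"
      using C by (simp add: sum_distrib_left)
    finally show ?thesis .
  qed
  then show ?thesis by blast
qed

lemma matrix_minimal_type: "minimal_type (fredholm_coeff (matrix_trace N))"
  unfolding minimal_type_def using matrix_coeff_bound by blast

lemma matrix_coeff_tendsto:
  "(\<lambda>N. fredholm_coeff (matrix_trace N) n) \<longlonglongrightarrow> fredholm_coeff trace_seq n"
  by (rule tendsto_fredholm_coeff) (rule matrix_trace_tendsto)

lemma trace_seq_minimal_type: "minimal_type (fredholm_coeff trace_seq)"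
  by (rule minimal_type_LIMSEQ[OF matrix_coeff_tendsto]) (rule matrix_coeff_bound)

definition "limit_det z = (\<Sum>n. fredholm_coeff trace_seq n * z ^ n)"
definition "trunc_det N z = (\<Sum>n. fredholm_coeff (matrix_trace N) n * z ^ n)"

lemma trunc_det_eq_det: "trunc_det N z = det (mat N N (\<lambda>(i,j). (if i = j then 1 else 0) - z * x' i (x j)))"
proof -
  have "trunc_det N z = (\<Sum>n\<le>N. fredholm_coeff (matrix_trace N) n * z ^ n)"
    unfolding trunc_det_def
    by (rule suminf_finite) (auto simp: matrix_coeff_eq_sum_minors no_subset_of_card_gt)
  also have "\<dots> = (\<Sum>n\<le>N. \<Sum>S | S \<in> Pow {0..<N} \<and> card S = n. (- z) ^ card S * minor entry S)"
    unfolding matrix_coeff_eq_sum_minors sum_distrib_right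
    by (intro sum.cong refl) (auto simp: power_minus[of z] mult_ac)
  also have "\<dots> = (\<Sum>S\<in>Pow {0..<N}. (- z) ^ card S * minor entry S)"
  proof (rule sum.group)
    show "card ` Pow {0..<N} \<subseteq> {..N}" using card_mono[of "{0..<N}"] by auto
  qed auto
  also have "\<dots> = det (mat N N (\<lambda>(i,j). (if i = j then 1 else 0) - z * x' i (x j)))"
    by (rule det_one_minus_smult[symmetric])
  finally show ?thesis .
qed

text \<open>Convergence of each coefficient together with a summable bound independent of
  \<open>N\<close> gives uniform convergence on discs, as Hurwitz's theorem requires.\<close>

lemma trunc_det_uniform_limit:
  assumes "compact A"
  shows "uniform_limit A trunc_det limit_det sequentially"
proof -
  obtain r where r: "r > 0" "\<And>z. z \<in> A \<Longrightarrow> cmod z \<le> r"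
    using compact_imp_bounded[OF assms] unfolding bounded_pos by blast
  obtain C where C: "\<And>N n. cmod (fredholm_coeff (matrix_trace N) n) \<le> C * 1 ^ n / fact n"
    using matrix_coeff_bound[of 1, OF less_numeral_extra(1)] by blast
  define d where "d = (\<lambda>N n. cmod (fredholm_coeff (matrix_trace N) n - fredholm_coeff trace_seq n) * r ^ n)"
  define B where "B = (\<lambda>n. 2 * C * (r ^ n / fact n))"
  have C': "cmod (fredholm_coeff trace_seq n) \<le> C * 1 ^ n / fact n" for n
    by (rule LIMSEQ_le_const2[OF tendsto_norm[OF matrix_coeff_tendsto]]) (use C in blast)
  have dB: "d N n \<le> B n" for N n
  proof -
    have "cmod (fredholm_coeff (matrix_trace N) n - fredholm_coeff trace_seq n) \<le> 2 * C / fact n"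
      using norm_triangle_ineq4[of "fredholm_coeff (matrix_trace N) n" "fredholm_coeff trace_seq n"] C[of N n] C'[of n]
      by simp
    from mult_right_mono[OF this, of "r ^ n"] show ?thesis using r(1) by (simp add: d_def B_def)
  qed
  have sB: "summable B" unfolding B_def
    using summable_exp[of r] by (intro summable_mult) (simp add: divide_inverse mult.commute)
  have d0: "d N n \<ge> 0" for N n using r(1) by (simp add: d_def)
  have sd: "summable (d N)" for N
    by (rule summable_comparison_test'[OF sB]) (use dB d0 in simp)
  have "(\<lambda>N. \<Sum>n. d N n) \<longlonglongrightarrow> (\<Sum>n. 0)"
  proof (rule tendsto_suminf_dominated[OF _ _ sB])
    show "(\<lambda>N. d N n) \<longlonglongrightarrow> 0" for n
    proof -
      have "(\<lambda>N. cmod (fredholm_coeff (matrix_trace N) n - fredholm_coeff trace_seq n)) \<longlonglongrightarrow> 0"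
        using matrix_coeff_tendsto[of n] by (intro tendsto_norm_zero) (rule LIM_zero)
      then show ?thesis unfolding d_def by (rule tendsto_mult_left_zero)
    qed
    show "norm (d N n) \<le> B n" for N n using dB d0 by simp
  qed
  then have lim: "(\<lambda>N. \<Sum>n. d N n) \<longlonglongrightarrow> 0" by simp
  have le: "dist (trunc_det N z) (limit_det z) \<le> (\<Sum>n. d N n)" if "z \<in> A" for N z
  proof -
    have "trunc_det N z - limit_det z = (\<Sum>n. fredholm_coeff (matrix_trace N) n * z ^ n - fredholm_coeff trace_seq n * z ^ n)"
      unfolding trunc_det_def limit_det_def
      by (rule suminf_diff; rule summable_norm_cancel; rule minimal_type_summable_norm)
         (rule matrix_minimal_type trace_seq_minimal_type)+
    also have "norm \<dots> \<le> (\<Sum>n. d N n)"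
    proof (rule norm_suminf_le[OF _ sd])
      show "norm (fredholm_coeff (matrix_trace N) n * z ^ n - fredholm_coeff trace_seq n * z ^ n) \<le> d N n" for n
      proof -
        have "cmod z ^ n \<le> r ^ n" using r(2)[OF that] by (intro power_mono) auto
        then show ?thesis
          unfolding d_def left_diff_distrib[symmetric] norm_mult norm_power by (intro mult_left_mono) auto
      qed
    qed
    finally show ?thesis by (simp add: dist_norm)
  qed
  show ?thesis
  proof (rule uniform_limitI)
    fix e :: real assume "e > 0"
    then have "\<forall>\<^sub>F N in sequentially. (\<Sum>n. d N n) < e" using lim by (rule order_tendstoD(2)[rotated])
    then show "\<forall>\<^sub>F N in sequentially. \<forall>z\<in>A. dist (trunc_det N z) (limit_det z) < e"
      by eventually_elim (use le le_less_trans in blast)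
  qed
qed

text \<open>A kernel vector \<open>u\<close> of the matrix is pushed to the combination
  \<open>y\<close> of the vectors \<open>x j\<close>. Its entries are recovered as z x'_i y, so
  \<open>y\<close> cannot vanish. Unit length is arranged so that a limit of such vectors stays
  nonzero.\<close>

lemma trunc_det_zero_eigenvector:
  assumes "trunc_det N z = 0"
  obtains y where "norm y = 1" "y = z *\<^sub>C trunc N y"
proof -
  define A where "A = mat N N (\<lambda>(i,j). (if i = j then 1 else 0) - z * x' i (x j))"
  have A: "A \<in> carrier_mat N N" by (simp add: A_def)
  have "det A = 0" using assms by (simp add: trunc_det_eq_det A_def)
  then obtain v where v: "v \<in> carrier_vec N" "v \<noteq> 0\<^sub>v N" "A *\<^sub>v v = 0\<^sub>v N"
    using det_0_iff_vec_prod_zero[OF A] by blast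
  define u where "u = vec_index v"
  define y where "y = (\<Sum>j<N. u j *\<^sub>C x j)"
  have x'y: "x' i y = (\<Sum>j<N. x' i (x j) * u j)" for i
    unfolding y_def by (simp add: bounded_clinear_simps[OF bcl] bounded_clinear_scale_complex[OF bcl] mult.commute)
  have ui: "u i = z * x' i y" if "i < N" for i
  proof -
    have "vec_index (A *\<^sub>v v) i = 0" using v(3) that by simp
    then have "(\<Sum>j<N. ((if i = j then 1 else 0) - z * x' i (x j)) * u j) = 0"
      using that v(1) by (simp add: A_def scalar_prod_def u_def atLeast0LessThan)
    also have "(\<Sum>j<N. ((if i = j then 1 else 0) - z * x' i (x j)) * u j) =
        (\<Sum>j<N. if i = j then u j else 0) - z * (\<Sum>j<N. x' i (x j) * u j)"
      unfolding sum_distrib_left sum_subtractf[symmetric] by (intro sum.cong refl) (simp add: left_diff_distrib)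
    finally show ?thesis using that by (simp add: x'y)
  qed
  have "z *\<^sub>C trunc N y = (\<Sum>i<N. (z * x' i y) *\<^sub>C x i)"
    by (simp add: trunc_def scaleC.sum_right scaleC_scaleC)
  also have "\<dots> = (\<Sum>i<N. u i *\<^sub>C x i)" by (intro sum.cong refl) (simp only: lessThan_iff ui)
  also have "\<dots> = y" by (simp only: y_def)
  finally have y: "z *\<^sub>C trunc N y = y" .
  have "y \<noteq> 0"
  proof
    assume "y = 0"
    then have "u i = 0" if "i < N" for i using ui[OF that] bounded_clinear_simps(3)[OF bcl] by simp
    then have "v = 0\<^sub>v N" using v(1) by (intro eq_vecI) (auto simp: u_def)
    then show False using v(2) by simp
  qed
  define c where "c = complex_of_real (1 / norm y)"
  show thesis
  proof (rule that[of "c *\<^sub>C y"])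
    show "norm (c *\<^sub>C y) = 1" using \<open>y \<noteq> 0\<close> by (simp add: c_def norm_scaleC norm_divide)
    have "z *\<^sub>C trunc N (c *\<^sub>C y) = c *\<^sub>C z *\<^sub>C trunc N y"
      by (simp add: trunc_linear scaleC_scaleC mult.commute)
    then show "c *\<^sub>C y = z *\<^sub>C trunc N (c *\<^sub>C y)" by (simp add: y)
  qed
qed

lemma limit_det_holomorphic: "limit_det holomorphic_on UNIV"
  unfolding limit_det_def[abs_def] by (rule minimal_type_holomorphic[OF trace_seq_minimal_type])

lemma trunc_det_holomorphic: "trunc_det N holomorphic_on UNIV"
  unfolding trunc_det_def[abs_def] by (rule minimal_type_holomorphic[OF matrix_minimal_type])

lemma limit_det_0: "limit_det 0 = 1"
  unfolding limit_det_def using powser_zero[of "fredholm_coeff trace_seq"] by simp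

text \<open>Hurwitz's theorem for the sequence shifted by \<open>m\<close>. Were the limit constant
  near its zero, it would vanish identically, against its value 1 at the origin.\<close>

lemma zero_of_limit_det_approximated:
  assumes "limit_det z0 = 0" "r > 0"
  shows "\<exists>N\<ge>m. \<exists>z\<in>ball z0 r. trunc_det N z = 0"
proof (rule ccontr)
  assume no: "\<not> ?thesis"
  have "limit_det z0 \<noteq> 0"
  proof (rule Hurwitz_no_zeros[of "ball z0 r" "\<lambda>N. trunc_det (N + m)" limit_det])
    show "trunc_det (N + m) holomorphic_on ball z0 r" for N using trunc_det_holomorphic holomorphic_on_subset by blast
    show "limit_det holomorphic_on ball z0 r" using limit_det_holomorphic holomorphic_on_subset by blast
    show "uniform_limit A (\<lambda>N. trunc_det (N + m)) limit_det sequentially" if "compact A" for A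
      using trunc_det_uniform_limit[OF that] filterlim_add_const_nat_at_top[of m]
      by (rule filterlim_compose)
    show "\<not> limit_det constant_on ball z0 r"
    proof
      assume "limit_det constant_on ball z0 r"
      then obtain c where c: "\<And>z. z \<in> ball z0 r \<Longrightarrow> limit_det z = c" unfolding constant_on_def by blast
      have "limit_det 0 = 0"
      proof (rule analytic_continuation[OF limit_det_holomorphic open_UNIV connected_UNIV, of "ball z0 r" z0])
        show "limit_det z = 0" if "z \<in> ball z0 r" for z
          using c[OF that] c[of z0] assms by simp
      qed (use assms(2) in \<open>auto simp: islimpt_ball\<close>)
      then show False by (simp add: limit_det_0)
    qed
    show "trunc_det (N + m) z \<noteq> 0" if "z \<in> ball z0 r" for N z using no that le_add2[of m N] by blast
  qed (use assms in auto)
  then show False using assms by simp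
qed

text \<open>The zero is a limit of zeros of the finite determinants; the coordinates of the corresponding
  unit eigenvectors of the truncations converge along a subsequence, and so do the eigenvectors.\<close>

lemma zero_of_limit_det_imp_eigenvalue:
  assumes "limit_det z0 = 0"
  shows "Defs.eigenvalue T (1 / z0)"
proof -
  have "\<forall>m. \<exists>N z y. N \<ge> m \<and> dist z0 z < 1 / Suc m \<and> norm y = 1 \<and> y = z *\<^sub>C trunc N y"
  proof
    fix m
    obtain N z where "N \<ge> m" "z \<in> ball z0 (1 / Suc m)" "trunc_det N z = 0"
      using zero_of_limit_det_approximated[OF assms, of "1 / Suc m" m] by auto
    moreover obtain y where "norm y = 1" "y = z *\<^sub>C trunc N y"
      using trunc_det_zero_eigenvector[OF \<open>trunc_det N z = 0\<close>] by blast
    ultimately show "\<exists>N z y. N \<ge> m \<and> dist z0 z < 1 / Suc m \<and> norm y = 1 \<and> y = z *\<^sub>C trunc N y"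
      by auto
  qed
  then obtain N z y where N: "\<And>m. N m \<ge> m" and z: "\<And>m. dist z0 (z m) < 1 / Suc m"
    and y1: "\<And>m. norm (y m) = 1" and y: "\<And>m. y m = z m *\<^sub>C trunc (N m) (y m)"
    unfolding choice_iff by blast
  have zlim: "z \<longlonglongrightarrow> z0"
  proof (rule LIM_zero_cancel, rule Lim_null_comparison[OF always_eventually LIMSEQ_inverse_real_of_nat], rule allI)
    show "norm (z m - z0) \<le> inverse (real (Suc m))" for m
      using z[of m] by (simp add: dist_norm norm_minus_commute inverse_eq_divide)
  qed
  have xb: "cmod (x' k (y m)) \<le> onorm (x' k)" for k m
    using bounded_clinear_norm_le[OF bcl, of k "y m"] y1 by simp
  \<comment> \<open>The subsequence theorem is applied with the single bound 1 for all coordinates,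
    hence the division; adding 1 keeps the divisor nonzero when the functional is zero.\<close>
  define w where "w = (\<lambda>k. complex_of_real (onorm (x' k) + 1))"
  have w: "cmod (w k) = onorm (x' k) + 1" "w k \<noteq> 0" for k
    using onorm_nonneg[of k] by (simp_all add: w_def del: of_real_add add: norm_of_real)
  obtain r where r: "strict_mono r" and conv: "\<And>k. \<exists>l. (\<lambda>m. x' k (y (r m)) / w k) \<longlonglongrightarrow> l"
  proof (rule function_convergent_subsequence[of UNIV "\<lambda>m k. x' k (y m) / w k" 1])
    show "cmod (x' k (y m) / w k) \<le> 1" for m k
      using xb[of k m] w(1)[of k] onorm_nonneg[of k] by (simp add: norm_divide)
  qed auto
  have "\<forall>k. \<exists>l. (\<lambda>m. x' k (y (r m))) \<longlonglongrightarrow> l"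
  proof
    fix k
    obtain l where "(\<lambda>m. x' k (y (r m)) / w k) \<longlonglongrightarrow> l" using conv by blast
    from tendsto_mult[OF this tendsto_const[of "w k"]] w(2)[of k]
    show "\<exists>l. (\<lambda>m. x' k (y (r m))) \<longlonglongrightarrow> l" by auto
  qed
  then obtain l where l: "\<And>k. (\<lambda>m. x' k (y (r m))) \<longlonglongrightarrow> l k" unfolding choice_iff by blast
  define f where "f = (\<lambda>m k. if k < N (r m) then x' k (y (r m)) *\<^sub>C x k else 0)"
  have f: "(\<Sum>k. f m k) = trunc (N (r m)) (y (r m))" for m
  proof -
    have "(\<Sum>k. f m k) = (\<Sum>k<N (r m). f m k)" by (rule suminf_finite) (auto simp: f_def)
    then show ?thesis by (simp add: f_def trunc_def)
  qed
  have "(\<lambda>m. \<Sum>k. f m k) \<longlonglongrightarrow> (\<Sum>k. l k *\<^sub>C x k)"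
  proof (rule tendsto_suminf_dominated[OF _ _ summable_t])
    show "(\<lambda>m. f m k) \<longlonglongrightarrow> l k *\<^sub>C x k" for k
    proof (rule Lim_transform_eventually)
      show "(\<lambda>m. x' k (y (r m)) *\<^sub>C x k) \<longlonglongrightarrow> l k *\<^sub>C x k"
        by (rule scaleC.tendsto[OF l tendsto_const])
      show "\<forall>\<^sub>F m in sequentially. x' k (y (r m)) *\<^sub>C x k = f m k"
        using eventually_gt_at_top[of k]
      proof eventually_elim
        case (elim m)
        have "k < N (r m)" using elim N[of "r m"] seq_suble[OF r, of m] by linarith
        then show ?case by (simp add: f_def)
      qed
    qed
    show "norm (f m k) \<le> t k" for m k
      using norm_term_le[of k "y (r m)"] y1[of "r m"] t_nonneg[of k] by (simp add: f_def)
  qed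
  then have "(\<lambda>m. trunc (N (r m)) (y (r m))) \<longlonglongrightarrow> (\<Sum>k. l k *\<^sub>C x k)" by (simp only: f)
  moreover have "(\<lambda>m. z (r m)) \<longlonglongrightarrow> z0" using LIMSEQ_subseq_LIMSEQ[OF zlim r] by (simp add: o_def)
  ultimately have "(\<lambda>m. z (r m) *\<^sub>C trunc (N (r m)) (y (r m))) \<longlonglongrightarrow> z0 *\<^sub>C (\<Sum>k. l k *\<^sub>C x k)"
    by (intro scaleC.tendsto)
  then have ylim: "(\<lambda>m. y (r m)) \<longlonglongrightarrow> z0 *\<^sub>C (\<Sum>k. l k *\<^sub>C x k)" by (simp flip: y)
  define Y where "Y = z0 *\<^sub>C (\<Sum>k. l k *\<^sub>C x k)"
  have "(\<lambda>m. norm (y (r m))) \<longlonglongrightarrow> norm Y" unfolding Y_def by (rule tendsto_norm[OF ylim])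
  then have Y1: "norm Y = 1" using y1 by (simp add: LIMSEQ_const_iff)
  \<comment> \<open>The numbers \<open>l k\<close> arose as limits of coordinates; recognising them
    as the coordinates of \<open>Y\<close> turns the limit series into \<open>T Y\<close>.\<close>
  have "l k = x' k Y" for k
    by (rule LIMSEQ_unique[OF l]) (use bounded_clinear_tendsto[OF bcl ylim] in \<open>simp add: Y_def\<close>)
  then have "(\<Sum>k. l k *\<^sub>C x k) = T Y" using sums[of Y] by (simp add: sums_iff)
  then have TY: "Y = z0 *\<^sub>C T Y" by (simp add: Y_def)
  have "z0 \<noteq> 0" using assms limit_det_0 by auto
  have "T Y = (1 / z0) *\<^sub>C z0 *\<^sub>C T Y" using \<open>z0 \<noteq> 0\<close> by (simp only: scaleC_scaleC) simp
  then have "T Y = (1 / z0) *\<^sub>C Y" by (simp flip: TY)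
  moreover have "Y \<noteq> 0" using Y1 by auto
  ultimately show ?thesis unfolding Defs.eigenvalue_def by blast
qed

end

section \<open>Evenness and linear factors of entire power series\<close>

lemma minimal_type_coeff_unique:
  assumes "minimal_type c" "minimal_type d" "\<And>z. (\<Sum>n. c n * z ^ n) = (\<Sum>n. d n * z ^ n)"
  shows "c = d"
proof -
  have conv: "fps_conv_radius (Abs_fps e) > 0" if "minimal_type e" for e
  proof -
    have "conv_radius e = \<infinity>"
      by (rule conv_radius_inftyI'', rule summable_norm_cancel, rule minimal_type_summable_norm[OF that])
    then show ?thesis by (simp add: fps_conv_radius_def)
  qed
  have "Abs_fps c = Abs_fps d"
    by (rule eval_fps_eqD[OF conv[OF assms(1)] conv[OF assms(2)]]) (simp add: eval_fps_def assms(3))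
  then show ?thesis by (simp add: fps_eq_iff fun_eq_iff)
qed

lemma minimal_type_reflect: "minimal_type c \<Longrightarrow> minimal_type (\<lambda>n. (- 1) ^ n * c n)"
  by (simp add: minimal_type_def norm_mult norm_power)

lemma minimal_type_even_iff:
  assumes "minimal_type c"
  shows "(\<forall>z. (\<Sum>n. c n * (- z) ^ n) = (\<Sum>n. c n * z ^ n)) \<longleftrightarrow> (\<forall>n. odd n \<longrightarrow> c n = 0)"
proof -
  have eq: "(\<Sum>n. c n * (- z) ^ n) = (\<Sum>n. ((- 1) ^ n * c n) * z ^ n)" for z
    by (simp add: power_minus[of z] mult_ac)
  show ?thesis
  proof
    assume "\<forall>z. (\<Sum>n. c n * (- z) ^ n) = (\<Sum>n. c n * z ^ n)"
    then have "(\<lambda>n. (- 1) ^ n * c n) = c"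
      by (intro minimal_type_coeff_unique minimal_type_reflect assms) (simp add: eq)
    then have "(- 1) ^ n * c n = c n" for n by (rule fun_cong)
    then show "\<forall>n. odd n \<longrightarrow> c n = 0" by (metis minus_one_power_iff mult_minus1 neg_eq_iff_add_eq_0 mult_2 mult_eq_0_iff zero_neq_numeral)
  next
    assume odd: "\<forall>n. odd n \<longrightarrow> c n = 0"
    have "(- 1) ^ n * c n = c n" for n using odd by (cases "even n") auto
    then show "\<forall>z. (\<Sum>n. c n * (- z) ^ n) = (\<Sum>n. c n * z ^ n)" unfolding eq by (simp only: simp_thms)
  qed
qed

text \<open>Carries the formal factorisation of \<open>fredholm_coeff_add_power\<close> over to the
  values of the entire functions.\<close>

lemma suminf_linear_factor:
  assumes c: "minimal_type c" and d: "minimal_type d"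
    and eq: "Abs_fps c = (1 - fps_const l * fps_X) * Abs_fps d"
  shows "(\<Sum>n. c n * z ^ n) = (1 - l * z) * (\<Sum>n. d n * z ^ n)"
proof -
  have sc: "summable (\<lambda>n. c n * z ^ n)" and sd: "summable (\<lambda>n. d n * z ^ n)"
    using minimal_type_summable_norm[OF c] minimal_type_summable_norm[OF d] by (blast intro: summable_norm_cancel)+
  have c0: "c 0 = d 0" using arg_cong[OF eq, of "\<lambda>f. fps_nth f 0"] by simp
  have cS: "c (Suc n) = d (Suc n) - l * d n" for n
    using arg_cong[OF eq, of "\<lambda>f. fps_nth f (Suc n)"] by (simp add: algebra_simps)
  have sd': "summable (\<lambda>n. d (Suc n) * z ^ Suc n)" using sd summable_Suc_iff[of "\<lambda>n. d n * z ^ n"] by blast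
  have "(\<Sum>n. c n * z ^ n) = c 0 + (\<Sum>n. c (Suc n) * z ^ Suc n)"
    using suminf_split_head[OF sc] by simp
  also have "(\<Sum>n. c (Suc n) * z ^ Suc n) = (\<Sum>n. d (Suc n) * z ^ Suc n - (l * z) * (d n * z ^ n))"
    by (simp add: cS algebra_simps)
  also have "\<dots> = (\<Sum>n. d (Suc n) * z ^ Suc n) - (\<Sum>n. (l * z) * (d n * z ^ n))"
    by (rule suminf_diff[symmetric, OF sd' summable_mult[OF sd]])
  also have "(\<Sum>n. (l * z) * (d n * z ^ n)) = (l * z) * (\<Sum>n. d n * z ^ n)"
    by (rule suminf_mult[OF sd])
  also have "(\<Sum>n. d (Suc n) * z ^ Suc n) = (\<Sum>n. d n * z ^ n) - d 0"
    using suminf_split_head[OF sd] by simp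
  finally show ?thesis by (simp add: c0 algebra_simps)
qed

section \<open>Root spaces\<close>

definition root_space :: "('a::complex_normed_vector \<Rightarrow> 'a) \<Rightarrow> complex \<Rightarrow> 'a set"
  where "root_space T z = (\<Union>n. {x. ((\<lambda>y. T y - z *\<^sub>C y) ^^ n) x = 0})"

text \<open>The maps \<open>P\<close> and \<open>Q\<close> differ by multiples of \<open>x0\<close>,
  and so do their powers at any vector. \<open>P\<close> annihilates \<open>x0\<close>, while
  \<open>Q\<close> multiplies it by - l, which keeps \<open>x0\<close> out of the root space of the
  deflated operator. Hence exactly one dimension is lost.\<close>

lemma root_space_deflation:
  fixes T :: "'a::complex_normed_vector \<Rightarrow> 'a"
  assumes T: "bounded_clinear T" and g: "bounded_clinear g"
    and x0: "x0 \<noteq> 0" "T x0 = l *\<^sub>C x0" "g x0 = l" and l: "l \<noteq> 0"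
    and B: "complex_space.independent B" "complex_space.span B = root_space (\<lambda>y. T y - g y *\<^sub>C x0) l"
  shows "x0 \<notin> complex_space.span B" "complex_space.span (insert x0 B) = root_space T l"
proof -
  define P where "P = (\<lambda>y. T y - l *\<^sub>C y)"
  define Q where "Q = (\<lambda>y. T y - g y *\<^sub>C x0 - l *\<^sub>C y)"
  have lin: "P (y + c *\<^sub>C v) = P y + c *\<^sub>C P v" "Q (y + c *\<^sub>C v) = Q y + c *\<^sub>C Q v" for y v c
    by (simp_all add: P_def Q_def bounded_clinear_simps[OF T] bounded_clinear_simps[OF g]
        bounded_clinear_scale[OF T] bounded_clinear_scale_complex[OF g] scaleC.add_right scaleC.add_left
        scaleC.diff_right scaleC_scaleC mult.commute algebra_simps)
  have linn: "(P ^^ n) (y + c *\<^sub>C v) = (P ^^ n) y + c *\<^sub>C (P ^^ n) v"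
       "(Q ^^ n) (y + c *\<^sub>C v) = (Q ^^ n) y + c *\<^sub>C (Q ^^ n) v" for n y v c
    by (induction n) (simp_all add: lin)
  have P0: "P 0 = 0" by (simp add: P_def bounded_clinear_simps[OF T] scaleC.zero_right)
  have Px0: "P x0 = 0" by (simp add: P_def x0)
  have Qx0: "Q x0 = (- l) *\<^sub>C x0" by (simp add: Q_def x0 scaleC.minus_left)
  have Pnx0: "(P ^^ Suc n) x0 = 0" for n by (induction n) (simp_all add: Px0 P0)
  have Q0: "Q 0 = 0" using lin(2)[of 0 "-1" 0] by (simp add: scaleC.zero_right Q_def bounded_clinear_simps[OF T] bounded_clinear_simps[OF g] scaleC.zero_left)
  have Qsc: "Q (c *\<^sub>C v) = c *\<^sub>C Q v" for c v using lin(2)[of 0 c v] Q0 by simp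
  have Qnx0: "(Q ^^ n) x0 = ((- l) ^ n) *\<^sub>C x0" for n
  proof (induction n)
    case 0
    show ?case by (simp add: complex_space.scale_one)
  next
    case (Suc n)
    then show ?case by (simp add: Qsc Qx0 scaleC_scaleC mult.commute)
  qed
  have QP: "\<exists>c. (Q ^^ n) y = (P ^^ n) y + c *\<^sub>C x0" for n y
  proof (induction n)
    case 0
    show ?case by (rule exI[of _ 0]) (simp add: scaleC.zero_left)
  next
    case (Suc n)
    then obtain c where c: "(Q ^^ n) y = (P ^^ n) y + c *\<^sub>C x0" by blast
    have "(Q ^^ Suc n) y = Q ((P ^^ n) y) + c *\<^sub>C Q x0" by (simp add: c lin)
    also have "\<dots> = P ((P ^^ n) y) + (- g ((P ^^ n) y) - c * l) *\<^sub>C x0"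
    proof -
      have "Q v = P v - g v *\<^sub>C x0" for v by (simp add: P_def Q_def)
      then have "Q ((P ^^ n) y) = P ((P ^^ n) y) - g ((P ^^ n) y) *\<^sub>C x0" .
      then show ?thesis by (simp add: Qx0 scaleC_scaleC scaleC.minus_left scaleC.diff_left)
    qed
    finally show ?case by auto
  qed
  have rT: "root_space T l = (\<Union>n. {x. (P ^^ n) x = 0})" by (simp add: root_space_def P_def)
  have rT': "complex_space.span B = (\<Union>n. {x. (Q ^^ n) x = 0})" using B(2) by (simp add: root_space_def Q_def)
  show "x0 \<notin> complex_space.span B"
    using x0(1) l by (simp add: rT' Qnx0)
  show "complex_space.span (insert x0 B) = root_space T l"
  proof (intro equalityI subsetI)
    fix y assume "y \<in> complex_space.span (insert x0 B)"
    then obtain k n where k: "(Q ^^ n) (y - k *\<^sub>C x0) = 0"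
      by (auto simp: complex_space.span_insert rT')
    obtain c where "(Q ^^ n) (y - k *\<^sub>C x0) = (P ^^ n) (y - k *\<^sub>C x0) + c *\<^sub>C x0" using QP by blast
    then have "(P ^^ n) (y - k *\<^sub>C x0) = (- c) *\<^sub>C x0"
      using k by (simp add: scaleC.minus_left eq_neg_iff_add_eq_0)
    then have "(P ^^ Suc n) (y - k *\<^sub>C x0) = 0" using lin(1)[of 0 "- c" x0] by (simp add: P0 Px0 scaleC.zero_right)
    then have "(P ^^ Suc n) y + (- k) *\<^sub>C (P ^^ Suc n) x0 = 0"
      using linn(1)[of "Suc n" y "- k" x0] by (simp add: scaleC.minus_left)
    then have "(P ^^ Suc n) y = 0" by (simp add: Pnx0 scaleC.zero_right del: funpow.simps)
    then show "y \<in> root_space T l" unfolding rT by blast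
  next
    fix y assume "y \<in> root_space T l"
    then obtain n where n: "(P ^^ n) y = 0" by (auto simp: rT)
    obtain c where c: "(Q ^^ n) y = (P ^^ n) y + c *\<^sub>C x0" using QP by blast
    \<comment> \<open>Chosen to cancel the remaining multiple of \<open>x0\<close>:
      \<open>Q ^^ n\<close> scales \<open>x0\<close> by the nonzero number (- l)^n.\<close>
    define k where "k = c / (- l) ^ n"
    have "(Q ^^ n) (y + (- k) *\<^sub>C x0) = c *\<^sub>C x0 + (- k) *\<^sub>C ((- l) ^ n) *\<^sub>C x0"
      by (simp only: linn c n Qnx0 add_0)
    also have "\<dots> = (c + (- k) * (- l) ^ n) *\<^sub>C x0" by (simp only: scaleC.add_left scaleC_scaleC)
    also have "c + (- k) * (- l) ^ n = 0" using l by (simp add: k_def)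
    finally have "(Q ^^ n) (y - k *\<^sub>C x0) = 0" by (simp add: scaleC.minus_left scaleC.zero_left)
    then have "y - k *\<^sub>C x0 \<in> complex_space.span B" unfolding rT' by blast
    then show "y \<in> complex_space.span (insert x0 B)" by (auto simp: complex_space.span_insert)
  qed
qed

lemma root_space_not_eigenvalue:
  fixes T :: "'a::complex_normed_vector \<Rightarrow> 'a"
  assumes "bounded_clinear T" "\<not> Defs.eigenvalue T l"
  shows "root_space T l = {0}"
proof -
  define P where "P = (\<lambda>y. T y - l *\<^sub>C y)"
  have P: "P x = 0 \<longleftrightarrow> x = 0" for x
    using assms(2) bounded_clinear_simps(3)[OF assms(1)]
    by (auto simp: P_def Defs.eigenvalue_def scaleC.zero_right)
  have "(P ^^ n) x = 0 \<longleftrightarrow> x = 0" for n x by (induction n) (simp_all add: P)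
  then show ?thesis by (auto simp: root_space_def P_def[symmetric])
qed

lemma algebraic_multiplicity_eqI:
  fixes T :: "'a::complex_normed_vector \<Rightarrow> 'a"
  assumes "complex_space.independent B" "complex_space.span B = root_space T l"
  shows "algebraic_multiplicity T l = card B"
proof -
  have "complex_space.span B = complex_space.span (root_space T l)"
    unfolding assms(2)[symmetric] by (simp add: complex_space.span_span)
  from complex_space.dim_eq_card[OF this assms(1)]
  show ?thesis by (simp add: algebraic_multiplicity_def root_space_def)
qed

section \<open>Traces, eigenvalues and multiplicities\<close>

locale determinant_space =
  fixes s \<alpha> :: real and ty :: "'a::complex_banach itself"
  assumes det_bd: "determinant_bound TYPE('a) \<alpha>"
    and s: "0 < s" "s \<le> 1" and \<alpha>: "1 / s = 1 + \<alpha>" "\<alpha> \<ge> 0"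
begin

lemma representation_det: "nuclear_rep s T x' x \<Longrightarrow> nuclear_representation_det s T x' (x :: nat \<Rightarrow> 'a) \<alpha>"
  using det_bd s \<alpha> by unfold_locales

lemma representation_of_zero:
  assumes "nuclear_rep s (\<lambda>_. 0) x' (x :: nat \<Rightarrow> 'a)" "(\<lambda>k. x' k (x k)) sums t"
  shows "t = 0"
proof -
  interpret nuclear_representation_det s "\<lambda>_. 0" x' x \<alpha> by (rule representation_det[OF assms(1)])
  \<comment> \<open>The zeroth power is the identity, so \<open>trace_seq 0\<close> is the number
    \<open>t\<close> in question and only the later traces vanish.\<close>
  have "((\<lambda>_. 0 :: 'a) ^^ k) y = (if k = 0 then y else 0)" for k y by (cases k) auto
  then have "trace_seq k = (if k = 0 then t else 0)" for k
    using sums_unique[OF assms(2)] by (simp add: trace_seq_def bounded_clinear_simps[OF bcl])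
  then have "trace_seq = (\<lambda>k. if k = 0 then t else 0)" by (rule ext)
  then have "minimal_type (\<lambda>n. (- t) ^ n / fact n)"
    using trace_seq_minimal_type by (simp add: fredholm_coeff_only_first_trace[abs_def])
  then show ?thesis by (rule minimal_type_exp_imp_0)
qed

lemma trace_unique:
  assumes S: "nuclear_rep s S x' (x :: nat \<Rightarrow> 'a)" "(\<lambda>k. x' k (x k)) sums t"
    and S': "nuclear_rep s S u' u" "(\<lambda>k. u' k (u k)) sums t'"
  shows "t = t'"
proof -
  have u: "bounded_clinear (u' k)" for k using S' by (simp add: nuclear_rep_def)
  have "(\<lambda>k. - u' k (u k)) sums - t'" using S'(2) by (rule sums_minus)
  from sums_interleave[OF S(2) this]
  have "(\<lambda>n. (if even n then x' (n div 2) else u' (n div 2)) (if even n then x (n div 2) else - u (n div 2))) sums (t - t')"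
    using bounded_clinear_simps(2)[OF u, of _ 0] bounded_clinear_simps(3)[OF u]
    by (auto elim!: back_subst[of "\<lambda>f. f sums (t - t')"])
  moreover have "nuclear_rep s (\<lambda>_. 0) (\<lambda>n. if even n then x' (n div 2) else u' (n div 2))
     (\<lambda>n. if even n then x (n div 2) else - u (n div 2))"
    using nuclear_rep_interleave[OF S(1) S'(1)] by simp
  ultimately have "t - t' = 0" using representation_of_zero by blast
  then show ?thesis by simp
qed

lemma nuclear_trace_eqI:
  assumes "nuclear_rep s S x' (x :: nat \<Rightarrow> 'a)" "(\<lambda>k. x' k (x k)) sums t"
  shows "nuclear_trace s S = t"
  unfolding nuclear_trace_def
  by (rule the_equality) (use assms trace_unique in blast)+

definition power_trace :: "('a \<Rightarrow> 'a) \<Rightarrow> nat \<Rightarrow> complex"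
  where "power_trace T k = nuclear_trace s (T ^^ Suc k)"

lemma power_trace_eq:
  assumes "nuclear_rep s T x' x"
  shows "power_trace T = nuclear_representation.trace_seq T x' x"
proof
  fix k
  interpret nuclear_representation_det s T x' x \<alpha> by (rule representation_det[OF assms])
  show "power_trace T k = trace_seq k"
    unfolding power_trace_def by (rule nuclear_trace_eqI[OF power_representation trace_seq_sums])
qed

text \<open>Built from nuclear traces instead of a representation, so that an operator and its
  deflations can be compared although they come with different representations.\<close>

definition fredholm :: "('a \<Rightarrow> 'a) \<Rightarrow> complex \<Rightarrow> complex"
  where "fredholm T z = (\<Sum>n. fredholm_coeff (power_trace T) n * z ^ n)"

lemma nuclear_minimal_type:
  assumes "nuclear s (T :: 'a \<Rightarrow> 'a)"
  shows "minimal_type (fredholm_coeff (power_trace T))"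
proof -
  obtain x' x where r: "nuclear_rep s T x' x" using assms unfolding nuclear_def by blast
  interpret nuclear_representation_det s T x' x \<alpha> by (rule representation_det[OF r])
  show ?thesis using trace_seq_minimal_type by (simp add: power_trace_eq[OF r])
qed

lemma fredholm_holomorphic: "nuclear s T \<Longrightarrow> fredholm T holomorphic_on UNIV"
  unfolding fredholm_def[abs_def] by (rule minimal_type_holomorphic[OF nuclear_minimal_type])

lemma fredholm_0: "fredholm T 0 = 1"
  unfolding fredholm_def using powser_zero[of "fredholm_coeff (power_trace T)"] by simp

lemma nuclear_bounded_clinear:
  assumes "nuclear s (T :: 'a \<Rightarrow> 'a)"
  shows "bounded_clinear (T :: 'a \<Rightarrow> 'a)"
proof -
  obtain x' x where r: "nuclear_rep s T x' x" using assms unfolding nuclear_def by blast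
  interpret nuclear_representation_det s T x' x \<alpha> by (rule representation_det[OF r])
  show ?thesis by (rule bounded_clinear_T)
qed

lemma fredholm_zero_imp_eigenvalue:
  assumes "nuclear s (T :: 'a \<Rightarrow> 'a)" "fredholm T z = 0"
  shows "Defs.eigenvalue T (1 / z)"
proof -
  obtain x' x where r: "nuclear_rep s T x' x" using assms unfolding nuclear_def by blast
  interpret nuclear_representation_det s T x' x \<alpha> by (rule representation_det[OF r])
  have "limit_det z = 0" using assms(2) by (simp add: limit_det_def fredholm_def power_trace_eq[OF r])
  then show ?thesis by (rule zero_of_limit_det_imp_eigenvalue)
qed

text \<open>Subtracting the rank one operator \<open>g \<otimes> x0\<close> moves one copy of the eigenvalue \<open>l\<close> to \<open>0\<close>.\<close>

lemma deflation:
  assumes T: "nuclear s T" and l: "l \<noteq> 0" and x0: "x0 \<noteq> 0" "T x0 = l *\<^sub>C x0"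
  obtains g where "bounded_clinear g" "g x0 = l" "nuclear s (\<lambda>y. T y - g y *\<^sub>C x0)"
    "\<And>z. fredholm T z = (1 - l * z) * fredholm (\<lambda>y. T y - g y *\<^sub>C x0) z"
proof -
  obtain x' x where r: "nuclear_rep s T x' x" using T unfolding nuclear_def by blast
  interpret nuclear_representation_det s T x' x \<alpha> by (rule representation_det[OF r])
  have "\<exists>k. x' k x0 \<noteq> 0"
  proof (rule ccontr)
    assume "\<not> ?thesis"
    then have "T x0 = 0" using sums[of x0] by (simp add: scaleC.zero_left sums_iff)
    then show False using x0 l by simp
  qed
  then obtain k where k: "x' k x0 \<noteq> 0" by blast
  \<comment> \<open>Some functional of the representation is nonzero at \<open>x0\<close>, since
    \<open>T x0\<close> is nonzero; a multiple of it takes the value \<open>l\<close> there.\<close>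
  define g where "g = (\<lambda>y. (l / x' k x0) * x' k y)"
  have g: "bounded_clinear g" unfolding g_def by (rule bounded_clinear_cmult[OF bcl])
  have gx0: "g x0 = l" using k by (simp add: g_def)
  define T' where "T' = (\<lambda>y. T y - g y *\<^sub>C x0)"
  have T'_eq: "T' = (\<lambda>y. g y *\<^sub>C (- x0) + T y)" by (simp add: T'_def fun_eq_iff scaleC.minus_right)
  have n': "nuclear s T'"
    unfolding nuclear_def T'_eq using nuclear_rep_Cons[OF r g, of "- x0"] by blast
  have T'0: "T' x0 = 0" by (simp add: T'_def x0 gx0)
  have T'c: "bounded_clinear T'" by (rule nuclear_bounded_clinear[OF n'])
  \<comment> \<open>Because \<open>T'\<close> annihilates \<open>x0\<close>, powers of
    \<open>T'\<close> acquire only one rank one term. Its trace is - g (T^n x0), that is, -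
    l^(n+1).\<close>
  have pow: "(T' ^^ Suc n) y = g ((T ^^ n) y) *\<^sub>C (- x0) + (T ^^ Suc n) y" for n y
  proof (induction n)
    case 0
    show ?case by (simp add: T'_eq)
  next
    case (Suc n)
    have "(T' ^^ Suc (Suc n)) y = T' ((T' ^^ Suc n) y)" by simp
    also have "\<dots> = g ((T ^^ n) y) *\<^sub>C T' (- x0) + T' ((T ^^ Suc n) y)"
      unfolding Suc by (simp only: bounded_clinear_simps[OF T'c] bounded_clinear_scale[OF T'c])
    also have "T' (- x0) = 0" using bounded_clinear_simps(2)[OF T'c, of 0 x0] bounded_clinear_simps(3)[OF T'c] T'0 by simp
    finally show ?case by (simp add: T'_eq scaleC.zero_right)
  qed
  have Tx0: "(T ^^ n) x0 = (l ^ n) *\<^sub>C x0" for n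
  proof (induction n)
    case 0
    show ?case by (simp add: complex_space.scale_one)
  next
    case (Suc n)
    then show ?case by (simp add: bounded_clinear_scale[OF bounded_clinear_T] x0 scaleC_scaleC mult.commute)
  qed
  have tr: "power_trace T n = power_trace T' n + l ^ Suc n" for n
  proof -
    define h where "h = (\<lambda>y. g ((T ^^ n) y))"
    have h: "bounded_clinear h" unfolding h_def
      by (rule bounded_clinear_compose[OF g bounded_clinear_funpow[OF bounded_clinear_T]])
    have "nuclear_rep s (T' ^^ Suc n) (case_nat h x') (case_nat (- x0) (\<lambda>i. (T ^^ n) (x i)))"
      using nuclear_rep_Cons[OF power_representation[of n] h, of "- x0"]
      by (simp add: pow[abs_def] h_def del: funpow.simps)
    moreover have "(\<lambda>i. case_nat h x' i (case_nat (- x0) (\<lambda>i. (T ^^ n) (x i)) i)) sums (trace_seq n - l ^ Suc n)"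
    proof -
      have "h (- x0) = - h x0" using bounded_clinear_simps(2)[OF h, of 0 x0] bounded_clinear_simps(3)[OF h] by simp
      also have "h x0 = l ^ Suc n" by (simp add: h_def Tx0 bounded_clinear_scale_complex[OF g] gx0 mult.commute)
      finally have h0: "h (- x0) = - (l ^ Suc n)" .
      have "(\<lambda>i. (\<lambda>i. case_nat h x' i (case_nat (- x0) (\<lambda>i. (T ^^ n) (x i)) i)) (Suc i)) sums trace_seq n"
        using trace_seq_sums[of n] by simp
      from sums_Suc[OF this] show ?thesis by (simp add: h0)
    qed
    ultimately have "power_trace T' n = trace_seq n - l ^ Suc n"
      unfolding power_trace_def by (rule nuclear_trace_eqI)
    then show ?thesis by (simp add: power_trace_eq[OF r])
  qed
  have "fredholm T z = (1 - l * z) * fredholm T' z" for z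
    unfolding fredholm_def
    by (rule suminf_linear_factor[OF nuclear_minimal_type[OF T] nuclear_minimal_type[OF n']])
       (rule fredholm_coeff_add_power, rule tr)
  then show thesis using that[of g] g gx0 n' by (simp add: T'_def)
qed

lemma eigenvalue_imp_fredholm_zero:
  assumes "nuclear s (T :: 'a \<Rightarrow> 'a)" "Defs.eigenvalue T l" "l \<noteq> 0"
  shows "fredholm T (1 / l) = 0"
proof -
  obtain x0 where "x0 \<noteq> 0" "T x0 = l *\<^sub>C x0" using assms(2) unfolding Defs.eigenvalue_def by blast
  from deflation[OF assms(1,3) this] obtain g where
    "\<And>z. fredholm T z = (1 - l * z) * fredholm (\<lambda>y. T y - g y *\<^sub>C x0) z" by metis
  then show ?thesis using assms(3) by simp
qed

text \<open>Induction on a bound \<open>N\<close> for the order of the zero. Each deflation lowers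
  the order by one and takes one vector off a basis of the root space; once \<open>l\<close> is no
  eigenvalue, both counts are 0. The finite basis is constructed on the way.\<close>

lemma order_eq_multiplicity_aux:
  assumes "nuclear s (T :: 'a \<Rightarrow> 'a)" "l \<noteq> 0"
    and "\<not> (\<exists>h. h holomorphic_on UNIV \<and> (\<forall>z. fredholm T z = (1 - z / (1 / l)) ^ N * h z))"
  shows "\<exists>B. finite B \<and> complex_space.independent B \<and> complex_space.span B = root_space T l \<and>
    vanishes_to_order (fredholm T) (1 / l) (card B)"
  using assms(1,3)
proof (induction N arbitrary: T)
  case 0
  then show ?case using fredholm_holomorphic by auto
next
  case (Suc N)
  show ?case
  proof (cases "Defs.eigenvalue T l")
    case False
    have "fredholm T (1 / l) \<noteq> 0"
      using fredholm_zero_imp_eigenvalue[OF Suc.prems(1), of "1 / l"] False by auto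
    then have "vanishes_to_order (fredholm T) (1 / l) 0"
      unfolding vanishes_to_order_def using fredholm_holomorphic[OF Suc.prems(1)] by auto
    moreover have "root_space T l = {0}"
      by (rule root_space_not_eigenvalue[OF nuclear_bounded_clinear[OF Suc.prems(1)] False])
    ultimately show ?thesis
      by (intro exI[of _ "{}"]) (simp add: complex_space.independent_empty)
  next
    case True
    then obtain x0 where x0: "x0 \<noteq> 0" "T x0 = l *\<^sub>C x0" unfolding Defs.eigenvalue_def by blast
    obtain g where g: "bounded_clinear g" "g x0 = l" and n': "nuclear s (\<lambda>y. T y - g y *\<^sub>C x0)"
      and D: "\<And>z. fredholm T z = (1 - l * z) * fredholm (\<lambda>y. T y - g y *\<^sub>C x0) z"
      using deflation[OF Suc.prems(1) \<open>l \<noteq> 0\<close> x0] by blast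
    define T' where "T' = (\<lambda>y. T y - g y *\<^sub>C x0)"
    have fac: "1 - l * z = 1 - z / (1 / l)" for z by (simp add: mult.commute)
    have "\<not> (\<exists>h. h holomorphic_on UNIV \<and> (\<forall>z. fredholm T' z = (1 - z / (1 / l)) ^ N * h z))"
    proof
      assume "\<exists>h. h holomorphic_on UNIV \<and> (\<forall>z. fredholm T' z = (1 - z / (1 / l)) ^ N * h z)"
      then obtain h where h: "h holomorphic_on UNIV" "\<And>z. fredholm T' z = (1 - z / (1 / l)) ^ N * h z" by blast
      have "fredholm T z = (1 - z / (1 / l)) ^ Suc N * h z" for z
        unfolding D fac T'_def[symmetric] h(2) by simp
      then show False using Suc.prems(2) h(1) by blast
    qed
    from Suc.IH[OF n'[folded T'_def] this]
    obtain B where B: "finite B" "complex_space.independent B" "complex_space.span B = root_space T' l"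
      and ord: "vanishes_to_order (fredholm T') (1 / l) (card B)" by blast
    have new: "x0 \<notin> complex_space.span B" "complex_space.span (insert x0 B) = root_space T l"
      using root_space_deflation[OF nuclear_bounded_clinear[OF Suc.prems(1)] g(1) x0 g(2) \<open>l \<noteq> 0\<close> B(2)]
        B(3) by (simp_all add: T'_def)
    have "x0 \<notin> B" using new(1) complex_space.span_base by blast
    then have card: "card (insert x0 B) = Suc (card B)" using B(1) by simp
    obtain h where h: "h holomorphic_on UNIV" "h (1 / l) \<noteq> 0"
      "\<And>z. fredholm T' z = (1 - z / (1 / l)) ^ card B * h z"
      using ord unfolding vanishes_to_order_def by blast
    have "fredholm T z = (1 - z / (1 / l)) ^ Suc (card B) * h z" for z
      unfolding D fac T'_def[symmetric] h(3) by simp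
    then have "vanishes_to_order (fredholm T) (1 / l) (card (insert x0 B))"
      unfolding vanishes_to_order_def card using h by blast
    moreover have "complex_space.independent (insert x0 B)"
      by (rule complex_space.independent_insertI[OF new(1) B(2)])
    ultimately show ?thesis using B(1) new(2) by blast
  qed
qed

lemma fredholm_vanishes_to_multiplicity:
  assumes "nuclear s (T :: 'a \<Rightarrow> 'a)" "l \<noteq> 0"
  shows "vanishes_to_order (fredholm T) (1 / l) (algebraic_multiplicity T l)"
proof -
  have "fredholm T 0 \<noteq> 0" "1 / l \<noteq> 0" using assms(2) by (simp_all add: fredholm_0)
  then obtain N where "\<not> (\<exists>h. h holomorphic_on UNIV \<and> (\<forall>z. fredholm T z = (1 - z / (1 / l)) ^ N * h z))"
    using zero_order_bounded[OF fredholm_holomorphic[OF assms(1)]] by blast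
  from order_eq_multiplicity_aux[OF assms this] show ?thesis
    using algebraic_multiplicity_eqI by metis
qed

lemma eigenvalue_iff_multiplicity_pos:
  assumes "nuclear s (T :: 'a \<Rightarrow> 'a)" "l \<noteq> 0"
  shows "Defs.eigenvalue T l \<longleftrightarrow> algebraic_multiplicity T l > 0"
proof -
  have "fredholm T (1 / l) = 0 \<longleftrightarrow> algebraic_multiplicity T l > 0"
    using fredholm_vanishes_to_multiplicity[OF assms] assms(2) unfolding vanishes_to_order_def by auto
  moreover have "fredholm T (1 / l) = 0 \<longleftrightarrow> Defs.eigenvalue T l"
    using eigenvalue_imp_fredholm_zero[OF assms(1) _ assms(2)]
      fredholm_zero_imp_eigenvalue[OF assms(1), of "1 / l"] by auto
  ultimately show ?thesis by simp
qed

text \<open>Multiplicity 0 encodes not being an eigenvalue, so symmetry becomes one equation for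
  every nonzero number.\<close>

lemma central_symmetric_iff_multiplicity:
  assumes "nuclear s (T :: 'a \<Rightarrow> 'a)"
  shows "central_symmetric_spectrum T \<longleftrightarrow>
    (\<forall>l. l \<noteq> 0 \<longrightarrow> algebraic_multiplicity T (- l) = algebraic_multiplicity T l)"
proof
  assume c: "central_symmetric_spectrum T"
  show "\<forall>l. l \<noteq> 0 \<longrightarrow> algebraic_multiplicity T (- l) = algebraic_multiplicity T l"
  proof (intro allI impI)
    fix l :: complex assume l: "l \<noteq> 0"
    show "algebraic_multiplicity T (- l) = algebraic_multiplicity T l"
    proof (cases "Defs.eigenvalue T l")
      case True
      then show ?thesis using c l unfolding central_symmetric_spectrum_def by blast
    next
      case False
      have "\<not> Defs.eigenvalue T (- l)"
        using c l False unfolding central_symmetric_spectrum_def by (metis minus_minus neg_equal_0_iff_equal)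
      then show ?thesis
        using False eigenvalue_iff_multiplicity_pos[OF assms l] eigenvalue_iff_multiplicity_pos[OF assms, of "- l"] l by simp
    qed
  qed
next
  assume m: "\<forall>l. l \<noteq> 0 \<longrightarrow> algebraic_multiplicity T (- l) = algebraic_multiplicity T l"
  show "central_symmetric_spectrum T"
    unfolding central_symmetric_spectrum_def
  proof (intro allI impI)
    fix l assume "l \<noteq> 0 \<and> Defs.eigenvalue T l"
    then show "Defs.eigenvalue T (- l) \<and> algebraic_multiplicity T (- l) = algebraic_multiplicity T l"
      using m eigenvalue_iff_multiplicity_pos[OF assms, of l] eigenvalue_iff_multiplicity_pos[OF assms, of "- l"] by simp
  qed
qed

lemma vanishes_to_order_reflect:
  assumes "vanishes_to_order f a m"
  shows "vanishes_to_order (\<lambda>z. f (- z)) (- a) m"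
proof -
  obtain h where h: "h holomorphic_on UNIV" "h a \<noteq> 0" "\<And>z. f z = (1 - z / a) ^ m * h z"
    using assms unfolding vanishes_to_order_def by blast
  have "(h \<circ> uminus) holomorphic_on UNIV"
    by (rule holomorphic_on_compose_gen[OF _ h(1)]) (auto intro: holomorphic_intros)
  then show ?thesis unfolding vanishes_to_order_def
    by (intro exI[of _ "h \<circ> uminus"]) (use h in \<open>auto simp: o_def\<close>)
qed

text \<open>The zero at 1 / l carries the multiplicity of \<open>l\<close>, so reflecting the
  eigenvalues reflects the zeros. Symmetric zeros alone would leave a zero-free factor undetermined;
  the growth bound rules it out.\<close>

lemma central_symmetric_iff_even:
  assumes "nuclear s (T :: 'a \<Rightarrow> 'a)"
  shows "central_symmetric_spectrum T \<longleftrightarrow> (\<forall>z. fredholm T (- z) = fredholm T z)"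
proof
  assume even: "\<forall>z. fredholm T (- z) = fredholm T z"
  show "central_symmetric_spectrum T"
    unfolding central_symmetric_iff_multiplicity[OF assms]
  proof (intro allI impI)
    fix l :: complex assume l: "l \<noteq> 0"
    have "vanishes_to_order (fredholm T) (1 / - l) (algebraic_multiplicity T l)"
      using vanishes_to_order_reflect[OF fredholm_vanishes_to_multiplicity[OF assms l]] even by simp
    moreover have "vanishes_to_order (fredholm T) (1 / - l) (algebraic_multiplicity T (- l))"
      using fredholm_vanishes_to_multiplicity[OF assms, of "- l"] l by simp
    ultimately show "algebraic_multiplicity T (- l) = algebraic_multiplicity T l"
      using vanishes_to_order_unique[of "fredholm T" "1 / - l"] l by simp
  qed
next
  assume "central_symmetric_spectrum T"
  then have m: "algebraic_multiplicity T (- l) = algebraic_multiplicity T l" if "l \<noteq> 0" for l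
    using that central_symmetric_iff_multiplicity[OF assms] by blast
  have hol: "(\<lambda>z. fredholm T (- z)) holomorphic_on UNIV"
    using holomorphic_on_compose_gen[OF _ fredholm_holomorphic[OF assms], of uminus UNIV]
    by (simp add: o_def holomorphic_on_minus)
  have growth: "\<exists>C>0. \<forall>z. cmod (fredholm T z) \<le> C * exp (\<epsilon> * cmod z)" if "\<epsilon> > 0" for \<epsilon>
    unfolding fredholm_def by (rule minimal_type_bound[OF nuclear_minimal_type[OF assms] that])
  have growth': "\<exists>C>0. \<forall>z. cmod (fredholm T (- z)) \<le> C * exp (\<epsilon> * cmod z)" if "\<epsilon> > 0" for \<epsilon>
    using growth[OF that] by (metis norm_minus_cancel)
  have ord: "vanishes_to_order (\<lambda>z. fredholm T (- z)) a k \<longleftrightarrow> vanishes_to_order (fredholm T) a k"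
    if a: "a \<noteq> 0" for a k
  proof -
    have 1: "vanishes_to_order (fredholm T) a (algebraic_multiplicity T (1 / a))"
      using fredholm_vanishes_to_multiplicity[OF assms, of "1 / a"] a by simp
    have "vanishes_to_order (fredholm T) (- a) (algebraic_multiplicity T (- (1 / a)))"
      using fredholm_vanishes_to_multiplicity[OF assms, of "- (1 / a)"] a by simp
    then have "vanishes_to_order (fredholm T) (- a) (algebraic_multiplicity T (1 / a))"
      using m[of "1 / a"] a by simp
    from vanishes_to_order_reflect[OF this]
    have 2: "vanishes_to_order (\<lambda>z. fredholm T (- z)) a (algebraic_multiplicity T (1 / a))" by simp
    show ?thesis
    proof
      assume "vanishes_to_order (\<lambda>z. fredholm T (- z)) a k"
      from vanishes_to_order_unique[OF 2 this a] 1 show "vanishes_to_order (fredholm T) a k" by simp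
    next
      assume "vanishes_to_order (fredholm T) a k"
      from vanishes_to_order_unique[OF 1 this a] 2 show "vanishes_to_order (\<lambda>z. fredholm T (- z)) a k" by simp
    qed
  qed
  show "\<forall>z. fredholm T (- z) = fredholm T z"
  proof
    fix z
    show "fredholm T (- z) = fredholm T z"
      by (rule entire_minimal_type_determined_by_zeros[where f = "\<lambda>z. fredholm T (- z)" and g = "fredholm T",
          OF hol _ growth' fredholm_holomorphic[OF assms] fredholm_0 growth ord])
        (simp_all add: fredholm_0)
  qed
qed

theorem central_symmetric_iff_odd_traces:
  assumes "nuclear s (T :: 'a \<Rightarrow> 'a)"
  shows "central_symmetric_spectrum T \<longleftrightarrow> (\<forall>n\<ge>1. nuclear_trace s (T ^^ (2 * n - 1)) = 0)"
proof -
  have "central_symmetric_spectrum T \<longleftrightarrow> (\<forall>n. odd n \<longrightarrow> fredholm_coeff (power_trace T) n = 0)"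
    unfolding central_symmetric_iff_even[OF assms] fredholm_def
    by (rule minimal_type_even_iff[OF nuclear_minimal_type[OF assms]])
  also have "\<dots> \<longleftrightarrow> (\<forall>k. even k \<longrightarrow> power_trace T k = 0)"
    by (rule fredholm_coeff_odd_eq_0_iff)
  also have "\<dots> \<longleftrightarrow> (\<forall>n\<ge>1. nuclear_trace s (T ^^ (2 * n - 1)) = 0)"
  proof (intro iffI allI impI)
    fix n :: nat assume a: "\<forall>k. even k \<longrightarrow> power_trace T k = 0" and n: "n \<ge> 1"
    have "2 * n - 1 = Suc (2 * (n - 1))" using n by simp
    moreover have "power_trace T (2 * (n - 1)) = 0" using a by simp
    ultimately show "nuclear_trace s (T ^^ (2 * n - 1)) = 0" by (simp only: power_trace_def)
  next
    fix k :: nat assume a: "\<forall>n\<ge>1. nuclear_trace s (T ^^ (2 * n - 1)) = 0" and k: "even k"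
    obtain j where j: "k = 2 * j" using k by (elim evenE)
    have "Suc k = 2 * Suc j - 1" using j by simp
    moreover have "nuclear_trace s (T ^^ (2 * Suc j - 1)) = 0" using a by (metis le_add1 plus_1_eq_Suc)
    ultimately show "power_trace T k = 0" by (simp only: power_trace_def)
  qed
  finally show ?thesis .
qed

end

section \<open>The determinant bound on subquotients of Lp spaces\<close>

text \<open>Jensen's inequality for the indices with \<open>u i > 0\<close>; the others add nothing
  to either side, and passing from \<open>J\<close> back to \<open>I\<close> enlarges the
  constant.\<close>

lemma power_mean:
  fixes u :: "'a \<Rightarrow> real"
  assumes "finite I" "\<And>i. i \<in> I \<Longrightarrow> u i \<ge> 0" "p \<ge> 1"
  shows "(\<Sum>i\<in>I. u i) powr p \<le> real (card I) powr (p - 1) * (\<Sum>i\<in>I. u i powr p)"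
proof -
  define J where "J = {i\<in>I. u i > 0}"
  have J: "finite J" "J \<subseteq> I" using assms(1) by (auto simp: J_def)
  have z: "u i = 0" if "i \<in> I - J" for i using that assms(2)[of i] by (auto simp: J_def)
  have uJ: "(\<Sum>i\<in>I. u i) = (\<Sum>i\<in>J. u i)" "(\<Sum>i\<in>I. u i powr p) = (\<Sum>i\<in>J. u i powr p)"
    using assms(1) J z by (auto intro!: sum.mono_neutral_right)
  show ?thesis
  proof (cases "J = {}")
    case True
    then show ?thesis unfolding uJ by simp
  next
    case False
    define n where "n = real (card J)"
    have n: "n > 0" using False J by (simp add: n_def card_gt_0_iff)
    have "(\<Sum>i\<in>J. (1 / n) *\<^sub>R u i) powr p \<le> (\<Sum>i\<in>J. (1 / n) * u i powr p)"
      by (rule convex_on_sum[OF J(1) False powr_convex[OF assms(3)]]) (use n in \<open>auto simp: J_def n_def\<close>)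
    also have "(\<Sum>i\<in>J. (1 / n) *\<^sub>R u i) = (\<Sum>i\<in>J. u i) / n" by (simp add: sum_divide_distrib)
    also have "(\<Sum>i\<in>J. (1 / n) * u i powr p) = (\<Sum>i\<in>J. u i powr p) / n" by (simp add: sum_divide_distrib)
    finally have "(\<Sum>i\<in>J. u i) powr p / n powr p \<le> (\<Sum>i\<in>J. u i powr p) / n"
      using n by (simp add: powr_divide J_def sum_nonneg)
    then have "(\<Sum>i\<in>J. u i) powr p \<le> n powr (p - 1) * (\<Sum>i\<in>J. u i powr p)"
      using n by (simp add: powr_diff field_simps)
    also have "\<dots> \<le> real (card I) powr (p - 1) * (\<Sum>i\<in>J. u i powr p)"
      using n J assms card_mono[OF assms(1) J(2)]
      by (intro mult_right_mono powr_mono2 sum_nonneg) (auto simp: n_def)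
    finally show ?thesis unfolding uJ .
  qed
qed

text \<open>Testing the isometry with the conjugate of row \<open>i\<close> gives S^2 \<le> S for
  its squared length S.\<close>

lemma isometric_row_norm:
  fixes q :: "nat \<Rightarrow> nat \<Rightarrow> complex"
  assumes "\<And>f. (\<Sum>k<n. cmod (\<Sum>j<n. q k j * f j) ^ 2) = (\<Sum>j<n. cmod (f j) ^ 2)" "i < n"
  shows "(\<Sum>j<n. cmod (q i j) ^ 2) \<le> 1"
proof -
  define S where "S = (\<Sum>j<n. cmod (q i j) ^ 2)"
  have "(\<Sum>j<n. q i j * cnj (q i j)) = complex_of_real S"
    unfolding S_def of_real_sum complex_norm_square ..
  then have "S ^ 2 = cmod (\<Sum>j<n. q i j * cnj (q i j)) ^ 2" by simp
  also have "\<dots> \<le> (\<Sum>k<n. cmod (\<Sum>j<n. q k j * cnj (q i j)) ^ 2)"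
    by (rule member_le_sum[of i]) (use assms(2) in auto)
  also have "\<dots> = (\<Sum>j<n. cmod (cnj (q i j)) ^ 2)" by (rule assms(1))
  also have "\<dots> = S" by (simp add: S_def)
  finally have "S * S \<le> S" by (simp add: power2_eq_square)
  have "S \<le> 1"
  proof (rule ccontr)
    assume "\<not> S \<le> 1"
    then have "1 * S < S * S" by (intro mult_strict_right_mono) auto
    then show False using \<open>S * S \<le> S\<close> by simp
  qed
  then show ?thesis by (simp add: S_def)
qed

lemma det_scale_rows_columns:
  fixes A :: "nat \<Rightarrow> nat \<Rightarrow> complex"
  shows "det (mat n n (\<lambda>(i,j). a i * b j * A i j)) = (\<Prod>i<n. a i * b i) * det (mat n n (\<lambda>(i,j). A i j))"
proof -
  have expand: "det (mat n n (\<lambda>(i,j). C i j)) = (\<Sum>p | p permutes {0..<n}. of_int (sign p) * (\<Prod>i = 0..<n. C i (p i)))"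
    for C :: "nat \<Rightarrow> nat \<Rightarrow> complex"
    by (subst det_def'[of _ n]) (auto intro!: sum.cong prod.cong simp: permutes_atLeastLessThan_less)
  have "(\<Prod>i = 0..<n. a i * b (p i) * A i (p i)) = (\<Prod>i<n. a i * b i) * (\<Prod>i = 0..<n. A i (p i))"
    if "p permutes {0..<n}" for p
    using prod.permute[OF that, of b] by (simp add: prod.distrib atLeast0LessThan o_def)
  then show ?thesis
    unfolding expand sum_distrib_left by (intro sum.cong refl) (simp add: mult.left_commute)
qed

text \<open>Homogeneity reduces the determinant bound to unit balls, where
  \<open>norm_det_le_power\<close> asks only for the sum of the rotated diagonal entries.\<close>

lemma determinant_boundI:
  fixes ty :: "'a::complex_banach itself"
  assumes "K > 0" "\<alpha> \<ge> 0"
    and bd: "\<And>n \<phi> y q. n > 0 \<Longrightarrow> (\<And>i. bounded_clinear (\<phi> i)) \<Longrightarrow> (\<And>i v. cmod (\<phi> i v) \<le> norm v) \<Longrightarrow>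
      (\<And>j. norm (y j) \<le> 1) \<Longrightarrow>
      (\<And>f. (\<Sum>k<n. cmod (\<Sum>j<n. q k j * f j) ^ 2) = (\<Sum>j<n. cmod (f j) ^ 2)) \<Longrightarrow>
      (\<Sum>i<n. cmod (\<Sum>j<n. \<phi> i (y j :: 'a) * q i j)) \<le> real n * (K * real n powr \<alpha>)"
  shows "determinant_bound ty \<alpha>"
  unfolding determinant_bound_def
proof (intro exI[of _ K] conjI allI impI)
  show "K > 0" by fact
  fix n and \<phi> :: "nat \<Rightarrow> 'a \<Rightarrow> complex" and y :: "nat \<Rightarrow> 'a"
  assume \<phi>: "\<forall>i. bounded_clinear (\<phi> i)"
  \<comment> \<open>Division by zero yields zero, so a vanishing functional or vector is normalised
    to zero and the factorisation \<open>split\<close> holds in that case too.\<close>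
  define \<psi> v where "\<psi> = (\<lambda>i u. complex_of_real (1 / onorm (\<phi> i)) * \<phi> i u)"
    and "v = (\<lambda>j. complex_of_real (1 / norm (y j)) *\<^sub>C y j)"
  have on: "onorm (\<phi> i) \<ge> 0" for i
    using onorm_pos_le \<phi> bounded_clinear_imp_bounded_linear by blast
  have \<psi>: "bounded_clinear (\<psi> i)" for i unfolding \<psi>_def by (rule bounded_clinear_cmult) (use \<phi> in blast)
  have \<psi>1: "cmod (\<psi> i u) \<le> norm u" for i u
    using bounded_clinear_norm_le[OF \<phi>[rule_format], of i u] on[of i]
    by (cases "onorm (\<phi> i) = 0") (auto simp: \<psi>_def norm_mult norm_divide field_simps)
  have v1: "norm (v j) \<le> 1" for j by (simp add: v_def norm_scaleC norm_divide)
  have split: "\<phi> i (y j) = complex_of_real (onorm (\<phi> i)) * complex_of_real (norm (y j)) * \<psi> i (v j)" for i j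
  proof (cases "onorm (\<phi> i) = 0 \<or> y j = 0")
    case True
    then show ?thesis
      using bounded_clinear_norm_le[OF \<phi>[rule_format], of i "y j"] bounded_clinear_simps(3)[OF \<phi>[rule_format], of i] by auto
  next
    case False
    then show ?thesis by (simp add: \<psi>_def v_def bounded_clinear_scale_complex[OF \<phi>[rule_format]])
  qed
  have "det (mat n n (\<lambda>(i,j). \<phi> i (y j))) = (\<Prod>i<n. complex_of_real (onorm (\<phi> i)) * complex_of_real (norm (y i)))
      * det (mat n n (\<lambda>(i,j). \<psi> i (v j)))"
    unfolding split by (rule det_scale_rows_columns)
  then have "cmod (det (mat n n (\<lambda>(i,j). \<phi> i (y j)))) =
      (\<Prod>i<n. onorm (\<phi> i) * norm (y i)) * cmod (det (mat n n (\<lambda>(i,j). \<psi> i (v j))))"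
    using on by (simp add: norm_mult prod_norm[symmetric])
  also have "\<dots> \<le> (\<Prod>i<n. onorm (\<phi> i) * norm (y i)) * (K * real n powr \<alpha>) ^ n"
  proof (rule mult_left_mono)
    show "cmod (det (mat n n (\<lambda>(i,j). \<psi> i (v j)))) \<le> (K * real n powr \<alpha>) ^ n"
    proof (cases "n = 0")
      case False
      then show ?thesis by (intro norm_det_le_power bd \<psi> \<psi>1 v1) auto
    qed simp
    show "0 \<le> (\<Prod>i<n. onorm (\<phi> i) * norm (y i))" by (rule prod_nonneg) (simp add: on)
  qed
  finally show "cmod (det (mat n n (\<lambda>(i,j). \<phi> i (y j)))) \<le> (K * real n powr \<alpha>) ^ n * (\<Prod>i<n. onorm (\<phi> i) * norm (y i))"
    by (simp add: mult.commute)
qed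

text \<open>Hadamard's inequality for entries in the unit disc, here from Cauchy-Schwarz and the row
  lengths. It is the endpoint p = \<infinity>.\<close>

lemma determinant_bound_half: "determinant_bound (ty :: 'a::complex_banach itself) (1 / 2)"
proof (rule determinant_boundI[of 1])
  fix n and \<phi> :: "nat \<Rightarrow> 'a \<Rightarrow> complex" and y :: "nat \<Rightarrow> 'a" and q :: "nat \<Rightarrow> nat \<Rightarrow> complex"
  assume \<phi>: "\<And>i v. cmod (\<phi> i v) \<le> norm v" and y: "\<And>j. norm (y j) \<le> 1"
    and q: "\<And>f. (\<Sum>k<n. cmod (\<Sum>j<n. q k j * f j) ^ 2) = (\<Sum>j<n. cmod (f j) ^ 2)"
  have "cmod (\<Sum>j<n. \<phi> i (y j) * q i j) \<le> sqrt n" if "i < n" for i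
  proof -
    have "cmod (\<Sum>j<n. \<phi> i (y j) * q i j) \<le> (\<Sum>j<n. cmod (q i j))"
    proof (rule sum_norm_le)
      fix j
      have "cmod (\<phi> i (y j)) \<le> 1" using \<phi>[of i "y j"] y[of j] by linarith
      then show "cmod (\<phi> i (y j) * q i j) \<le> cmod (q i j)"
        by (simp add: norm_mult mult_left_le_one_le)
    qed
    also have "\<dots> \<le> sqrt n"
    proof (rule real_le_rsqrt)
      have "(\<Sum>j<n. cmod (q i j)) ^ 2 \<le> (\<Sum>j<n. cmod (q i j) ^ 2) * real n"
        using sum_squared_le_sum_of_squares[of "\<lambda>j. cmod (q i j)" "{..<n}"] by simp
      also have "\<dots> \<le> 1 * real n" by (intro mult_right_mono isometric_row_norm[OF q that]) auto
      finally show "(\<Sum>j<n. cmod (q i j)) ^ 2 \<le> real n" by simp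
    qed
    finally show ?thesis .
  qed
  then have "(\<Sum>i<n. cmod (\<Sum>j<n. \<phi> i (y j) * q i j)) \<le> (\<Sum>i<n. sqrt n)" by (intro sum_mono) auto
  then show "(\<Sum>i<n. cmod (\<Sum>j<n. \<phi> i (y j) * q i j)) \<le> real n * (1 * real n powr (1 / 2))"
    by (simp add: powr_half_sqrt)
qed auto

text \<open>\<open>Y\<close> is, up to norm increase by arbitrarily small amounts, a quotient of a subset of \<open>X\<close>:
  \<open>R y x\<close> says that \<open>x\<close> represents \<open>y\<close>.\<close>

definition covers :: "'v cspace \<Rightarrow> 'w cspace \<Rightarrow> ('v \<Rightarrow> 'w \<Rightarrow> bool) \<Rightarrow> bool"
  where "covers Y X R \<longleftrightarrow>
    (\<forall>y x. R y x \<longrightarrow> norm_of Y y \<le> norm_of X x) \<and>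
    (\<forall>y x y' x'. R y x \<longrightarrow> R y' x' \<longrightarrow> R (plus_of Y y y') (plus_of X x x')) \<and>
    (\<forall>c y x. R y x \<longrightarrow> R (scale_of Y c y) (scale_of X c x)) \<and>
    (\<forall>y\<in>points Y. \<forall>e>0. \<exists>x\<in>points X. R y x \<and> norm_of X x < norm_of Y y + e)"

lemma covers_trans:
  assumes R: "covers Z Y R" and S: "covers Y X S"
  shows "covers Z X (R OO S)"
  unfolding covers_def
proof (intro conjI allI ballI impI)
  show "norm_of Z z \<le> norm_of X x" if "(R OO S) z x" for z x
  proof -
    obtain y where y: "R z y" "S y x" using \<open>(R OO S) z x\<close> by blast
    have "norm_of Z z \<le> norm_of Y y" using R y(1) unfolding covers_def by blast
    also have "\<dots> \<le> norm_of X x" using S y(2) unfolding covers_def by blast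
    finally show ?thesis .
  qed
  show "(R OO S) (plus_of Z z z') (plus_of X x x')" if "(R OO S) z x" "(R OO S) z' x'" for z x z' x'
  proof -
    obtain y y' where y: "R z y" "S y x" "R z' y'" "S y' x'"
      using \<open>(R OO S) z x\<close> \<open>(R OO S) z' x'\<close> by blast
    have "R (plus_of Z z z') (plus_of Y y y')" using R y(1,3) unfolding covers_def by blast
    moreover have "S (plus_of Y y y') (plus_of X x x')" using S y(2,4) unfolding covers_def by blast
    ultimately show ?thesis by blast
  qed
  show "(R OO S) (scale_of Z c z) (scale_of X c x)" if "(R OO S) z x" for c z x
  proof -
    obtain y where y: "R z y" "S y x" using \<open>(R OO S) z x\<close> by blast
    have "R (scale_of Z c z) (scale_of Y c y)" using R y(1) unfolding covers_def by blast
    moreover have "S (scale_of Y c y) (scale_of X c x)" using S y(2) unfolding covers_def by blast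
    ultimately show ?thesis by blast
  qed
  fix z and e :: real assume z: "z \<in> points Z" "e > 0"
  then have "\<exists>y\<in>points Y. R z y \<and> norm_of Y y < norm_of Z z + e / 2"
    using R half_gt_zero[OF z(2)] unfolding covers_def by blast
  then obtain y where y: "y \<in> points Y" "R z y" "norm_of Y y < norm_of Z z + e / 2" by blast
  then have "\<exists>x\<in>points X. S y x \<and> norm_of X x < norm_of Y y + e / 2"
    using S half_gt_zero[OF z(2)] unfolding covers_def by blast
  then obtain x where x: "x \<in> points X" "S y x" "norm_of X x < norm_of Y y + e / 2" by blast
  show "\<exists>x\<in>points X. (R OO S) z x \<and> norm_of X x < norm_of Z z + e"
    by (rule bexI[OF _ x(1)]) (use x y in auto)
qed

lemma covers_isometric:
  assumes "isometric Y Z" "points Y = UNIV"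
  shows "\<exists>R. covers Y Z R"
proof -
  obtain j where j: "bij_betw j (points Y) (points Z)"
    "\<And>x y. j (plus_of Y x y) = plus_of Z (j x) (j y)"
    "\<And>c x. j (scale_of Y c x) = scale_of Z c (j x)" "\<And>x. norm_of Z (j x) = norm_of Y x"
    using assms unfolding isometric_def by auto
  have "covers Y Z (\<lambda>y z. z = j y)"
    unfolding covers_def using j bij_betwE[OF j(1)] by auto
  then show ?thesis by blast
qed

lemma covers_subspace:
  assumes "closed_subspace X N"
  shows "covers (subspace_cspace X N) X (\<lambda>y x. x = y)"
  using assms unfolding covers_def closed_subspace_def subspace_cspace_def by auto

text \<open>The axioms on which quotients rely: nonnegativity bounds the infimum from below, and the
  neutral element puts each point into its own coset. A \<open>cspace\<close> has no field for zero,
  so \<open>z\<close> is a parameter, identified as the 0-multiple of every point.\<close>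

definition seminormed :: "'v cspace \<Rightarrow> 'v \<Rightarrow> bool"
  where "seminormed X z \<longleftrightarrow>
    (\<forall>x\<in>points X. \<forall>y\<in>points X. plus_of X x y \<in> points X) \<and>
    (\<forall>c. \<forall>x\<in>points X. scale_of X c x \<in> points X) \<and>
    (\<forall>x\<in>points X. 0 \<le> norm_of X x \<and> plus_of X x z = x \<and> scale_of X 0 x = z)"

lemma seminormed_subspace:
  assumes "seminormed X z" "closed_subspace X N"
  shows "seminormed (subspace_cspace X N) z"
  using assms unfolding seminormed_def closed_subspace_def subspace_cspace_def by auto

text \<open>Membership in a set of points replaces membership in a coset, so the relation respects
  the operations without a proof that sums of cosets are cosets. The quotient norm is an infimum,
  which is why representatives are only almost optimal.\<close>

lemma covers_quotient:
  assumes X: "seminormed X z" and N: "closed_subspace X N"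
  shows "covers (quotient_cspace X N) X (\<lambda>C x. x \<in> C \<and> C \<subseteq> points X)"
proof -
  have NX: "N \<subseteq> points X" using N by (simp add: closed_subspace_def)
  obtain n where n: "n \<in> N" using N by (auto simp: closed_subspace_def)
  have "scale_of X 0 n \<in> N" using N n by (simp add: closed_subspace_def)
  then have zN: "z \<in> N" using X n NX by (auto simp: seminormed_def)
  have self: "x \<in> coset_of X N x" if "x \<in> points X" for x
  proof -
    have "plus_of X x z = x" using X that by (simp add: seminormed_def)
    then show ?thesis using zN unfolding coset_of_def by (metis imageI)
  qed
  have sub: "coset_of X N x \<subseteq> points X" if "x \<in> points X" for x
    using X that NX unfolding coset_of_def seminormed_def by auto
  have bdd: "bdd_below (norm_of X ` C)" if "C \<subseteq> points X" for C
    by (rule bdd_belowI[of _ 0]) (use X that in \<open>auto simp: seminormed_def\<close>)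
  show ?thesis
    unfolding covers_def
  proof (intro conjI allI ballI impI)
    fix C x assume "x \<in> C \<and> C \<subseteq> points X"
    then show "norm_of (quotient_cspace X N) C \<le> norm_of X x"
      using bdd by (auto simp: quotient_cspace_def intro: cINF_lower)
  next
    fix C x D y assume Cx: "x \<in> C \<and> C \<subseteq> points X" and Dy: "y \<in> D \<and> D \<subseteq> points X"
    then show "plus_of X x y \<in> plus_of (quotient_cspace X N) C D"
      by (auto simp: quotient_cspace_def)
    show "plus_of (quotient_cspace X N) C D \<subseteq> points X"
      using Cx Dy X by (auto simp: quotient_cspace_def seminormed_def)
  next
    fix c C x assume Cx: "x \<in> C \<and> C \<subseteq> points X"
    then have "scale_of X c x \<in> points X" using X by (auto simp: seminormed_def)
    then show "scale_of X c x \<in> scale_of (quotient_cspace X N) c C"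
      using Cx self by (auto simp: quotient_cspace_def)
    have "coset_of X N (scale_of X c x) \<subseteq> points X" if "x \<in> C" for x
      by (rule sub) (use Cx X that in \<open>auto simp: seminormed_def\<close>)
    then show "scale_of (quotient_cspace X N) c C \<subseteq> points X"
      by (auto simp: quotient_cspace_def)
  next
    fix C and e :: real assume C: "C \<in> points (quotient_cspace X N)" and e: "e > 0"
    then obtain x0 where x0: "x0 \<in> points X" "C = coset_of X N x0" by (auto simp: quotient_cspace_def)
    have ne: "C \<noteq> {}" "C \<subseteq> points X" using self[OF x0(1)] sub[OF x0(1)] x0(2) by auto
    have "(INF x\<in>C. norm_of X x) < norm_of (quotient_cspace X N) C + e"
      using e by (simp add: quotient_cspace_def)
    then obtain x where "x \<in> C" "norm_of X x < norm_of (quotient_cspace X N) C + e"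
      using cINF_less_iff[OF ne(1) bdd[OF ne(2)]] by blast
    then show "\<exists>x\<in>points X. (x \<in> C \<and> C \<subseteq> points X) \<and> norm_of X x < norm_of (quotient_cspace X N) C + e"
      using ne by blast
  qed
qed

section \<open>Functions representing elements of subquotients of Lp spaces\<close>

definition Lp_pre :: "ennreal \<Rightarrow> 'm measure \<Rightarrow> ('m \<Rightarrow> complex) cspace"
  where "Lp_pre p M = \<lparr>points = Lp_functions p M, plus_of = (\<lambda>f g x. f x + g x),
     scale_of = (\<lambda>c f x. c * f x), norm_of = Lp_seminorm p M\<rparr>"

definition ae_class :: "'m measure \<Rightarrow> ('m \<Rightarrow> complex) \<Rightarrow> ('m \<Rightarrow> complex) set"
  where "ae_class M f = {h \<in> borel_measurable M. AE x in M. h x = f x}"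

context
  fixes p :: ennreal and r :: real and M :: "'m measure"
  assumes r: "p = ennreal r" "r \<ge> 2"
begin

lemma Lp_functions_iff: "f \<in> Lp_functions p M \<longleftrightarrow> f \<in> borel_measurable M \<and> integrable M (\<lambda>x. cmod (f x) powr r)"
  using r by (simp add: Lp_functions_def)

lemma Lp_seminorm_eq: "Lp_seminorm p M f = (\<integral>x. cmod (f x) powr r \<partial>M) powr (1 / r)"
  using r by (simp add: Lp_seminorm_def)

lemma Lp_functions_scale: "f \<in> Lp_functions p M \<Longrightarrow> (\<lambda>x. c * f x) \<in> Lp_functions p M"
  by (auto simp: Lp_functions_iff norm_mult powr_mult intro!: borel_measurable_times)

lemma Lp_functions_add:
  assumes "f \<in> Lp_functions p M" "g \<in> Lp_functions p M"
  shows "(\<lambda>x. f x + g x) \<in> Lp_functions p M"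
proof -
  have fg: "f \<in> borel_measurable M" "g \<in> borel_measurable M"
      "integrable M (\<lambda>x. cmod (f x) powr r)" "integrable M (\<lambda>x. cmod (g x) powr r)"
    using assms by (simp_all add: Lp_functions_iff)
  note [measurable] = fg(1,2)
  have "integrable M (\<lambda>x. cmod (f x + g x) powr r)"
  proof (rule Bochner_Integration.integrable_bound)
    show "integrable M (\<lambda>x. 2 powr (r - 1) * (cmod (f x) powr r + cmod (g x) powr r))"
      using fg by auto
    show "(\<lambda>x. cmod (f x + g x) powr r) \<in> borel_measurable M" by measurable
    have "cmod (f x + g x) powr r \<le> 2 powr (r - 1) * (cmod (f x) powr r + cmod (g x) powr r)" for x
    proof -
      have "cmod (f x + g x) powr r \<le> (cmod (f x) + cmod (g x)) powr r"
        using r by (intro powr_mono2 norm_triangle_ineq) auto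
      also have "\<dots> \<le> 2 powr (r - 1) * (cmod (f x) powr r + cmod (g x) powr r)"
        using power_mean[of "{..<2::nat}" "\<lambda>i. if i = 0 then cmod (f x) else cmod (g x)" r] r
        by (simp add: lessThan_Suc numeral_2_eq_2 add.commute)
      finally show ?thesis .
    qed
    then show "AE x in M. norm (cmod (f x + g x) powr r) \<le> norm (2 powr (r - 1) * (cmod (f x) powr r + cmod (g x) powr r))"
      by (intro AE_I2) simp
  qed
  then show ?thesis by (simp add: Lp_functions_iff)
qed

lemma Lp_functions_sum:
  assumes "\<And>j. j < n \<Longrightarrow> f j \<in> Lp_functions p M" "f' \<in> Lp_functions p M"
  shows "(\<lambda>x. \<Sum>j<n::nat. c j * f j x) \<in> Lp_functions p M"
  using assms(1)
proof (induction n)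
  case 0
  \<comment> \<open>The empty sum is the zero function, obtained as 0 times the given member
    \<open>f'\<close>.\<close>
  then show ?case using Lp_functions_scale[OF assms(2), of 0] by simp
next
  case (Suc n)
  then show ?case using Lp_functions_add[OF _ Lp_functions_scale[of "f n" "c n"]] by simp
qed

lemma Lp_seminorm_cong_AE:
  assumes "AE x in M. f x = g x" "f \<in> borel_measurable M" "g \<in> borel_measurable M"
  shows "Lp_seminorm p M f = Lp_seminorm p M g" "f \<in> Lp_functions p M \<longleftrightarrow> g \<in> Lp_functions p M"
proof -
  have ae: "AE x in M. cmod (f x) powr r = cmod (g x) powr r" using assms(1) by eventually_elim simp
  note [measurable] = assms(2,3)
  show "Lp_seminorm p M f = Lp_seminorm p M g"
    unfolding Lp_seminorm_eq by (subst integral_cong_AE[OF _ _ ae]) auto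
  show "f \<in> Lp_functions p M \<longleftrightarrow> g \<in> Lp_functions p M"
    using integrable_cong_AE[OF _ _ ae] assms(2,3) by (simp add: Lp_functions_iff)
qed

lemma Lp_coset_eq:
  assumes "f \<in> Lp_functions p M"
  shows "coset_of (Lp_pre p M) {f \<in> borel_measurable M. AE x in M. f x = 0} f = ae_class M f"
proof (intro equalityI subsetI)
  have f: "f \<in> borel_measurable M" using assms by (simp add: Lp_functions_iff)
  fix h
  {
    assume "h \<in> coset_of (Lp_pre p M) {f \<in> borel_measurable M. AE x in M. f x = 0} f"
    then obtain k where k: "k \<in> borel_measurable M" "AE x in M. k x = 0" "h = (\<lambda>x. f x + k x)"
      by (auto simp: coset_of_def Lp_pre_def)
    then show "h \<in> ae_class M f" using f by (auto simp: ae_class_def)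
  next
    assume "h \<in> ae_class M f"
    then have h: "h \<in> borel_measurable M" "AE x in M. h x = f x" by (auto simp: ae_class_def)
    have "h = plus_of (Lp_pre p M) f (\<lambda>x. h x - f x)" by (simp add: Lp_pre_def)
    moreover have "(\<lambda>x. h x - f x) \<in> {f \<in> borel_measurable M. AE x in M. f x = 0}"
      using h f by auto
    ultimately show "h \<in> coset_of (Lp_pre p M) {f \<in> borel_measurable M. AE x in M. f x = 0} f"
      unfolding coset_of_def by blast
  }
qed

lemma Lp_eq_quotient: "Lp p M = quotient_cspace (Lp_pre p M) {f \<in> borel_measurable M. AE x in M. f x = 0}"
  by (simp add: Lp_def Lp_pre_def)

lemma Lp_points: "points (Lp p M) = ae_class M ` Lp_functions p M"
  unfolding Lp_eq_quotient quotient_cspace_def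
  using Lp_coset_eq by (simp add: Lp_pre_def)

lemma ae_class_self: "f \<in> Lp_functions p M \<Longrightarrow> f \<in> ae_class M f"
  by (simp add: ae_class_def Lp_functions_iff)

lemma ae_class_subset: "f \<in> Lp_functions p M \<Longrightarrow> h \<in> ae_class M f \<Longrightarrow>
    h \<in> Lp_functions p M \<and> Lp_seminorm p M h = Lp_seminorm p M f"
  using Lp_seminorm_cong_AE[of h f] by (auto simp: ae_class_def Lp_functions_iff)

lemma Lp_plus:
  assumes f: "f \<in> Lp_functions p M" and g: "g \<in> Lp_functions p M"
  shows "plus_of (Lp p M) (ae_class M f) (ae_class M g) = ae_class M (\<lambda>x. f x + g x)"
proof -
  have m: "f \<in> borel_measurable M" "g \<in> borel_measurable M" using assms by (simp_all add: Lp_functions_iff)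
  have "{(\<lambda>x. h x + k x) |h k. h \<in> ae_class M f \<and> k \<in> ae_class M g} = ae_class M (\<lambda>x. f x + g x)"
  proof (intro equalityI subsetI)
    fix u assume "u \<in> {(\<lambda>x. h x + k x) |h k. h \<in> ae_class M f \<and> k \<in> ae_class M g}"
    then obtain h k where u: "u = (\<lambda>x. h x + k x)" and hk: "h \<in> ae_class M f" "k \<in> ae_class M g" by blast
    have "AE x in M. h x + k x = f x + g x"
      using hk unfolding ae_class_def by (auto elim: eventually_elim2)
    then show "u \<in> ae_class M (\<lambda>x. f x + g x)" using hk by (auto simp: ae_class_def u)
  next
    fix u assume u: "u \<in> ae_class M (\<lambda>x. f x + g x)"
    have "(\<lambda>x. u x - g x) \<in> ae_class M f"
      using u m unfolding ae_class_def by (auto elim: eventually_mono)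
    moreover have "u = (\<lambda>x. (u x - g x) + g x)" by simp
    ultimately show "u \<in> {(\<lambda>x. h x + k x) |h k. h \<in> ae_class M f \<and> k \<in> ae_class M g}"
      using ae_class_self[OF g] unfolding mem_Collect_eq
      by (intro exI[of _ "\<lambda>x. u x - g x"] exI[of _ g] conjI)
  qed
  then show ?thesis by (simp add: Lp_def quotient_cspace_def)
qed

lemma Lp_scale:
  assumes f: "f \<in> Lp_functions p M"
  shows "scale_of (Lp p M) c (ae_class M f) = ae_class M (\<lambda>x. c * f x)"
proof -
  have "scale_of (Lp p M) c (ae_class M f) = (\<Union>h\<in>ae_class M f. ae_class M (\<lambda>x. c * h x))"
    unfolding Lp_eq_quotient quotient_cspace_def
    using Lp_coset_eq[OF Lp_functions_scale] ae_class_subset[OF f] by (simp add: Lp_pre_def)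
  also have "\<dots> = (\<Union>h\<in>ae_class M f. ae_class M (\<lambda>x. c * f x))"
  proof (rule SUP_cong[OF refl])
    fix h assume "h \<in> ae_class M f"
    then have ae: "AE x in M. c * h x = c * f x" by (auto simp: ae_class_def)
    show "ae_class M (\<lambda>x. c * h x) = ae_class M (\<lambda>x. c * f x)"
      unfolding ae_class_def using ae by (auto elim: eventually_elim2)
  qed
  also have "\<dots> = ae_class M (\<lambda>x. c * f x)" using ae_class_self[OF f] by auto
  finally show ?thesis .
qed

lemma Lp_norm: "f \<in> Lp_functions p M \<Longrightarrow> norm_of (Lp p M) (ae_class M f) = Lp_seminorm p M f"
proof -
  assume f: "f \<in> Lp_functions p M"
  have "(INF h\<in>ae_class M f. Lp_seminorm p M h) = (INF h\<in>ae_class M f. Lp_seminorm p M f)"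
    using ae_class_subset[OF f] by (intro INF_cong refl) auto
  also have "\<dots> = Lp_seminorm p M f" using ae_class_self[OF f] by (intro cINF_const) auto
  finally show ?thesis by (simp add: Lp_def quotient_cspace_def)
qed

lemma covers_Lp: "covers (Lp p M) (Lp_pre p M) (\<lambda>C f. f \<in> Lp_functions p M \<and> C = ae_class M f)"
  unfolding covers_def
  using Lp_functions_add Lp_functions_scale
  by (auto simp: Lp_plus Lp_scale Lp_norm Lp_points) (auto simp: Lp_pre_def Lp_norm)

lemma seminormed_Lp: "seminormed (Lp p M) (ae_class M (\<lambda>_. 0))"
proof -
  have 0: "(\<lambda>_. 0) \<in> Lp_functions p M" if "f \<in> Lp_functions p M" for f :: "'m \<Rightarrow> complex"
    using Lp_functions_scale[OF that, of 0] by simp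
  show ?thesis
    unfolding seminormed_def Lp_points
    using Lp_functions_add Lp_functions_scale 0
    by (auto simp: Lp_plus Lp_scale Lp_norm Lp_seminorm_eq)
qed

text \<open>Subspaces and quotients in either order lead to a composition of covering relations. Its
  last link ends at genuine functions, whose values at a point can be rotated.\<close>

lemma covers_subquotient_Lp:
  assumes "is_subspace_of_quotient Y (Lp p M) \<or> is_quotient_of_subspace Y (Lp p M)" "points Y = UNIV"
  shows "\<exists>R. covers Y (Lp_pre p M) R \<and> (\<forall>y f. R y f \<longrightarrow> f \<in> Lp_functions p M)"
proof -
  have "\<exists>R. covers Y (Lp p M) R" using assms(1)
  proof
    assume "is_subspace_of_quotient Y (Lp p M)"
    then obtain N U where N: "closed_subspace (Lp p M) N" and U: "closed_subspace (quotient_cspace (Lp p M) N) U"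
      and iso: "isometric Y (subspace_cspace (quotient_cspace (Lp p M) N) U)"
      unfolding is_subspace_of_quotient_def by blast
    obtain R where R: "covers Y (subspace_cspace (quotient_cspace (Lp p M) N) U) R"
      using covers_isometric[OF iso assms(2)] by blast
    from covers_trans[OF covers_trans[OF R covers_subspace[OF U]] covers_quotient[OF seminormed_Lp N]]
    show ?thesis by blast
  next
    assume "is_quotient_of_subspace Y (Lp p M)"
    then obtain U N where U: "closed_subspace (Lp p M) U" and N: "closed_subspace (subspace_cspace (Lp p M) U) N"
      and iso: "isometric Y (quotient_cspace (subspace_cspace (Lp p M) U) N)"
      unfolding is_quotient_of_subspace_def by blast
    obtain R where R: "covers Y (quotient_cspace (subspace_cspace (Lp p M) U) N) R"
      using covers_isometric[OF iso assms(2)] by blast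
    from covers_trans[OF covers_trans[OF R covers_quotient[OF seminormed_subspace[OF seminormed_Lp U] N]] covers_subspace[OF U]]
    show ?thesis by blast
  qed
  then obtain R where "covers Y (Lp p M) R" by blast
  from covers_trans[OF this covers_Lp] show ?thesis by blast
qed

text \<open>At each point, the sum of |F_i|^r is at most the power r / 2 of the sum of |F_i|^2. The
  isometry replaces F by f, and a power mean returns to r-th powers at the cost n^(r/2 - 1); both
  inequalities need r \<ge> 2. Integration bounds the sum of the r-th powers of the norms by n^(r/2)
  2^r, and a power mean over \<open>i\<close> adds the factor n^(1 - 1/r).\<close>

lemma rotated_Lp_norms_bound:
  fixes q :: "nat \<Rightarrow> nat \<Rightarrow> complex"
  assumes q: "\<And>f. (\<Sum>k<n. cmod (\<Sum>j<n. q k j * f j) ^ 2) = (\<Sum>j<n. cmod (f j) ^ 2)" and n: "n > 0"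
    and f: "\<And>j. f j \<in> Lp_functions p M" "\<And>j. Lp_seminorm p M (f j) \<le> 2"
  shows "(\<Sum>i<n. Lp_seminorm p M (\<lambda>x. \<Sum>j<n. q i j * f j x)) \<le> real n * (2 * real n powr (1 / 2 - 1 / r))"
proof -
  define F where "F = (\<lambda>i x. \<Sum>j<n. q i j * f j x)"
  have F: "F i \<in> Lp_functions p M" for i unfolding F_def by (rule Lp_functions_sum[OF f(1) f(1)])
  define I where "I = (\<lambda>g. \<integral>x. cmod (g x) powr r \<partial>M)"
  have I0: "I g \<ge> 0" for g by (simp add: I_def)
  have pw: "(\<Sum>i<n. cmod (F i x) powr r) \<le> real n powr (r / 2 - 1) * (\<Sum>j<n. cmod (f j x) powr r)" for x
  proof -
    have sq: "(cmod z ^ 2) powr (r / 2) = cmod z powr r" for z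
      by (cases "z = 0") (simp_all add: powr_powr flip: powr_numeral)
    have "(\<Sum>i<n. cmod (F i x) powr r) = (\<Sum>i<n. (cmod (F i x) ^ 2) powr (r / 2))" by (simp only: sq)
    also have "\<dots> \<le> (\<Sum>i<n. cmod (F i x) ^ 2) powr (r / 2)"
      using r by (intro sum_powr_le_powr_sum) auto
    also have "(\<Sum>i<n. cmod (F i x) ^ 2) = (\<Sum>j<n. cmod (f j x) ^ 2)"
      unfolding F_def by (rule q)
    also have "\<dots> powr (r / 2) \<le> real n powr (r / 2 - 1) * (\<Sum>j<n. (cmod (f j x) ^ 2) powr (r / 2))"
      using power_mean[of "{..<n}" "\<lambda>j. cmod (f j x) ^ 2" "r / 2"] r by simp
    finally show ?thesis by (simp only: sq)
  qed
  have Fint: "integrable M (\<lambda>x. cmod (F i x) powr r)" for i using F by (simp add: Lp_functions_iff)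
  have fint: "integrable M (\<lambda>x. cmod (f j x) powr r)" for j using f(1) by (simp add: Lp_functions_iff)
  have If: "I (f j) \<le> 2 powr r" for j
  proof -
    have "I (f j) = Lp_seminorm p M (f j) powr r" using r(2) I0[of "f j"] by (simp add: Lp_seminorm_eq I_def powr_powr)
    also have "\<dots> \<le> 2 powr r" using r(2) f(2)[of j] by (intro powr_mono2) (auto simp: Lp_seminorm_eq)
    finally show ?thesis .
  qed
  have "(\<Sum>i<n. I (F i)) = (\<integral>x. (\<Sum>i<n. cmod (F i x) powr r) \<partial>M)"
    unfolding I_def by (rule Bochner_Integration.integral_sum[symmetric]) (rule Fint)
  also have "\<dots> \<le> (\<integral>x. real n powr (r / 2 - 1) * (\<Sum>j<n. cmod (f j x) powr r) \<partial>M)"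
    using Fint fint pw by (intro integral_mono) auto
  also have "\<dots> = real n powr (r / 2 - 1) * (\<Sum>j<n. I (f j))"
    unfolding I_def using fint by (simp add: Bochner_Integration.integral_sum)
  also have "\<dots> \<le> real n powr (r / 2 - 1) * (\<Sum>j<n. 2 powr r)"
    using If by (intro mult_left_mono sum_mono) auto
  also have "\<dots> = real n powr (r / 2) * 2 powr r"
    using n by (simp add: powr_diff)
  finally have sumI: "(\<Sum>i<n. I (F i)) \<le> real n powr (r / 2) * 2 powr r" .
  define S where "S = (\<Sum>i<n. I (F i) powr (1 / r))"
  have S0: "S \<ge> 0" by (simp add: S_def sum_nonneg)
  have "S powr r \<le> real n powr (r - 1) * (\<Sum>i<n. (I (F i) powr (1 / r)) powr r)"
    using power_mean[of "{..<n}" "\<lambda>i. I (F i) powr (1 / r)" r] r by (simp add: S_def)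
  also have "(\<Sum>i<n. (I (F i) powr (1 / r)) powr r) = (\<Sum>i<n. I (F i))"
    using r I0 by (intro sum.cong refl) (simp add: powr_powr)
  also have "real n powr (r - 1) * (\<Sum>i<n. I (F i)) \<le> real n powr (r - 1) * (real n powr (r / 2) * 2 powr r)"
    using sumI by (intro mult_left_mono) auto
  also have "\<dots> = (real n * (2 * real n powr (1 / 2 - 1 / r))) powr r"
  proof -
    have "(real n * (2 * real n powr (1 / 2 - 1 / r))) powr r = real n powr r * 2 powr r * real n powr ((1 / 2 - 1 / r) * r)"
      by (simp add: powr_mult powr_powr)
    also have "(1 / 2 - 1 / r) * r = r / 2 - 1" using r by (simp add: field_simps)
    finally show ?thesis using n by (simp add: powr_diff)
  qed
  finally have "S powr r \<le> (real n * (2 * real n powr (1 / 2 - 1 / r))) powr r" .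
  then have "S \<le> real n * (2 * real n powr (1 / 2 - 1 / r))"
    using r S0 powr_less_mono2[of r "real n * (2 * real n powr (1 / 2 - 1 / r))" S] by force
  then show ?thesis by (simp add: S_def I_def F_def Lp_seminorm_eq)
qed

lemma determinant_bound_subquotient_Lp:
  fixes ty :: "'y::complex_banach itself"
  assumes "is_subspace_of_quotient (cspace_of_type ty) (Lp p M) \<or> is_quotient_of_subspace (cspace_of_type ty) (Lp p M)"
  shows "determinant_bound ty (1 / 2 - 1 / r)"
proof -
  obtain R where cov: "covers (cspace_of_type ty) (Lp_pre p M) R" and RL: "\<And>y f. R y f \<Longrightarrow> f \<in> Lp_functions p M"
    using covers_subquotient_Lp[OF assms] by (auto simp: cspace_of_type_def)
  have R1: "R y f \<Longrightarrow> norm y \<le> Lp_seminorm p M f"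
    and R2: "R y f \<Longrightarrow> R y' f' \<Longrightarrow> R (y + y') (\<lambda>x. f x + f' x)"
    and R3: "R y f \<Longrightarrow> R (c *\<^sub>C y) (\<lambda>x. c * f x)"
    and R4': "e > 0 \<Longrightarrow> \<exists>f\<in>Lp_functions p M. R y f \<and> Lp_seminorm p M f < norm y + e"
      for y y' f f' c and e :: real
    using cov unfolding covers_def by (simp_all add: cspace_of_type_def Lp_pre_def)
  have R4: "\<exists>f. R y f \<and> Lp_seminorm p M f < norm y + e" if "e > 0" for y e
    using R4'[OF that] by blast
  have R0: "R 0 (\<lambda>x. 0)"
  proof -
    obtain f where "R 0 f" using R4[of 1 0] by auto
    from R3[OF this, of 0] show ?thesis by (simp add: scaleC.zero_left)
  qed
  show ?thesis
  proof (rule determinant_boundI[of 2])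
    show "0 \<le> 1 / 2 - 1 / r" using r by (simp add: field_simps)
    fix n and \<phi> :: "nat \<Rightarrow> 'y \<Rightarrow> complex" and y :: "nat \<Rightarrow> 'y" and q :: "nat \<Rightarrow> nat \<Rightarrow> complex"
    assume n: "n > 0" and \<phi>: "\<And>i. bounded_clinear (\<phi> i)" "\<And>i v. cmod (\<phi> i v) \<le> norm v" and y: "\<And>j. norm (y j) \<le> 1"
      and q: "\<And>f. (\<Sum>k<n. cmod (\<Sum>j<n. q k j * f j) ^ 2) = (\<Sum>j<n. cmod (f j) ^ 2)"
    have "\<forall>j. \<exists>f. R (y j) f \<and> Lp_seminorm p M f < norm (y j) + 1" using R4[of 1] by auto
    \<comment> \<open>An excess of 1 over the norm of a unit ball vector is the origin of the
      constant K = 2.\<close>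
    then obtain f where f: "\<And>j. R (y j) (f j)" "\<And>j. Lp_seminorm p M (f j) < norm (y j) + 1"
      unfolding choice_iff by blast
    have f2: "Lp_seminorm p M (f j) \<le> 2" for j using f(2)[of j] y[of j] by linarith
    have sumR: "R (\<Sum>j<m. q i j *\<^sub>C y j) (\<lambda>x. \<Sum>j<m. q i j * f j x)" for i m
    proof (induction m)
      case 0
      then show ?case using R0 by simp
    next
      case (Suc m)
      then show ?case using R2[OF Suc R3[OF f(1)[of m], of "q i m"]] by simp
    qed
    \<comment> \<open>The entry is \<open>\<phi> i\<close> at the rotated vector, so it is bounded
      by the norm of that vector and hence by the norm of the rotated representative.\<close>
    have "cmod (\<Sum>j<n. \<phi> i (y j) * q i j) \<le> Lp_seminorm p M (\<lambda>x. \<Sum>j<n. q i j * f j x)" for i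
    proof -
      have "(\<Sum>j<n. \<phi> i (y j) * q i j) = \<phi> i (\<Sum>j<n. q i j *\<^sub>C y j)"
        by (simp add: bounded_clinear_simps[OF \<phi>(1)] bounded_clinear_scale_complex[OF \<phi>(1)] mult.commute)
      also have "cmod \<dots> \<le> norm (\<Sum>j<n. q i j *\<^sub>C y j)" by (rule \<phi>(2))
      also have "\<dots> \<le> Lp_seminorm p M (\<lambda>x. \<Sum>j<n. q i j * f j x)" by (rule R1[OF sumR])
      finally show ?thesis .
    qed
    then have "(\<Sum>i<n. cmod (\<Sum>j<n. \<phi> i (y j) * q i j)) \<le> (\<Sum>i<n. Lp_seminorm p M (\<lambda>x. \<Sum>j<n. q i j * f j x))"
      by (intro sum_mono)
    also have "\<dots> \<le> real n * (2 * real n powr (1 / 2 - 1 / r))"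
      by (rule rotated_Lp_norms_bound[OF q n RL[OF f(1)] f2])
    finally show "(\<Sum>i<n. cmod (\<Sum>j<n. \<phi> i (y j) * q i j)) \<le> real n * (2 * real n powr (1 / 2 - 1 / r))" .
  qed simp
qed

end

theorem corollary1:
  fixes s :: real and p :: ennreal and \<mu> :: "'m measure"
    and T :: "'y::complex_banach \<Rightarrow> 'y"
  assumes "2/3 \<le> s" and "s \<le> 1" and "2 \<le> p"
    and "1 / s = 1 + \<bar>1/2 - enn2real (1 / p)\<bar>"
    and "is_subspace_of_quotient (cspace_of_type TYPE('y)) (Lp p \<mu>) \<or>
         is_quotient_of_subspace (cspace_of_type TYPE('y)) (Lp p \<mu>)"
    and "nuclear s T"
  shows "central_symmetric_spectrum T \<longleftrightarrow>
    (\<forall>n::nat. n \<ge> 1 \<longrightarrow> nuclear_trace s (T ^^ (2 * n - 1)) = 0)"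
proof -
  define \<alpha> where "\<alpha> = \<bar>1/2 - enn2real (1 / p)\<bar>"
  have "determinant_bound TYPE('y) \<alpha>"
  proof (cases "p = \<infinity>")
    case True
    \<comment> \<open>Here 1 / p = 0, so \<alpha> = 1 / 2.\<close>
    then show ?thesis using determinant_bound_half[of "TYPE('y)"] by (simp add: \<alpha>_def)
  next
    case False
    define r where "r = enn2real p"
    have p: "p = ennreal r" using False by (simp add: r_def less_top)
    have r: "2 \<le> r"
    proof -
      have "ennreal 2 \<le> ennreal r" using assms(3) by (simp add: p)
      then show ?thesis by (subst (asm) ennreal_le_iff2) auto
    qed
    have "1 / p = ennreal (1 / r)" using divide_ennreal[of 1 r] r by (simp add: p)
    then have "\<alpha> = 1 / 2 - 1 / r" using r by (simp add: \<alpha>_def field_simps)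
    then show ?thesis using determinant_bound_subquotient_Lp[OF p r assms(5)] by simp
  qed
  then interpret determinant_space s \<alpha> "TYPE('y)"
    using assms by unfold_locales (auto simp: \<alpha>_def)
  show ?thesis by (rule central_symmetric_iff_odd_traces[OF assms(6)])
qed

end
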